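(* Let $\beta\in(0,1)$. For every $\lambda<0$, $T>0$ and $g\in C[0,T]$, $$\mathbb E_x\left[\int_0^{\tau_\infty}e^{\lambda s}g(S^c_s)\,ds\right]=\sum_{j=0}^\infty\lambda^j(I_0^\beta)^{j+1}g(x),\quad x\in(0,T].$$ Moreover, for all $\lambda\in\mathbb R$ and $x>0$, $$\mathbb E_x\big[e^{\lambda\tau_\infty}\big]=\sum_{N=0}^\infty\lambda^Nx^{\beta N}\prod_{n=1}^N\left(\frac{\Gamma(1+n\beta)}{\Gamma(n\beta+1-\beta)}-\frac{1}{\Gamma(1-\beta)}\right)^{-1},$$ where an empty product equals $1$.
   Context: Fix $\beta\in(0,1)$. $J_0^\beta g(x)=\int_0^x\frac{(x-r)^{\beta-1}}{\Gamma(\beta)}g(r)\,dr$ for $x>0$ and $J_0^\beta g(0)=0$. For $\psi\in C[0,T]$, $\mathcal K\psi(x)=\int_0^x\frac{(x-r)^{\beta-1}r^{-\beta}}{\Gamma(\beta)\Gamma(1-\beta)}\psi(r)\,dr$ for $x>0$, $\mathcal K\psi(0)=\psi(0)$. Define $I_0^\beta g=\sum_{j=0}^\infty\mathcal K^jJ_0^\beta g$ ($\mathcal K^0$ the identity); $(I_0^\beta)^{j}$ denotes the $j$-fold iterate. A $\beta$-stable subordinator is a (càdlàg) Lévy process $-S=\{-S_s\}_{s\ge0}$ started at $0$ with $\mathbb E[\exp\{kS_s\}]=\exp\{-sk^\beta\}$, $k,s>0$. Let $\{-S^j\}_{j\in\mathbb N}$ be i.i.d. $\beta$-stable subordinators.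 For a starting point $x>0$ define recursively $\tau_0=0$; $\widetilde S^1_t=x+S^1_t$; for $j\ge2$, $\widetilde S^j_t=\widetilde S^{j-1}_{\tau_{j-1}-}+S^j_{t-\tau_{j-1}}$; $\tau_j=\inf\{s>\tau_{j-1}:\widetilde S^j_s\le0\}$; $\tau_\infty=\lim_{j\to\infty}\tau_j$ (where $Y_{t-}$ denotes the left limit). The censored decreasing $\beta$-stable process started at $S^c_0=x$ is $S^c_t=\widetilde S^j_t$ for $\tau_{j-1}\le t<\tau_j$, $j\in\mathbb N$, and $S^c_t=\partial$ (a cemetery state) for $t\ge\tau_\infty$. $\mathbb E_x$ is expectation given $S^c_0=x$. *)

theory Defs
  imports "HOL-Probability.Probability"
begin

section \<open>Fractional integral operators\<close>

text \<open>
  All operators act on functions \<open>real \<Rightarrow> real\<close>; their values at \<open>x \<ge> 0\<close> depend only on the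
  restriction of the argument to \<open>[0,x]\<close>, so they also act on functions given on \<open>[0,T]\<close>.
  Values at \<open>x < 0\<close> are irrelevant.
\<close>

definition riemann_liouville :: "real \<Rightarrow> (real \<Rightarrow> real) \<Rightarrow> real \<Rightarrow> real" where
  "riemann_liouville \<beta> g x =
     (if x > 0 then LBINT r=0..x. (x - r) powr (\<beta> - 1) / Gamma \<beta> * g r else 0)"

definition censor_kernel :: "real \<Rightarrow> (real \<Rightarrow> real) \<Rightarrow> real \<Rightarrow> real" where
  "censor_kernel \<beta> \<psi> x =
     (if x > 0
      then LBINT r=0..x.
             (x - r) powr (\<beta> - 1) * r powr (- \<beta>) / (Gamma \<beta> * Gamma (1 - \<beta>)) * \<psi> r
      else \<psi> 0)"

definition censored_integral :: "real \<Rightarrow> (real \<Rightarrow> real) \<Rightarrow> real \<Rightarrow> real" where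
  "censored_integral \<beta> g x = (\<Sum>j. (censor_kernel \<beta> ^^ j) (riemann_liouville \<beta> g) x)"

section \<open>Stable subordinators\<close>

definition cadlag :: "(real \<Rightarrow> real) \<Rightarrow> bool" where
  "cadlag f \<longleftrightarrow>
     (\<forall>t\<ge>0. continuous (at_right t) f) \<and> (\<forall>t>0. \<exists>l. (f \<longlongrightarrow> l) (at_left t))"

text \<open>
  Only times \<open>t \<ge> 0\<close> matter. Stochastic continuity is not listed: it follows from
  right-continuity of the paths and stationarity of the increments.
\<close>

definition levy_process :: "'a measure \<Rightarrow> (real \<Rightarrow> 'a \<Rightarrow> real) \<Rightarrow> bool" where
  "levy_process M X \<longleftrightarrow>
     prob_space M \<and>
     (\<forall>t\<ge>0. X t \<in> borel_measurable M) \<and>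
     (AE \<omega> in M. X 0 \<omega> = 0) \<and>
     (\<forall>n. \<forall>t :: nat \<Rightarrow> real. 0 \<le> t 0 \<and> (\<forall>i<n. t i \<le> t (Suc i)) \<longrightarrow>
        prob_space.indep_vars M (\<lambda>_. borel) (\<lambda>i \<omega>. X (t (Suc i)) \<omega> - X (t i) \<omega>) {..<n}) \<and>
     (\<forall>s\<ge>0. \<forall>h\<ge>0. distr M borel (\<lambda>\<omega>. X (s + h) \<omega> - X s \<omega>) = distr M borel (X h)) \<and>
     (AE \<omega> in M. cadlag (\<lambda>t. X t \<omega>))"

definition stable_subordinator :: "real \<Rightarrow> 'a measure \<Rightarrow> (real \<Rightarrow> 'a \<Rightarrow> real) \<Rightarrow> bool" where
  "stable_subordinator \<beta> M U \<longleftrightarrow>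
     levy_process M U \<and>
     (\<forall>k>0. \<forall>s>0. integral\<^sup>L M (\<lambda>\<omega>. exp (- k * U s \<omega>)) = exp (- s * k powr \<beta>))"

text \<open>
  The processes are indexed by \<open>j \<ge> 1\<close>; each one is a random element of
  \<open>\<real>\<^bsup>[0,\<infinity>)\<^esup>\<close> with the product \<open>\<sigma>\<close>-algebra.
\<close>

definition iid_processes :: "'a measure \<Rightarrow> (nat \<Rightarrow> real \<Rightarrow> 'a \<Rightarrow> real) \<Rightarrow> bool" where
  "iid_processes M U \<longleftrightarrow>
     prob_space.indep_vars M (\<lambda>_. Pi\<^sub>M {0..} (\<lambda>_. borel))
       (\<lambda>j \<omega>. \<lambda>t\<in>{0..}. U j t \<omega>) {1..} \<and>
     (\<forall>i\<ge>1. \<forall>j\<ge>1. distr M (Pi\<^sub>M {0..} (\<lambda>_. borel)) (\<lambda>\<omega>. \<lambda>t\<in>{0..}. U i t \<omega>) =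
                    distr M (Pi\<^sub>M {0..} (\<lambda>_. borel)) (\<lambda>\<omega>. \<lambda>t\<in>{0..}. U j t \<omega>))"

section \<open>The censored process\<close>

text \<open>
  Pathwise construction: \<open>x\<close> is the starting point and \<open>p j t\<close> is the value at time \<open>t\<close> of the
  path of \<open>S\<^sup>j\<close>, \<open>j \<ge> 1\<close>. The times are extended reals because the infimum may be over the
  empty set; \<open>censored_stage x p j\<close> (for \<open>j \<ge> 1\<close>) is meaningful for \<open>t\<close> at or after
  \<open>censored_time x p (j - 1)\<close> when the latter is finite.
\<close>

function censored_time :: "real \<Rightarrow> (nat \<Rightarrow> real \<Rightarrow> real) \<Rightarrow> nat \<Rightarrow> ereal"
  and censored_stage :: "real \<Rightarrow> (nat \<Rightarrow> real \<Rightarrow> real) \<Rightarrow> nat \<Rightarrow> real \<Rightarrow> real" where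
  "censored_time x p 0 = 0"
| "censored_time x p (Suc j) =
     Inf {ereal s | s. censored_time x p j < ereal s \<and> censored_stage x p (Suc j) s \<le> 0}"
| "censored_stage x p 0 = undefined"
| "censored_stage x p (Suc 0) = (\<lambda>t. x + p 1 t)"
| "censored_stage x p (Suc (Suc j)) =
     (\<lambda>t. Lim (at_left (real_of_ereal (censored_time x p (Suc j)))) (censored_stage x p (Suc j))
          + p (Suc (Suc j)) (t - real_of_ereal (censored_time x p (Suc j))))"
  by pat_completeness auto
termination
  by (relation "Wellfounded.measure (case_sum (\<lambda>(x, p, j). 2 * j + 1) (\<lambda>(x, p, j). 2 * j))") auto

definition censored_lifetime :: "real \<Rightarrow> (nat \<Rightarrow> real \<Rightarrow> real) \<Rightarrow> ereal" where
  "censored_lifetime x p = lim (censored_time x p)"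

text \<open>The cemetery state is \<open>None\<close>.\<close>

definition censored_process :: "real \<Rightarrow> (nat \<Rightarrow> real \<Rightarrow> real) \<Rightarrow> real \<Rightarrow> real option" where
  "censored_process x p t =
     (if ereal t < censored_lifetime x p
      then Some (censored_stage x p
             (THE j. j \<ge> 1 \<and> censored_time x p (j - 1) \<le> ereal t \<and> ereal t < censored_time x p j) t)
      else None)"

text \<open>
  The integral up to the lifetime never sees the cemetery state, so the value chosen there is
  immaterial.
\<close>

definition discounted_integral ::
    "real \<Rightarrow> (real \<Rightarrow> real) \<Rightarrow> real \<Rightarrow> (nat \<Rightarrow> real \<Rightarrow> real) \<Rightarrow> real" where
  "discounted_integral lam g x p =
     (LBINT s=0..(censored_lifetime x p).
        exp (lam * s) * (case censored_process x p s of Some y \<Rightarrow> g y | None \<Rightarrow> 0))"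

text \<open>
  Path regularity of a Levy process is only required almost surely, and on the exceptional null
  set the path functionals above are arbitrary. Expectations of them are therefore taken with
  respect to \<open>completion M\<close>, on which they are genuine random variables; for \<open>M\<close>-measurable
  functions this is the same as the expectation under \<open>M\<close>.
\<close>

text \<open>\<open>e\<^sup>u\<close> for extended \<open>u\<close>, with \<open>e\<^bsup>-\<infinity>\<^esup> = 0\<close> and \<open>e\<^bsup>\<infinity>\<^esup> = \<infinity>\<close>.\<close>

definition exp_ereal :: "ereal \<Rightarrow> ennreal" where
  "exp_ereal u = (case u of ereal r \<Rightarrow> ennreal (exp r) | PInfty \<Rightarrow> \<infinity> | MInfty \<Rightarrow> 0)"

end

theory Submission
  imports Defs
begin


text \<open>
  Let \<open>U\<close> be a \<open>\<beta>\<close>-stable subordinator, \<open>T\<close> its first passage time over a level \<open>x\<close>, and \<open>L\<close> its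
  left limit at \<open>T\<close>. Two laws govern one stage of the construction: the weighted occupation measure
  \<open>\<integral> s\<^sup>m/m! P(U s \<in> dz) ds\<close>, and the joint law of \<open>(T, x - L)\<close>, which is tested against
  \<open>T\<^sup>m/m! f(x - L)\<close>. The first is found from its Laplace transform. For the second,
  \<open>n \<integral> s\<^sup>m/m! e\<^bsup>c U s\<^esup> 1(U s < x \<le> U (s + 1/n)) ds\<close> is the average of \<open>s\<^sup>m/m! e\<^bsup>c U s\<^esup>\<close> over the
  window \<open>[T - 1/n, T)\<close>. It converges to \<open>T\<^sup>m/m! e\<^bsup>c L\<^esup>\<close>, while its Laplace transform in \<open>x\<close> is
  explicit because the increments of \<open>U\<close> are independent. So no jump measure is needed.

  Both laws are fractional integrals, hence \<open>w\<^sub>n(x) = E \<integral> s\<^sup>n/n! f(S\<^sup>c) ds\<close> satisfies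
  \<open>w\<^sub>n = J w\<^bsub>n-1\<^esub> + K w\<^sub>n\<close> with \<open>w\<^bsub>-1\<^esub> = f\<close>, where \<open>J\<close> is the Riemann--Liouville integral.
  Counting only the first \<open>N\<close> stages gives the iteration that starts from \<open>0\<close>, so \<open>w\<^sub>n\<close> is the minimal
  solution \<open>I w\<^bsub>n-1\<^esub> = I\<^bsup>n+1\<^esup> f\<close>. For \<open>f = 1\<close> every \<open>I\<^bsup>n+1\<^esup> f\<close> is a power of \<open>x\<close>; this gives the
  moments of the lifetime and the summability that justifies expanding \<open>e\<^bsup>\<lambda> s\<^esup>\<close>.
\<close>

section \<open>Laplace transforms determine measures on the half line\<close>

text \<open>Everything is first done with nonnegative integrands in \<open>ennreal\<close>, where
  Fubini and monotone convergence need no integrability; signed functions enter only at the end, as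
  differences of two nonnegative ones. This is why the exponential is replaced by the weights
  s^n/n!: they are nonnegative, and as kernels of order n + 1 they lead to fractional integrals of
  order (n + 1) \<beta>.

  The delicate point is that Laplace inversion in the level x gives an identity only for almost
  every x, whereas the second inversion, in the undershoot, takes place at a fixed x. Testing with
  e^{c L}, c > 0, rather than e^{-c (x - L)} makes the functional nondecreasing in x; together with
  a scaling bound for the explicit side this yields the identity at every x > 0.

  Minimality matters because the operator K fixes constants, so u = J f + K u does not have a unique
  solution. On powers the Neumann series converges because J first makes the exponent positive, and
  K contracts x^s for s > 0.\<close>

lemma moments_unique:
  fixes M N :: "real measure"
  assumes "real_distribution M" "real_distribution N"
    and M01: "AE t in M. 0 \<le> t \<and> t \<le> 1" and N01: "AE t in N. 0 \<le> t \<and> t \<le> 1"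
    and moments: "\<And>n. (\<integral>t. t ^ n \<partial>M) = (\<integral>t. t ^ n \<partial>N)"
  shows "M = N"
proof (rule Levy_uniqueness[OF assms(1,2)], rule ext)
  \<comment> \<open>On [0,1] the n-th term is at most |u|^n/n!, so the exponential series may be
    integrated term by term.\<close>
  have expand: "char L u = (\<Sum>n. (\<i> * u) ^ n / fact n * complex_of_real (\<integral>t. t ^ n \<partial>L))"
    if L: "real_distribution L" "AE t in L. 0 \<le> t \<and> t \<le> 1" for L :: "real measure" and u
  proof -
    interpret L: real_distribution L by fact
    define f where "f n t = (\<i> * u) ^ n / fact n * complex_of_real (t ^ n)" for n :: nat and t
    have bnd: "norm (f n t) \<le> \<bar>u\<bar> ^ n / fact n" if "0 \<le> t \<and> t \<le> 1" for n t
      using that power_le_one[of t n]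
      by (auto simp: f_def norm_mult norm_divide norm_power intro!: mult_left_le divide_right_mono)
    have meas: "f n \<in> borel_measurable L" for n
      unfolding f_def by measurable
    have int: "integrable L (f n)" for n
      by (rule L.integrable_const_bound[OF _ meas]) (use L(2) bnd in auto)
    have sm: "summable (\<lambda>n. \<bar>u\<bar> ^ n / fact n)"
      using summable_exp_generic[of "\<bar>u\<bar>"] by (simp add: divide_inverse mult.commute)
    have 1: "char L u = (\<integral>t. (\<Sum>n. f n t) \<partial>L)"
      unfolding char_def
    proof (intro Bochner_Integration.integral_cong refl)
      fix t
      have "(\<lambda>n. (\<i> * (u * t)) ^ n /\<^sub>R fact n) sums exp (\<i> * (u * t))"
        by (rule exp_converges)
      then show "iexp (u * t) = (\<Sum>n. f n t)"
        by (auto simp: sums_iff f_def power_mult_distrib divide_inverse scaleR_conv_of_real mult_ac)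
    qed
    also have "\<dots> = (\<Sum>n. (\<integral>t. f n t \<partial>L))"
    proof (rule integral_suminf[OF int])
      show "AE t in L. summable (\<lambda>n. norm (f n t))"
        using L(2) by eventually_elim (intro summable_comparison_test'[OF sm], auto intro: bnd)
      show "summable (\<lambda>n. \<integral>t. norm (f n t) \<partial>L)"
      proof (rule summable_comparison_test'[OF sm])
        fix n
        have "(\<integral>t. norm (f n t) \<partial>L) \<le> (\<integral>t. \<bar>u\<bar> ^ n / fact n \<partial>L)"
          by (rule integral_mono_AE) (use int L(2) bnd in auto)
        then show "norm (\<integral>t. norm (f n t) \<partial>L) \<le> \<bar>u\<bar> ^ n / fact n"
          using L.prob_space by (simp add: L.space_eq_univ)
      qed
    qed
    also have "\<dots> = (\<Sum>n. (\<i> * u) ^ n / fact n * complex_of_real (\<integral>t. t ^ n \<partial>L))"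
      unfolding f_def integral_mult_right_zero integral_complex_of_real ..
    finally show ?thesis .
  qed
  show "char M u = char N u" for u
    using expand[OF assms(1) M01] expand[OF assms(2) N01] moments by simp
qed

text \<open>The substitution t = e^{-z} reduces the claim to moments on [0,1]: after weighting with
  e^{-z}/c, the n-th moment is the transform at n + 1 divided by c. Finiteness at 1 is what makes c
  a real normalising constant.\<close>

lemma laplace_unique:
  fixes M N :: "real measure"
  assumes sets [measurable_cong]: "sets M = sets borel" "sets N = sets borel"
    and M0: "AE z in M. 0 \<le> z" and N0: "AE z in N. 0 \<le> z"
    and eq: "\<And>q. 0 < q \<Longrightarrow> (\<integral>\<^sup>+z. ennreal (exp (- q * z)) \<partial>M) = (\<integral>\<^sup>+z. ennreal (exp (- q * z)) \<partial>N)"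
    and fin: "(\<integral>\<^sup>+z. ennreal (exp (- z)) \<partial>M) < \<infinity>"
  shows "M = N"
proof -
  define c where "c = enn2real (\<integral>\<^sup>+z. ennreal (exp (- z)) \<partial>M)"
  have cM: "(\<integral>\<^sup>+z. ennreal (exp (- z)) \<partial>M) = ennreal c"
    using fin by (simp add: c_def)
  have cN: "(\<integral>\<^sup>+z. ennreal (exp (- z)) \<partial>N) = ennreal c"
    using eq[of 1] cM by simp
  have "c \<ge> 0" by (simp add: c_def)
  define tilt where
    "tilt L = distr (density L (\<lambda>z. ennreal (exp (- z) / c))) borel (\<lambda>z. exp (- z))" for L :: "real measure"
  show ?thesis
  \<comment> \<open>If the transform vanishes at 1 there is nothing to normalise; both measures are
    then zero.\<close>
  proof (cases "c = 0")
    case True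
    have null: "emeasure L A = 0" if "sets L = sets borel" "(\<integral>\<^sup>+z. ennreal (exp (- z)) \<partial>L) = ennreal c"
      for L and A :: "real set"
    proof -
      note that(1)[measurable_cong]
      have "AE z in L. ennreal (exp (- z)) = 0"
        using that True by (subst nn_integral_0_iff_AE[symmetric]) auto
      then have "AE z in L. False" by eventually_elim simp
      then have "emeasure L (space L) = 0" by (simp add: AE_iff_measurable[OF _ refl])
      then show ?thesis
        by (metis emeasure_eq_0 emeasure_notin_sets sets.sets_into_space sets.top)
    qed
    show ?thesis
      by (rule measure_eqI) (simp_all add: sets null[OF sets(1) cM] null[OF sets(2) cN])
  next
    case False
    with \<open>c \<ge> 0\<close> have c: "c > 0" by simp
    \<comment> \<open>The tilting is invertible: z = - ln t, and the factor c/t undoes the density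
      e^{-z}/c.\<close>
    have recover: "emeasure L A = (\<integral>\<^sup>+t. indicator A (- ln t) * ennreal (c / t) \<partial>tilt L)"
      if L: "sets L = sets borel" and A: "A \<in> sets borel" for L A
    proof -
      note L[measurable_cong] A[measurable]
      have "(\<integral>\<^sup>+t. indicator A (- ln t) * ennreal (c / t) \<partial>tilt L)
          = (\<integral>\<^sup>+z. ennreal (exp (- z) / c) * (indicator A z * ennreal (c / exp (- z))) \<partial>L)"
        unfolding tilt_def
        by (subst nn_integral_distr, simp, simp, subst nn_integral_density) auto
      also have "\<dots> = (\<integral>\<^sup>+z. indicator A z \<partial>L)"
        using c by (intro nn_integral_cong)
          (auto simp: indicator_def ennreal_mult'[symmetric])
      finally show ?thesis using A L by simp
    qed
    have moment: "(\<integral>t. t ^ n \<partial>tilt L) = enn2real ((\<integral>\<^sup>+z. ennreal (exp (- (real n + 1) * z)) \<partial>L) / c)"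
      and AE01: "AE t in tilt L. 0 \<le> t \<and> t \<le> 1" 
      and prob: "real_distribution (tilt L)"
      if L: "sets L = sets borel" "AE z in L. 0 \<le> z"
        "(\<integral>\<^sup>+z. ennreal (exp (- z)) \<partial>L) = ennreal c" for L n
    proof -
      note L(1)[measurable_cong]
      show AE: "AE t in tilt L. 0 \<le> t \<and> t \<le> 1"
        unfolding tilt_def using L(2)
        by (subst AE_distr_iff, simp, simp, subst AE_density, auto)
      have "emeasure (density L (\<lambda>z. ennreal (exp (- z) / c))) (space L)
          = (\<integral>\<^sup>+z. ennreal (exp (- z)) * ennreal (1 / c) \<partial>L)"
        using c by (subst emeasure_density) (auto simp: ennreal_mult'[symmetric] intro!: nn_integral_cong)
      also have "\<dots> = 1"
        using c by (subst nn_integral_multc) (auto simp: L(3) ennreal_mult'[symmetric])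
      finally have "prob_space (density L (\<lambda>z. ennreal (exp (- z) / c)))"
        by (intro prob_spaceI) simp
      then show "real_distribution (tilt L)"
        unfolding tilt_def by (rule prob_space.real_distribution_distr) simp
      have "(\<integral>t. t ^ n \<partial>tilt L) = enn2real (\<integral>\<^sup>+t. ennreal (t ^ n) \<partial>tilt L)"
        by (intro integral_eq_nn_integral) (use AE in \<open>auto simp: tilt_def\<close>)
      also have "(\<integral>\<^sup>+t. ennreal (t ^ n) \<partial>tilt L) =
          (\<integral>\<^sup>+z. ennreal (exp (- z) / c) * ennreal (exp (- z) ^ n) \<partial>L)"
        unfolding tilt_def
        by (subst nn_integral_distr, simp, simp, subst nn_integral_density) auto
      also have "\<dots> = (\<integral>\<^sup>+z. ennreal (exp (- (real n + 1) * z)) * ennreal (1 / c) \<partial>L)"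
        using c by (intro nn_integral_cong)
         (auto simp: ennreal_mult'[symmetric] exp_of_nat_mult[symmetric] exp_add[symmetric] algebra_simps)
      also have "\<dots> = (\<integral>\<^sup>+z. ennreal (exp (- (real n + 1) * z)) \<partial>L) / c"
        using c by (subst nn_integral_multc) (auto simp: divide_ennreal_def inverse_ennreal inverse_eq_divide)
      finally show "(\<integral>t. t ^ n \<partial>tilt L) = enn2real ((\<integral>\<^sup>+z. ennreal (exp (- (real n + 1) * z)) \<partial>L) / c)" .
    qed
    have "tilt M = tilt N"
    proof (rule moments_unique)
      show "(\<integral>t. t ^ n \<partial>tilt M) = (\<integral>t. t ^ n \<partial>tilt N)" for n
        using eq[of "real n + 1"] by (simp add: moment sets M0 N0 cM cN)
    qed (rule prob[OF sets(1) M0 cM] prob[OF sets(2) N0 cN] AE01[OF sets(1) M0 cM] AE01[OF sets(2) N0 cN])+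
    then show ?thesis
      by (intro measure_eqI) (auto simp: sets recover)
  qed
qed

section \<open>Fractional integrals of nonnegative functions\<close>

text \<open>The cut-off at 0 lets every convolution run over the whole line, so substitutions and
  Fubini carry no moving limits. The Gamma normalisation gives the Laplace transform q^{-a}, hence
  orders add under convolution.\<close>

definition frac_kernel :: "real \<Rightarrow> real \<Rightarrow> real" where
  "frac_kernel a z = (if z > 0 then z powr (a - 1) / Gamma a else 0)"

lemma borel_measurable_frac_kernel [measurable]: "frac_kernel a \<in> borel_measurable borel"
  unfolding frac_kernel_def by measurable

lemma frac_kernel_nonneg [simp]: "a > 0 \<Longrightarrow> 0 \<le> frac_kernel a z"
  by (simp add: frac_kernel_def Gamma_real_pos less_imp_le)

lemma frac_kernel_laplace:
  assumes "a > 0" "q > 0"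
  shows "(\<integral>\<^sup>+z. ennreal (exp (- q * z) * frac_kernel a z) \<partial>lborel) = ennreal (q powr (- a))"
    (is "?lhs = _")
proof -
  have G: "Gamma a > 0" "Gamma a \<noteq> 0"
    using Gamma_real_pos[OF assms(1)] by auto
  have "?lhs
     = ennreal \<bar>1 / q\<bar> * (\<integral>\<^sup>+z. ennreal (exp (- q * (0 + 1 / q * z)) * frac_kernel a (0 + 1 / q * z))
         \<partial>lborel)"
    using assms by (intro nn_integral_real_affine) auto
  also have "\<dots> = ennreal (1 / q) *
      (\<integral>\<^sup>+z. ennreal (q powr (1 - a) / Gamma a)
      * ennreal (indicator {0..} z * z powr (a - 1) / exp z) \<partial>lborel)"
    using assms G
    by (intro arg_cong2[where f="(*)"] nn_integral_cong)
      (auto simp: frac_kernel_def indicator_def ennreal_mult'[symmetric] powr_divide zero_less_divide_iff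
         powr_minus powr_diff exp_minus field_simps)
  also have "\<dots> = ennreal (1 / q) * (ennreal (q powr (1 - a) / Gamma a) * Gamma a)"
    by (subst nn_integral_cmult) (auto simp: Gamma_conv_nn_integral_real[OF assms(1)])
  also have "\<dots> = ennreal (q powr (- a))"
    using assms G by (auto simp: ennreal_mult'[symmetric] powr_minus powr_diff field_simps)
  finally show ?thesis .
qed

text \<open>Putting y = x t leaves Euler's Beta integral. For x \<le> 0 one of the two factors
  vanishes at every y.\<close>

lemma frac_kernel_conv:
  assumes "a > 0" "b > 0"
  shows "(\<integral>\<^sup>+y. ennreal (frac_kernel a (x - y)) * ennreal (frac_kernel b y) \<partial>lborel)
      = ennreal (frac_kernel (a + b) x)"
    (is "?lhs = _")
proof (cases "x > 0")
  case True
  have G: "Gamma a > 0" "Gamma b > 0" "Gamma (a + b) > 0"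
    using assms by (auto intro!: Gamma_real_pos)
  then have G': "Gamma a \<noteq> 0" "Gamma b \<noteq> 0" "Gamma (a + b) \<noteq> 0"
    by auto
  \<comment> \<open>These are the powers of x released by the two kernels; the Jacobian supplies one
    more factor x.\<close>
  define C where "C = x powr (a + b - 2) / (Gamma a * Gamma b)"
  have "?lhs
     = ennreal \<bar>x\<bar> * (\<integral>\<^sup>+t. ennreal (frac_kernel a (x - (0 + x * t)))
         * ennreal (frac_kernel b (0 + x * t)) \<partial>lborel)"
    using True by (intro nn_integral_real_affine) auto
  also have "(\<integral>\<^sup>+t. ennreal (frac_kernel a (x - (0 + x * t))) * ennreal (frac_kernel b (0 + x * t)) \<partial>lborel)
     = (\<integral>\<^sup>+t. ennreal C * ennreal (indicator {0..1} t * (t powr (b - 1) * (1 - t) powr (a - 1))) \<partial>lborel)"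
  proof (intro nn_integral_cong, goal_cases)
    case (1 t)
    show ?case
    proof (cases "0 < t \<and> t < 1")
      case True
      then have t: "0 < t" "0 < 1 - t" by auto
      have "x - x * t = x * (1 - t)" by (simp add: algebra_simps)
      moreover have "x powr (a + b - 2) = x powr (a - 1) * x powr (b - 1)"
        by (simp add: powr_add[symmetric])
      ultimately show ?thesis using t G \<open>x > 0\<close>
        by (simp add: frac_kernel_def C_def ennreal_mult'[symmetric] powr_mult)
    next
      case False
      have "x * t < x \<longleftrightarrow> t < 1" using \<open>x > 0\<close> by simp
      then show ?thesis using \<open>x > 0\<close> False
        by (auto simp: frac_kernel_def indicator_def zero_less_mult_iff not_less)
    qed
  qed
  also have "\<dots> = ennreal C * Beta b a"
    using nn_integral_has_integral_lebesgue[OF _ has_integral_Beta_real[OF assms(2,1)]]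
    by (subst nn_integral_cmult) auto
  also have "ennreal \<bar>x\<bar> * (ennreal C * Beta b a) = ennreal (frac_kernel (a + b) x)"
    using True G G' assms
    by (auto simp: ennreal_mult'[symmetric] C_def frac_kernel_def Beta_def powr_diff field_simps
        power2_eq_square powr_add)
  finally show ?thesis .
next
  case False
  then have "frac_kernel a (x - y) = 0 \<or> frac_kernel b y = 0" for y
    by (auto simp: frac_kernel_def)
  then have "ennreal (frac_kernel a (x - y)) * ennreal (frac_kernel b y) = 0" for y
    by (metis ennreal_0 mult_zero_left mult_zero_right)
  then show ?thesis using False by (simp only: nn_integral_const) (simp add: frac_kernel_def)
qed


section \<open>Monotonicity and growth of Gamma quotients\<close>

lemma Gamma_real_nonzero [simp]: "0 < (x::real) \<Longrightarrow> Gamma x \<noteq> 0"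
  by (metis Gamma_real_pos less_irrefl)

lemma ennreal_mult_collect: "0 \<le> a \<Longrightarrow> ennreal a * (ennreal b * c) = ennreal (a * b) * c"
  by (simp add: ennreal_mult' mult.assoc)

text \<open>The logarithmic derivative of the quotient in z is Digamma (z + c) - Digamma z, which is
  positive because the trigamma function is.\<close>

lemma Gamma_ratio_strict_mono:
  fixes z w c :: real
  assumes "0 < c" "0 < z" "z < w"
  shows "Gamma (z + c) / Gamma z < Gamma (w + c) / Gamma w"
proof -
  have dig: "Digamma u < Digamma v" if "0 < u" "u < v" for u v :: real
  proof (rule DERIV_pos_imp_increasing[OF that(2)])
    fix y assume "u \<le> y" "y \<le> v"
    with that have "y > 0" by simp
    then have "(Digamma has_field_derivative Polygamma 1 y) (at y)"
      by (auto intro!: derivative_eq_intros simp: nonpos_Ints_def)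
    moreover have "Polygamma 1 y > 0"
      using \<open>y > 0\<close> by (intro Polygamma_real_odd_pos) (auto elim!: nonpos_Ints_cases)
    ultimately show "\<exists>l. (Digamma has_field_derivative l) (at y) \<and> 0 < l" by blast
  qed
  have "ln_Gamma (z + c) - ln_Gamma z < ln_Gamma (w + c) - ln_Gamma w"
  proof (rule DERIV_pos_imp_increasing[OF assms(3)])
    fix y assume "z \<le> y" "y \<le> w"
    then show "\<exists>l. ((\<lambda>y. ln_Gamma (y + c) - ln_Gamma y) has_field_derivative l) (at y) \<and> 0 < l"
      using assms dig[of y "y + c"]
      by (intro exI[of _ "Digamma (y + c) - Digamma y"]) (auto intro!: derivative_eq_intros)
  qed
  then have "exp (ln_Gamma (z + c) - ln_Gamma z) < exp (ln_Gamma (w + c) - ln_Gamma w)"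
    by simp
  then show ?thesis
    using assms by (simp add: exp_diff Gamma_real_pos_exp)
qed

text \<open>Log-convexity at t + 1 - c = (1 - c)(t + 1) + c t, combined with Gamma (t + 1) = t Gamma
  t. The bound shows that the factors of the lifetime series tend to infinity.\<close>

lemma Gamma_ratio_ge_powr:
  fixes t c :: real
  assumes "0 < c" "c < 1" "0 < t"
  shows "t powr c \<le> Gamma (t + 1) / Gamma (t + 1 - c)"
proof -
  have pos: "Gamma t > 0" "Gamma (t + 1) > 0" "Gamma (t + 1 - c) > 0"
    using assms by (auto intro!: Gamma_real_pos)
  have "(ln \<circ> Gamma) ((1 - c) *\<^sub>R (t + 1) + c *\<^sub>R t) \<le> (1 - c) * (ln \<circ> Gamma) (t + 1) + c * (ln \<circ> Gamma) t"
    using assms by (intro convex_onD[OF log_convex_Gamma_real]) auto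
  then have "ln (Gamma (t + 1 - c)) \<le> (1 - c) * ln (Gamma (t + 1)) + c * ln (Gamma t)"
    by (simp add: algebra_simps)
  moreover have "ln (Gamma (t + 1)) = ln t + ln (Gamma t)"
  proof -
    have "t \<notin> \<int>\<^sub>\<le>\<^sub>0" using assms by (auto elim!: nonpos_Ints_cases)
    then show ?thesis using assms pos by (simp add: Gamma_plus1 ln_mult)
  qed
  ultimately have "c * ln t \<le> ln (Gamma (t + 1)) - ln (Gamma (t + 1 - c))"
    by (simp add: algebra_simps)
  then have "exp (c * ln t) \<le> exp (ln (Gamma (t + 1)) - ln (Gamma (t + 1 - c)))"
    by simp
  then show ?thesis
    using assms pos by (simp add: powr_def exp_diff mult.commute)
qed

section \<open>Fractional integrals with values in \<open>ennreal\<close>\<close>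

definition frac_int :: "real \<Rightarrow> (real \<Rightarrow> ennreal) \<Rightarrow> real \<Rightarrow> ennreal" where
  "frac_int a f x = (\<integral>\<^sup>+y. ennreal (frac_kernel a (x - y)) * (f y * indicator {0<..} y) \<partial>lborel)"

lemma borel_measurable_frac_int [measurable]:
  assumes [measurable]: "f \<in> borel_measurable borel"
  shows "frac_int a f \<in> borel_measurable borel"
  unfolding frac_int_def by measurable

lemma frac_int_mono:
  "(\<And>y. 0 < y \<Longrightarrow> y < x \<Longrightarrow> f y \<le> g y) \<Longrightarrow> frac_int a f x \<le> frac_int a g x"
  unfolding frac_int_def
  by (intro nn_integral_mono) (auto simp: frac_kernel_def indicator_def intro: mult_left_mono)

lemma frac_int_cong:
  "(\<And>y. 0 < y \<Longrightarrow> y < x \<Longrightarrow> f y = g y) \<Longrightarrow> frac_int a f x = frac_int a g x"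
  by (intro antisym frac_int_mono) auto

lemma frac_int_zero [simp]: "frac_int a (\<lambda>_. 0) x = 0"
  by (simp add: frac_int_def)

lemma frac_int_nonpos: "x \<le> 0 \<Longrightarrow> frac_int a f x = 0"
  using frac_int_cong[of x f "\<lambda>_. 0" a] by simp

lemma frac_int_add:
  assumes [measurable]: "f \<in> borel_measurable borel" "g \<in> borel_measurable borel"
  shows "frac_int a (\<lambda>y. f y + g y) x = frac_int a f x + frac_int a g x"
  unfolding frac_int_def by (subst nn_integral_add[symmetric]) (auto simp: algebra_simps)

lemma frac_int_sum:
  assumes [measurable]: "\<And>i. i \<in> I \<Longrightarrow> f i \<in> borel_measurable borel"
  shows "frac_int a (\<lambda>y. \<Sum>i\<in>I. f i y) x = (\<Sum>i\<in>I. frac_int a (f i) x)"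
  unfolding frac_int_def by (subst nn_integral_sum[symmetric]) (auto simp: sum_distrib_left sum_distrib_right)

lemma frac_int_cmult:
  assumes [measurable]: "f \<in> borel_measurable borel"
  shows "frac_int a (\<lambda>y. c * f y) x = c * frac_int a f x"
  unfolding frac_int_def by (subst nn_integral_cmult[symmetric]) (auto simp: mult_ac)

lemma frac_int_SUP:
  assumes [measurable]: "\<And>i. f i \<in> borel_measurable borel" and inc: "incseq f"
  shows "frac_int a (\<lambda>y. SUP i. f i y) x = (SUP i. frac_int a (f i) x)"
proof -
  have "frac_int a (\<lambda>y. SUP i. f i y) x
      = (\<integral>\<^sup>+y. (SUP i. ennreal (frac_kernel a (x - y)) * (f i y * indicator {0<..} y)) \<partial>lborel)"
    unfolding frac_int_def
    by (intro nn_integral_cong) (simp add: SUP_mult_left_ennreal SUP_mult_right_ennreal)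
  also have "\<dots> = (SUP i. frac_int a (f i) x)"
    unfolding frac_int_def using inc
    by (intro nn_integral_monotone_convergence_SUP)
       (auto simp: incseq_def le_fun_def intro!: mult_left_mono mult_right_mono)
  finally show ?thesis .
qed

lemma frac_int_frac_int:
  assumes "a > 0" "b > 0" and [measurable]: "f \<in> borel_measurable borel"
  shows "frac_int a (frac_int b f) x = frac_int (a + b) f x"
proof -
  have "frac_int a (frac_int b f) x
     = (\<integral>\<^sup>+y. (\<integral>\<^sup>+z. ennreal (frac_kernel a (x - y)) * ennreal (frac_kernel b (y - z))
         * (f z * indicator {0<..} z) \<partial>lborel) \<partial>lborel)"
    unfolding frac_int_def
  proof (intro nn_integral_cong, goal_cases)
    case (1 y)
    have "(\<integral>\<^sup>+z. ennreal (frac_kernel b (y - z)) * (f z * indicator {0<..} z) \<partial>lborel) * indicator {0<..} y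
       = (\<integral>\<^sup>+z. ennreal (frac_kernel b (y - z)) * (f z * indicator {0<..} z) \<partial>lborel)"
    proof (cases "y > 0")
      case False
      then have "frac_int b f y = 0" by (simp add: frac_int_nonpos)
      then show ?thesis by (simp add: frac_int_def)
    qed simp
    then show ?case
      by (simp only: nn_integral_cmult[symmetric] mult.assoc)
         (subst nn_integral_cmult, auto simp: mult.assoc)
  qed
  also have "\<dots> = (\<integral>\<^sup>+z. (\<integral>\<^sup>+y. ennreal (frac_kernel a (x - y)) * ennreal (frac_kernel b (y - z))
      * (f z * indicator {0<..} z) \<partial>lborel) \<partial>lborel)"
    by (subst lborel_pair.Fubini') (auto simp: case_prod_beta)
  also have "\<dots> = frac_int (a + b) f x"
    unfolding frac_int_def
  proof (intro nn_integral_cong, goal_cases)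
    case (1 z)
    have "(\<integral>\<^sup>+y. ennreal (frac_kernel a (x - y)) * ennreal (frac_kernel b (y - z)) \<partial>lborel)
       = (\<integral>\<^sup>+y. ennreal (frac_kernel a (x - z - y)) * ennreal (frac_kernel b y) \<partial>lborel)"
      by (subst nn_integral_real_affine[where c=1 and t=z]) (auto simp: algebra_simps)
    also have "\<dots> = ennreal (frac_kernel (a + b) (x - z))"
      by (rule frac_kernel_conv[OF assms(1,2)])
    finally show ?case
      by (subst nn_integral_multc) auto
  qed
  finally show ?thesis .
qed

lemma frac_int_frac_kernel:
  assumes "a > 0" "b > 0"
  shows "frac_int a (\<lambda>y. ennreal (frac_kernel b y)) x = ennreal (frac_kernel (a + b) x)"
  unfolding frac_kernel_conv[OF assms, symmetric] frac_int_def
  by (intro nn_integral_cong) (auto simp: frac_kernel_def indicator_def)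

section \<open>The censoring operator and its Neumann series\<close>

definition censor_int :: "real \<Rightarrow> (real \<Rightarrow> ennreal) \<Rightarrow> real \<Rightarrow> ennreal" where
  "censor_int b f = frac_int b (\<lambda>y. ennreal (frac_kernel (1 - b) y) * f y)"

lemma borel_measurable_censor_int [measurable]:
  assumes [measurable]: "f \<in> borel_measurable borel"
  shows "censor_int b f \<in> borel_measurable borel"
  unfolding censor_int_def by measurable

lemma borel_measurable_censor_int_pow [measurable]:
  assumes [measurable]: "f \<in> borel_measurable borel"
  shows "(censor_int b ^^ i) f \<in> borel_measurable borel"
  by (induction i) auto

lemma censor_int_mono:
  "(\<And>y. 0 < y \<Longrightarrow> y < x \<Longrightarrow> f y \<le> g y) \<Longrightarrow> censor_int b f x \<le> censor_int b g x"
  unfolding censor_int_def by (intro frac_int_mono mult_left_mono) auto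

lemma censor_int_sum:
  assumes [measurable]: "\<And>i. i \<in> I \<Longrightarrow> f i \<in> borel_measurable borel"
  shows "censor_int b (\<lambda>y. \<Sum>i\<in>I. f i y) x = (\<Sum>i\<in>I. censor_int b (f i) x)"
  unfolding censor_int_def sum_distrib_left by (rule frac_int_sum) auto

lemma censor_int_cmult:
  assumes [measurable]: "f \<in> borel_measurable borel"
  shows "censor_int b (\<lambda>y. c * f y) x = c * censor_int b f x"
  unfolding censor_int_def mult.left_commute[of _ c] by (rule frac_int_cmult) auto

lemma censor_int_SUP:
  assumes [measurable]: "\<And>i. f i \<in> borel_measurable borel" and "incseq f"
  shows "censor_int b (\<lambda>y. SUP i. f i y) x = (SUP i. censor_int b (f i) x)"
  unfolding censor_int_def SUP_mult_left_ennreal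
  using assms by (intro frac_int_SUP) (auto simp: incseq_def le_fun_def intro!: mult_left_mono)

definition nn_censored_int :: "real \<Rightarrow> (real \<Rightarrow> ennreal) \<Rightarrow> real \<Rightarrow> ennreal" where
  "nn_censored_int b f x = (\<Sum>i. (censor_int b ^^ i) (frac_int b f) x)"

lemma borel_measurable_nn_censored_int [measurable]:
  assumes [measurable]: "f \<in> borel_measurable borel"
  shows "nn_censored_int b f \<in> borel_measurable borel"
  unfolding nn_censored_int_def by measurable

lemma borel_measurable_nn_censored_int_pow [measurable]:
  assumes [measurable]: "f \<in> borel_measurable borel"
  shows "(nn_censored_int b ^^ i) f \<in> borel_measurable borel"
  by (induction i) auto

lemma censor_int_pow_mono:
  assumes "\<And>y. y \<le> x \<Longrightarrow> f y \<le> g y"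
  shows "(censor_int b ^^ i) f x \<le> (censor_int b ^^ i) g x"
  using assms
proof (induction i arbitrary: x)
  case (Suc i)
  then show ?case by (auto intro!: censor_int_mono)
qed auto

lemma censor_int_pow_cmult:
  assumes [measurable]: "f \<in> borel_measurable borel"
  shows "(censor_int b ^^ i) (\<lambda>y. c * f y) x = c * (censor_int b ^^ i) f x"
proof (induction i arbitrary: x)
  case (Suc i)
  then have "(censor_int b ^^ i) (\<lambda>y. c * f y) = (\<lambda>x. c * (censor_int b ^^ i) f x)"
    by (rule ext)
  then show ?case by (simp add: censor_int_cmult)
qed simp

lemma nn_censored_int_cmult:
  assumes [measurable]: "f \<in> borel_measurable borel"
  shows "nn_censored_int b (\<lambda>y. c * f y) x = c * nn_censored_int b f x"
  unfolding nn_censored_int_def frac_int_cmult[OF assms, abs_def]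
  by (simp add: censor_int_pow_cmult)

lemma nn_censored_int_mono:
  assumes "\<And>y. 0 < y \<Longrightarrow> y \<le> x \<Longrightarrow> f y \<le> g y"
  shows "nn_censored_int b f x \<le> nn_censored_int b g x"
  unfolding nn_censored_int_def
  by (intro suminf_le censor_int_pow_mono frac_int_mono assms) auto

text \<open>The minimal nonnegative solution of \<open>u = J f + K u\<close>, reached by iteration from \<open>0\<close>.\<close>

lemma SUP_iteration_eq_nn_censored_int:
  assumes [measurable]: "\<And>N. B N \<in> borel_measurable borel" "\<And>N. F N \<in> borel_measurable borel"
    and incB: "incseq B" and incF: "incseq F"
    and zero: "B 0 = (\<lambda>_. 0)"
    and step: "\<And>N x. B (Suc N) x = frac_int b (F (Suc N)) x + censor_int b (B N) x"
  shows "(SUP N. B N x) = nn_censored_int b (\<lambda>y. SUP N. F N y) x"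
proof -
  define f where "f = (\<lambda>y. SUP N. F N y)"
  have [measurable]: "f \<in> borel_measurable borel" unfolding f_def by measurable
  define u where "u = (\<lambda>y. SUP N. B N y)"
  have [measurable]: "u \<in> borel_measurable borel" unfolding u_def by measurable
  have shift: "frac_int b f y + censor_int b (\<lambda>z. \<Sum>i<N. (censor_int b ^^ i) (frac_int b f) z) y
      = (\<Sum>i<Suc N. (censor_int b ^^ i) (frac_int b f) y)" for N y
    by (subst censor_int_sum, simp) (simp add: sum.lessThan_Suc_shift del: sum.lessThan_Suc)
  \<comment> \<open>Replacing the forcing by its supremum in every step bounds the iteration by the
    partial sums of the Neumann series.\<close>
  have upper: "B N y \<le> (\<Sum>i<N. (censor_int b ^^ i) (frac_int b f) y)" for N y
  proof (induction N arbitrary: y)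
    case (Suc N)
    have "B (Suc N) y \<le> frac_int b f y + censor_int b (\<lambda>z. \<Sum>i<N. (censor_int b ^^ i) (frac_int b f) z) y"
      unfolding step f_def using Suc
      by (intro add_mono frac_int_mono censor_int_mono) (auto simp: f_def intro: SUP_upper)
    then show ?case unfolding shift .
  qed (simp add: zero)
  \<comment> \<open>The forcing may vary with N because, for higher time weights, it is the N-stage
    expectation of the preceding order; monotone convergence passes both terms to the limit.\<close>
  have fixpoint: "u y = frac_int b f y + censor_int b u y" for y
  proof -
    have "u y = (SUP N. B (Suc N) y)"
    proof -
      have "B N y \<le> B (Suc N) y" for N using incB by (auto simp: incseq_Suc_iff le_fun_def)
      then have "(SUP N. B N y) = (SUP N. B (Suc N) y)"
        by (intro antisym SUP_mono) auto
      then show ?thesis by (simp add: u_def)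
    qed
    also have "\<dots> = (SUP N. frac_int b (F (Suc N)) y) + (SUP N. censor_int b (B N) y)"
      unfolding step using incF incB
      by (intro ennreal_SUP_add) (auto simp: incseq_def le_fun_def intro!: frac_int_mono censor_int_mono)
    also have "(SUP N. censor_int b (B N) y) = censor_int b u y"
      unfolding u_def by (intro censor_int_SUP[symmetric] incB) auto
    also have "(SUP N. frac_int b (F (Suc N)) y) = (SUP N. frac_int b (F N) y)"
    proof (rule antisym)
      show "(SUP N. frac_int b (F N) y) \<le> (SUP N. frac_int b (F (Suc N)) y)"
        using incF by (intro SUP_mono) (auto simp: incseq_Suc_iff le_fun_def intro!: frac_int_mono)
    qed (auto intro!: SUP_mono)
    also have "\<dots> = frac_int b f y"
      unfolding f_def by (intro frac_int_SUP[symmetric] incF) auto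
    finally show ?thesis .
  qed
  \<comment> \<open>Iterating the fixed-point equation and discarding the nonnegative remainder
    shows that a solution dominates every partial sum.\<close>
  have lower: "(\<Sum>i<N. (censor_int b ^^ i) (frac_int b f) y) \<le> u y" for N y
  proof (induction N arbitrary: y)
    case (Suc N)
    have "frac_int b f y + censor_int b (\<lambda>z. \<Sum>i<N. (censor_int b ^^ i) (frac_int b f) z) y \<le> u y"
      unfolding fixpoint[of y] using Suc by (intro add_left_mono censor_int_mono) auto
    then show ?case unfolding shift .
  qed simp
  have "u x = nn_censored_int b f x"
    unfolding nn_censored_int_def suminf_eq_SUP
  proof (rule antisym)
    show "u x \<le> (SUP N. \<Sum>i<N. (censor_int b ^^ i) (frac_int b f) x)"
      unfolding u_def by (intro SUP_mono) (auto intro: upper)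
    show "(SUP N. \<Sum>i<N. (censor_int b ^^ i) (frac_int b f) x) \<le> u x"
      by (intro SUP_least lower)
  qed
  then show ?thesis by (simp add: u_def f_def)
qed

section \<open>Powers as eigenfunctions of the censoring operator\<close>

definition pos_power :: "real \<Rightarrow> real \<Rightarrow> ennreal" where
  "pos_power s x = (if x > 0 then ennreal (x powr s) else 0)"

lemma borel_measurable_pos_power [measurable]: "pos_power s \<in> borel_measurable borel"
  unfolding pos_power_def by measurable

lemma pos_power_conv_frac_kernel:
  "s > -1 \<Longrightarrow> pos_power s x = ennreal (Gamma (s + 1)) * ennreal (frac_kernel (s + 1) x)"
  using Gamma_real_pos[of "s + 1"]
  by (auto simp: pos_power_def frac_kernel_def ennreal_mult'[symmetric])

lemma frac_int_pos_power:
  assumes "b > 0" "s > -1"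
  shows "frac_int b (pos_power s) x = ennreal (Gamma (s + 1) / Gamma (s + b + 1)) * pos_power (s + b) x"
proof -
  have "frac_int b (pos_power s) x
      = ennreal (Gamma (s + 1)) * frac_int b (\<lambda>y. ennreal (frac_kernel (s + 1) y)) x"
    unfolding pos_power_conv_frac_kernel[OF assms(2)] by (rule frac_int_cmult) auto
  also have "\<dots> = ennreal (Gamma (s + 1) / Gamma (s + b + 1)) * pos_power (s + b) x"
    using assms Gamma_real_pos[of "s + 1"] Gamma_real_pos[of "s + b + 1"]
    by (subst frac_int_frac_kernel, simp, simp, subst pos_power_conv_frac_kernel)
       (auto simp: ennreal_mult_collect add_ac)
  finally show ?thesis .
qed

text \<open>The eigenvalue of \<open>censor_int b\<close> on x^s. It equals 1 at s = 0 and lies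
  below 1 for s > 0.\<close>

definition censor_ratio :: "real \<Rightarrow> real \<Rightarrow> real" where
  "censor_ratio b s = Gamma (s + 1 - b) / (Gamma (1 - b) * Gamma (s + 1))"

lemma censor_int_pos_power:
  assumes "0 < b" "b < 1" "s \<ge> 0"
  shows "censor_int b (pos_power s) x = ennreal (censor_ratio b s) * pos_power s x"
proof -
  note pos = Gamma_real_pos[of "1 - b"] Gamma_real_pos[of "s + 1 - b"] Gamma_real_pos[of "s + 1"]
  have "censor_int b (pos_power s) x
      = frac_int b (\<lambda>y. ennreal (Gamma (s + 1 - b) / Gamma (1 - b)) * ennreal (frac_kernel (s + 1 - b) y)) x"
    unfolding censor_int_def using assms pos
    by (intro frac_int_cong)
       (auto simp: frac_kernel_def pos_power_def ennreal_mult'[symmetric] powr_add[symmetric] field_simps)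
  also have "\<dots> = ennreal (Gamma (s + 1 - b) / Gamma (1 - b)) * ennreal (frac_kernel (s + 1) x)"
    using assms by (subst frac_int_cmult, simp, subst frac_int_frac_kernel) auto
  also have "\<dots> = ennreal (censor_ratio b s) * pos_power s x"
    using assms pos
    by (subst pos_power_conv_frac_kernel) (auto simp: ennreal_mult_collect censor_ratio_def)
  finally show ?thesis .
qed

text \<open>The factor that the censored fractional derivative produces in mapping x^s to x^{s-b}:
  the Riemann-Liouville derivative of order b gives the first term, and the censoring term x^{-b} /
  Gamma (1 - b) is subtracted.\<close>

definition censor_factor :: "real \<Rightarrow> real \<Rightarrow> real" where
  "censor_factor b s = Gamma (1 + s) / Gamma (s + 1 - b) - 1 / Gamma (1 - b)"

text \<open>The subtracted term is the same Gamma quotient taken at s = 0, since Gamma 1 = 1; strict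
  monotonicity of the quotient gives the sign.\<close>

lemma censor_factor_pos:
  assumes "0 < b" "b < 1" "s > 0"
  shows "censor_factor b s > 0"
  using Gamma_ratio_strict_mono[of b "1 - b" "s + 1 - b"] assms
  by (simp add: censor_factor_def add.commute)

lemma censor_ratio_eq:
  assumes "0 < b" "b < 1" "s > 0"
  shows "1 - censor_ratio b s = Gamma (s + 1 - b) / Gamma (s + 1) * censor_factor b s"
  using Gamma_real_pos[of "1 - b"] Gamma_real_pos[of "s + 1 - b"] Gamma_real_pos[of "s + 1"] assms
  by (simp add: censor_ratio_def censor_factor_def field_simps)

text \<open>On powers the Neumann series is geometric: the fractional integral moves the exponent to
  t = s + b > 0, and each application of \<open>censor_int\<close> multiplies by
  \<open>censor_ratio b t\<close> < 1. By \<open>censor_ratio_eq\<close> the sum simplifies to the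
  inverse of \<open>censor_factor b t\<close>.\<close>

lemma nn_censored_int_pos_power:
  assumes "0 < b" "b < 1" "s \<ge> 0"
  shows "nn_censored_int b (pos_power s) x
      = ennreal (inverse (censor_factor b (s + b))) * pos_power (s + b) x"
proof -
  define t where "t = s + b"
  have t: "t > 0" using assms by (simp add: t_def)
  note pos = Gamma_real_pos[of "1 - b"] Gamma_real_pos[of "t + 1 - b"] Gamma_real_pos[of "t + 1"]
  have q: "0 \<le> censor_ratio b t" "censor_ratio b t < 1"
  proof -
    show "0 \<le> censor_ratio b t" using pos assms t by (simp add: censor_ratio_def)
    have "1 - censor_ratio b t > 0"
      using censor_ratio_eq[OF assms(1,2) t] censor_factor_pos[OF assms(1,2) t] pos assms t by simp
    then show "censor_ratio b t < 1" by simp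
  qed
  define d where "d = Gamma (t + 1 - b) / Gamma (t + 1)"
  have J: "frac_int b (pos_power s) = (\<lambda>x. ennreal d * pos_power t x)"
    using assms by (auto simp: frac_int_pos_power fun_eq_iff d_def t_def algebra_simps)
  have "(censor_int b ^^ i) (frac_int b (pos_power s))
      = (\<lambda>x. ennreal (d * censor_ratio b t ^ i) * pos_power t x)" for i
  proof (induction i)
    case (Suc i)
    show ?case
      unfolding funpow.simps o_apply Suc.IH fun_eq_iff using q
      by (subst censor_int_cmult, simp, subst censor_int_pos_power[OF assms(1,2)])
         (use t pos assms in \<open>auto simp: ennreal_mult_collect ennreal_mult'[symmetric] d_def mult_ac\<close>)
  qed (simp add: J)
  then have "nn_censored_int b (pos_power s) x = (\<Sum>i. ennreal (d * censor_ratio b t ^ i)) * pos_power t x"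
    unfolding nn_censored_int_def by simp
  also have "(\<Sum>i. ennreal (d * censor_ratio b t ^ i)) = ennreal (d * (1 / (1 - censor_ratio b t)))"
    using q pos assms t
    by (intro suminf_ennreal_eq sums_mult geometric_sums) (auto simp: d_def)
  also have "d * (1 / (1 - censor_ratio b t)) = inverse (censor_factor b t)"
    unfolding censor_ratio_eq[OF assms(1,2) t] d_def using assms t by (simp add: field_simps)
  finally show ?thesis by (simp add: t_def)
qed

lemma nn_censored_int_pow_one:
  assumes "0 < b" "b < 1"
  shows "(nn_censored_int b ^^ n) (pos_power 0) x
     = ennreal (\<Prod>k=1..n. inverse (censor_factor b (real k * b))) * pos_power (real n * b) x"
proof (induction n arbitrary: x)
  case (Suc n)
  then have IH: "(nn_censored_int b ^^ n) (pos_power 0) =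
      (\<lambda>x. ennreal (\<Prod>k=1..n. inverse (censor_factor b (real k * b))) * pos_power (real n * b) x)"
    by (rule ext)
  have "(\<Prod>k=1..n. inverse (censor_factor b (real k * b))) \<ge> 0"
    using assms by (intro prod_nonneg) (auto intro!: less_imp_le[OF censor_factor_pos])
  moreover have "inverse (censor_factor b (real (Suc n) * b)) > 0"
    using assms by (auto intro!: censor_factor_pos)
  ultimately show ?case
    unfolding funpow.simps o_apply IH using assms
    by (subst nn_censored_int_cmult, simp, subst nn_censored_int_pos_power)
       (auto simp: ennreal_mult_collect distrib_right add.commute)
qed simp


section \<open>First passage of nondecreasing paths\<close>

text \<open>
  Only rational times enter the next three functionals, which makes them measurable on the product
  space. For a subordinator path they are its value, its first passage time above \<open>x\<close>, and its left
  limit there.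
\<close>

definition path_val :: "(real \<Rightarrow> real) \<Rightarrow> real \<Rightarrow> real" where
  "path_val p s = enn2real (INF q\<in>\<rat> \<inter> {0..}. if s < q then ennreal (p q) else \<top>)"

definition path_time :: "(real \<Rightarrow> real) \<Rightarrow> real \<Rightarrow> real" where
  "path_time p x = enn2real (SUP q\<in>\<rat> \<inter> {0..}. if p q < x then ennreal q else 0)"

definition path_left :: "(real \<Rightarrow> real) \<Rightarrow> real \<Rightarrow> real" where
  "path_left p x = enn2real (SUP q\<in>\<rat> \<inter> {0..}. if p q < x then ennreal (p q) else 0)"

abbreviation path_space :: "(real \<Rightarrow> real) measure" where
  "path_space \<equiv> Pi\<^sub>M {0..} (\<lambda>_. borel)"

lemma countable_nonneg_rats: "countable (\<rat> \<inter> {0..} :: real set)"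
  by (rule countable_Int1[OF countable_rat])

lemma measurable_rational_coordinate:
  "q \<in> \<rat> \<inter> {0..} \<Longrightarrow> (\<lambda>z. fst z q) \<in> borel_measurable (path_space \<Otimes>\<^sub>M (borel :: real measure))"
  by (intro measurable_compose[OF measurable_fst measurable_component_singleton]) auto

lemma measurable_path_val [measurable]:
  "(\<lambda>z. path_val (fst z) (snd z)) \<in> borel_measurable (path_space \<Otimes>\<^sub>M borel)"
  unfolding path_val_def
proof (rule borel_measurable_enn2real, rule borel_measurable_INF[OF countable_nonneg_rats])
  fix q :: real assume "q \<in> \<rat> \<inter> {0..}"
  note [measurable] = measurable_rational_coordinate[OF this]
  show "(\<lambda>z. if snd z < q then ennreal (fst z q) else \<top>) \<in> borel_measurable (path_space \<Otimes>\<^sub>M borel)"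
    by measurable
qed

lemma measurable_path_time [measurable]:
  "(\<lambda>z. path_time (fst z) (snd z)) \<in> borel_measurable (path_space \<Otimes>\<^sub>M borel)"
  unfolding path_time_def
proof (rule borel_measurable_enn2real, rule borel_measurable_SUP[OF countable_nonneg_rats])
  fix q :: real assume "q \<in> \<rat> \<inter> {0..}"
  note [measurable] = measurable_rational_coordinate[OF this]
  show "(\<lambda>z. if fst z q < snd z then ennreal q else 0) \<in> borel_measurable (path_space \<Otimes>\<^sub>M borel)"
    by measurable
qed

lemma measurable_path_left [measurable]:
  "(\<lambda>z. path_left (fst z) (snd z)) \<in> borel_measurable (path_space \<Otimes>\<^sub>M borel)"
  unfolding path_left_def
proof (rule borel_measurable_enn2real, rule borel_measurable_SUP[OF countable_nonneg_rats])
  fix q :: real assume "q \<in> \<rat> \<inter> {0..}"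
  note [measurable] = measurable_rational_coordinate[OF this]
  show "(\<lambda>z. if fst z q < snd z then ennreal (fst z q) else 0) \<in> borel_measurable (path_space \<Otimes>\<^sub>M borel)"
    by measurable
qed

lemma measurable_path_val_compose [measurable (raw)]:
  assumes "f \<in> measurable M path_space" "g \<in> borel_measurable M"
  shows "(\<lambda>w. path_val (f w) (g w)) \<in> borel_measurable M"
    and "(\<lambda>w. path_time (f w) (g w)) \<in> borel_measurable M"
    and "(\<lambda>w. path_left (f w) (g w)) \<in> borel_measurable M"
  using measurable_compose[OF measurable_Pair[OF assms] measurable_path_val]
    measurable_compose[OF measurable_Pair[OF assms] measurable_path_time]
    measurable_compose[OF measurable_Pair[OF assms] measurable_path_left] by simp_all

lemma path_val_nonneg [simp]: "0 \<le> path_val p s" by (simp add: path_val_def)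
lemma path_time_nonneg [simp]: "0 \<le> path_time p x" by (simp add: path_time_def)
lemma path_left_nonneg [simp]: "0 \<le> path_left p x" by (simp add: path_left_def)

lemma path_left_le: "0 \<le> x \<Longrightarrow> path_left p x \<le> x"
  unfolding path_left_def
  by (intro enn2real_leI SUP_least) (auto intro: ennreal_leI)

text \<open>Unboundedness makes every passage time finite, and right-continuity lets the rational
  times determine the path.\<close>

definition subordinator_path :: "(real \<Rightarrow> real) \<Rightarrow> bool" where
  "subordinator_path p \<longleftrightarrow> p 0 = 0 \<and> mono_on {0..} p \<and>
     (\<forall>t\<ge>0. continuous (at_right t) p) \<and> (\<forall>a. \<exists>t\<ge>0. a < p t)"

context
  fixes p :: "real \<Rightarrow> real"
  assumes path: "subordinator_path p"
begin

lemma path_mono: "0 \<le> s \<Longrightarrow> s \<le> t \<Longrightarrow> p s \<le> p t"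
  using path by (auto simp: subordinator_path_def mono_on_def)

lemma path_nonneg: "0 \<le> s \<Longrightarrow> 0 \<le> p s"
  using path_mono[of 0 s] path by (simp add: subordinator_path_def)

lemma path_right_rat:
  assumes "0 \<le> s" "p s < a"
  obtains q where "q \<in> \<rat>" "s < q" "p q < a"
proof -
  have "(p \<longlongrightarrow> p s) (at_right s)"
    using path assms by (auto simp: subordinator_path_def continuous_within)
  then have "\<forall>\<^sub>F t in at_right s. p t < a"
    using assms by (intro order_tendstoD)
  then obtain b where "s < b" "\<And>t. s < t \<Longrightarrow> t < b \<Longrightarrow> p t < a"
    by (auto simp: eventually_at_right_field)
  moreover obtain q where "q \<in> \<rat>" "s < q" "q < b"
    using Rats_dense_in_real[OF \<open>s < b\<close>] by auto
  ultimately show thesis using that by blast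
qed

lemma path_val_eq:
  assumes "0 \<le> s"
  shows "path_val p s = p s"
proof -
  have "(INF q\<in>\<rat> \<inter> {0..}. if s < q then ennreal (p q) else \<top>) = ennreal (p s)"
  proof (rule antisym)
    show "ennreal (p s) \<le> (INF q\<in>\<rat> \<inter> {0..}. if s < q then ennreal (p q) else \<top>)"
      using assms by (intro INF_greatest) (auto intro!: ennreal_leI path_mono)
    show "(INF q\<in>\<rat> \<inter> {0..}. if s < q then ennreal (p q) else \<top>) \<le> ennreal (p s)"
    proof (rule ennreal_le_epsilon)
      fix e :: real assume "0 < e"
      then obtain q where q: "q \<in> \<rat>" "s < q" "p q < p s + e"
        using path_right_rat[OF assms, of "p s + e"] by auto
      have "(INF q\<in>\<rat> \<inter> {0..}. if s < q then ennreal (p q) else \<top>) \<le> ennreal (p q)"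
        using q assms by (intro INF_lower2[of q]) auto
      also have "\<dots> \<le> ennreal (p s + e)" using q by (intro ennreal_leI) auto
      also have "\<dots> = ennreal (p s) + ennreal e"
        using path_nonneg[OF assms] \<open>0 < e\<close> by simp
      finally show "(INF q\<in>\<rat> \<inter> {0..}. if s < q then ennreal (p q) else \<top>) \<le> ennreal (p s) + ennreal e" .
    qed
  qed
  then show ?thesis using path_nonneg[OF assms] by (simp add: path_val_def)
qed

text \<open>\<open>enn2real\<close> sends \<top> to 0, so finiteness is what makes the conversions
  in \<open>path_time\<close> and \<open>path_left\<close> faithful.\<close>

lemma path_SUP_finite:
  "(SUP q\<in>\<rat> \<inter> {0..}. if p q < x then ennreal q else 0) < \<top>"
  "(SUP q\<in>\<rat> \<inter> {0..}. if p q < x then ennreal (p q) else 0) < \<top>"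
proof -
  obtain t where t: "t \<ge> 0" "x < p t" using path by (auto simp: subordinator_path_def)
  have "q \<le> t" if "0 \<le> q" "p q < x" for q
    using path_mono[of t q] t that by force
  then have "(SUP q\<in>\<rat> \<inter> {0..}. if p q < x then ennreal q else 0) \<le> ennreal t"
    by (intro SUP_least) (auto intro!: ennreal_leI)
  then show "(SUP q\<in>\<rat> \<inter> {0..}. if p q < x then ennreal q else 0) < \<top>"
    using le_less_trans by fastforce
  have "(SUP q\<in>\<rat> \<inter> {0..}. if p q < x then ennreal (p q) else 0) \<le> ennreal x"
    by (intro SUP_least) (auto intro!: ennreal_leI)
  then show "(SUP q\<in>\<rat> \<inter> {0..}. if p q < x then ennreal (p q) else 0) < \<top>"
    using le_less_trans by fastforce
qed

lemma path_time_mono: "x \<le> y \<Longrightarrow> path_time p x \<le> path_time p y"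
  unfolding path_time_def
  by (intro enn2real_mono path_SUP_finite SUP_mono) (auto intro!: bexI)

lemma path_left_mono: "x \<le> y \<Longrightarrow> path_left p x \<le> path_left p y"
  unfolding path_left_def
  by (intro enn2real_mono path_SUP_finite SUP_mono) (auto intro!: bexI)

text \<open>By right-continuity the passage time itself already satisfies x \<le> p s, so the times
  strictly before passage are exactly those strictly below the level. This equivalence translates
  between windows in time and windows in space.\<close>

lemma less_path_time_iff:
  assumes "0 \<le> s"
  shows "s < path_time p x \<longleftrightarrow> p s < x"
proof -
  let ?S = "SUP q\<in>\<rat> \<inter> {0..}. if p q < x then ennreal q else 0"
  have S: "ennreal (path_time p x) = ?S"
    unfolding path_time_def using path_SUP_finite(1) by simp
  show ?thesis
  proof
    assume "s < path_time p x"
    then have "ennreal s < ?S" unfolding S[symmetric] using assms by (simp add: ennreal_less_iff)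
    then obtain q where "0 \<le> q" "ennreal s < (if p q < x then ennreal q else 0)"
      unfolding less_SUP_iff by blast
    then show "p s < x"
      using path_mono[of s q] assms by (auto split: if_splits simp: ennreal_less_iff)
  next
    assume "p s < x"
    then obtain q where q: "q \<in> \<rat>" "s < q" "p q < x" using path_right_rat[OF assms] by blast
    have "ennreal q \<le> ?S" using q assms by (intro SUP_upper2[of q]) auto
    then have "q \<le> path_time p x" unfolding S[symmetric] by simp
    with q show "s < path_time p x" by simp
  qed
qed

lemma path_time_pos: "0 < x \<Longrightarrow> 0 < path_time p x"
  using less_path_time_iff[of 0 x] path by (simp add: subordinator_path_def)

lemma path_le_left:
  assumes "0 \<le> s" "p s < x"
  shows "p s \<le> path_left p x"
proof -
  let ?S = "SUP q\<in>\<rat> \<inter> {0..}. if p q < x then ennreal (p q) else 0"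
  obtain q where q: "q \<in> \<rat>" "s < q" "p q < x" using path_right_rat[OF assms] by blast
  have "ennreal (p q) \<le> ?S" using q assms by (intro SUP_upper2[of q]) auto
  then have "p q \<le> path_left p x"
    unfolding path_left_def using path_SUP_finite(2)[of x] enn2real_mono[of "ennreal (p q)" ?S]
        path_nonneg[of q] q assms
    by simp
  with path_mono[of s q] q assms show ?thesis by simp
qed

lemma path_tendsto_left:
  assumes "0 < x"
  shows "(p \<longlongrightarrow> path_left p x) (at_left (path_time p x))"
proof -
  let ?S = "SUP q\<in>\<rat> \<inter> {0..}. if p q < x then ennreal (p q) else 0"
  have S: "ennreal (path_left p x) = ?S"
    unfolding path_left_def using path_SUP_finite(2) by simp
  have T: "0 < path_time p x" by (rule path_time_pos[OF assms])
  show ?thesis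
  proof (rule order_tendstoI)
    fix a assume a: "a < path_left p x"
    have "\<exists>s\<ge>0. s < path_time p x \<and> a < p s"
    proof (cases "a < 0")
      case True
      then show ?thesis using T path_nonneg[of 0] by (intro exI[of _ 0]) auto
    next
      case False
      with a have "ennreal a < ?S" unfolding S[symmetric] by (simp add: ennreal_less_iff)
      then obtain q where "0 \<le> q" "ennreal a < (if p q < x then ennreal (p q) else 0)"
        unfolding less_SUP_iff by blast
      then have "p q < x" "a < p q" using False by (auto split: if_splits simp: ennreal_less_iff)
      then show ?thesis using \<open>0 \<le> q\<close> less_path_time_iff[of q x] by auto
    qed
    then obtain s where s: "0 \<le> s" "s < path_time p x" "a < p s" by blast
    have "\<forall>\<^sub>F t in at_left (path_time p x). t \<in> {s<..<path_time p x}"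
      using s by (intro eventually_at_left_real)
    then show "\<forall>\<^sub>F t in at_left (path_time p x). a < p t"
    proof eventually_elim
      case (elim t)
      then show ?case using path_mono[of s t] s by auto
    qed
  next
    fix a assume a: "path_left p x < a"
    have "\<forall>\<^sub>F t in at_left (path_time p x). t \<in> {0<..<path_time p x}"
      using T by (intro eventually_at_left_real)
    then show "\<forall>\<^sub>F t in at_left (path_time p x). p t < a"
    proof eventually_elim
      case (elim t)
      then have "p t \<le> path_left p x"
        using less_path_time_iff[of t x] by (intro path_le_left) auto
      with a show ?case by simp
    qed
  qed
qed

end


section \<open>Stable subordinators and their potential measures\<close>

text \<open>Only right limits at t \<ge> 0 are taken, so values at negative times never enter. This
  permits passing from \<open>U\<close> to its restriction, which is \<open>undefined\<close>
  there.\<close>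

lemma subordinator_path_cong:
  assumes "\<And>t. 0 \<le> t \<Longrightarrow> p t = p' t"
  shows "subordinator_path p \<longleftrightarrow> subordinator_path p'"
proof -
  have "continuous (at_right t) p \<longleftrightarrow> continuous (at_right t) p'" if "t \<ge> 0" for t
  proof -
    have "\<forall>\<^sub>F s in at_right t. p s = p' s"
      using assms that eventually_at_right_less[of t] by (auto elim!: eventually_mono)
    then show ?thesis
      using assms[OF that] unfolding continuous_within by (simp add: tendsto_cong)
  qed
  moreover have "(\<exists>t\<ge>0. a < p t) \<longleftrightarrow> (\<exists>t\<ge>0. a < p' t)" for a
    using assms by metis
  ultimately show ?thesis
    using assms by (simp add: subordinator_path_def mono_on_def)
qed

locale subordinator =
  fixes \<beta> :: real and M :: "'a measure" and U :: "real \<Rightarrow> 'a \<Rightarrow> real"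
  assumes beta: "0 < \<beta>" "\<beta> < 1" and stable: "stable_subordinator \<beta> M U"
begin

lemma levy: "levy_process M U"
  using stable by (simp add: stable_subordinator_def)

sublocale prob_space M
  using levy by (simp add: levy_process_def)

lemma measurable_U [measurable]: "t \<ge> 0 \<Longrightarrow> U t \<in> borel_measurable M"
  using levy by (simp add: levy_process_def)

lemma U_0: "AE \<omega> in M. U 0 \<omega> = 0"
  using levy by (simp add: levy_process_def)

lemma U_stationary:
  "0 \<le> s \<Longrightarrow> 0 \<le> h \<Longrightarrow> distr M borel (\<lambda>\<omega>. U (s + h) \<omega> - U s \<omega>) = distr M borel (U h)"
  using levy unfolding levy_process_def by blast

lemma U_laplace:
  assumes "k > 0" "s \<ge> 0"
  shows "(\<integral>\<^sup>+\<omega>. ennreal (exp (- k * U s \<omega>)) \<partial>M) = ennreal (exp (- s * k powr \<beta>))"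
    (is "?lhs = _")
proof (cases "s = 0")
  case True
  have "?lhs = (\<integral>\<^sup>+\<omega>. 1 \<partial>M)"
    using U_0 by (intro nn_integral_cong_AE) (auto simp: True)
  then show ?thesis by (simp add: True emeasure_space_1)
next
  case False
  then have E: "(\<integral>\<omega>. exp (- k * U s \<omega>) \<partial>M) = exp (- s * k powr \<beta>)"
    using assms stable by (simp add: stable_subordinator_def)
  \<comment> \<open>A nonintegrable function has Bochner integral 0, but the value here is an
    exponential.\<close>
  then have "integrable M (\<lambda>\<omega>. exp (- k * U s \<omega>))"
    using not_integrable_integral_eq by force
  then show ?thesis
    using E by (subst nn_integral_eq_integral) auto
qed

text \<open>The Laplace transform is at most 1 for every k > 0, while e^{-k U} increases to infinity
  with k wherever U < 0. Monotone convergence leaves no mass there.\<close>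

lemma U_nonneg:
  assumes "s \<ge> 0"
  shows "AE \<omega> in M. 0 \<le> U s \<omega>"
proof -
  note [measurable] = measurable_U[OF assms]
  \<comment> \<open>The shift to k + 1 keeps the argument of the Laplace transform positive.\<close>
  define F where "F k \<omega> = (if U s \<omega> < 0 then ennreal (exp (- (real k + 1) * U s \<omega>)) else 0)" for k \<omega>
  have [measurable]: "F k \<in> borel_measurable M" for k unfolding F_def by measurable
  have "(\<integral>\<^sup>+\<omega>. (SUP k. F k \<omega>) \<partial>M) = (SUP k. (\<integral>\<^sup>+\<omega>. F k \<omega> \<partial>M))"
    by (rule nn_integral_monotone_convergence_SUP)
       (auto simp: F_def incseq_def le_fun_def intro!: ennreal_leI mult_right_mono_neg)
  also have "\<dots> \<le> 1"
  proof (rule SUP_least)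
    fix k
    have "(\<integral>\<^sup>+\<omega>. F k \<omega> \<partial>M) \<le> (\<integral>\<^sup>+\<omega>. ennreal (exp (- (real k + 1) * U s \<omega>)) \<partial>M)"
      by (intro nn_integral_mono) (auto simp: F_def)
    also have "\<dots> \<le> 1" using assms by (subst U_laplace) auto
    finally show "(\<integral>\<^sup>+\<omega>. F k \<omega> \<partial>M) \<le> 1" .
  qed
  finally have "(\<integral>\<^sup>+\<omega>. (SUP k. F k \<omega>) \<partial>M) \<noteq> \<infinity>" by (auto simp: top_unique)
  then have "AE \<omega> in M. (SUP k. F k \<omega>) \<noteq> \<infinity>"
    by (intro nn_integral_noteq_infinite) auto
  then show ?thesis
  proof eventually_elim
    case (elim \<omega>)
    show ?case
    proof (rule ccontr)
      assume neg: "\<not> 0 \<le> U s \<omega>"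
      obtain r where r: "(SUP k. F k \<omega>) = ennreal r" "r \<ge> 0" using elim by (cases "SUP k. F k \<omega>") auto
      obtain k where "r < real k * (- U s \<omega>)"
        using reals_Archimedean3[of "- U s \<omega>"] neg by auto
      also have "\<dots> \<le> (real k + 1) * (- U s \<omega>)" using neg by (intro mult_right_mono) auto
      also have "\<dots> < exp (- (real k + 1) * U s \<omega>)"
        using exp_ge_add_one_self[of "- (real k + 1) * U s \<omega>"] by linarith
      finally have "ennreal r < F k \<omega>"
        using neg r(2) by (simp add: F_def ennreal_less_iff)
      also have "F k \<omega> \<le> ennreal r" unfolding r(1)[symmetric] by (rule SUP_upper) simp
      finally show False by simp
    qed
  qed
qed

lemma U_increasing:
  assumes "0 \<le> s" "s \<le> t"
  shows "AE \<omega> in M. U s \<omega> \<le> U t \<omega>"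
proof -
  have [measurable]: "U s \<in> borel_measurable M" "U t \<in> borel_measurable M" "U (t - s) \<in> borel_measurable M"
    using assms by auto
  have D: "distr M borel (\<lambda>\<omega>. U t \<omega> - U s \<omega>) = distr M borel (U (t - s))"
    using U_stationary[of s "t - s"] assms
        by (simp only: add_diff_cancel_left' diff_ge_0_iff_ge add.commute[of s] diff_add_cancel)
  have "AE z in distr M borel (U (t - s)). 0 \<le> z"
    using U_nonneg[of "t - s"] assms by (subst AE_distr_iff) auto
  then have "AE \<omega> in M. 0 \<le> U t \<omega> - U s \<omega>"
    unfolding D[symmetric] by (subst (asm) AE_distr_iff) auto
  then show ?thesis by simp
qed

lemma increment_laplace:
  assumes "k > 0" "s \<ge> 0" "h \<ge> 0"
  shows "(\<integral>\<^sup>+\<omega>. ennreal (exp (- k * (U (s + h) \<omega> - U s \<omega>))) \<partial>M) = ennreal (exp (- h * k powr \<beta>))"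
    (is "?lhs = _")
proof -
  have [measurable]: "U s \<in> borel_measurable M" "U (s + h) \<in> borel_measurable M" "U h \<in> borel_measurable M"
    using assms by auto
  have "?lhs
     = (\<integral>\<^sup>+z. ennreal (exp (- k * z)) \<partial>distr M borel (\<lambda>\<omega>. U (s + h) \<omega> - U s \<omega>))"
    by (subst nn_integral_distr) auto
  also have "distr M borel (\<lambda>\<omega>. U (s + h) \<omega> - U s \<omega>) = distr M borel (U h)"
    using assms by (intro U_stationary)
  also have "(\<integral>\<^sup>+z. ennreal (exp (- k * z)) \<partial>distr M borel (U h)) = ennreal (exp (- h * k powr \<beta>))"
    using U_laplace[OF assms(1,3)] by (subst nn_integral_distr) simp_all
  finally show ?thesis .
qed

lemma increment_laplace_product:
  assumes "q > 0" "k > 0" "s \<ge> 0" "h \<ge> 0"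
  shows "(\<integral>\<^sup>+\<omega>. ennreal (exp (- q * U s \<omega>)) * ennreal (exp (- k * (U (s + h) \<omega> - U s \<omega>))) \<partial>M)
    = ennreal (exp (- s * q powr \<beta>)) * ennreal (exp (- h * k powr \<beta>))"
    (is "?lhs = _")
proof -
  have [measurable]: "U s \<in> borel_measurable M" "U (s + h) \<in> borel_measurable M" "U 0 \<in> borel_measurable M"
    using assms by auto
  \<comment> \<open>The increments over 0, s, s + h are independent, and the first is U s because U
    0 = 0 almost surely.\<close>
  define t where "t i = (if i = 0 then 0 else if i = 1 then s else s + h)" for i :: nat
  have "\<forall>i<2. t i \<le> t (Suc i)" using assms by (auto simp: t_def less_2_cases_iff)
  moreover have "0 \<le> t 0" by (simp add: t_def)
  ultimately have "indep_vars (\<lambda>_. borel) (\<lambda>i \<omega>. U (t (Suc i)) \<omega> - U (t i) \<omega>) {..<2}"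
    using levy unfolding levy_process_def by blast
  define G where "G i = (if i = 0 then (\<lambda>z. ennreal (exp (- q * z))) else (\<lambda>z. ennreal (exp (- k * z))))"
      for i :: nat
  have "indep_vars (\<lambda>_. borel) (\<lambda>i \<omega>. G i (U (t (Suc i)) \<omega> - U (t i) \<omega>)) {..<2}"
    by (rule indep_vars_compose2[OF \<open>indep_vars _ _ {..<2}\<close>]) (auto simp: G_def)
  then have "(\<integral>\<^sup>+\<omega>. (\<Prod>i\<in>{..<2}. G i (U (t (Suc i)) \<omega> - U (t i) \<omega>)) \<partial>M)
      = (\<Prod>i\<in>{..<2}. (\<integral>\<^sup>+\<omega>. G i (U (t (Suc i)) \<omega> - U (t i) \<omega>) \<partial>M))"
    by (intro indep_vars_nn_integral) auto
  moreover have two: "{..<2} = {0, 1::nat}" by auto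
  moreover have "(\<integral>\<^sup>+\<omega>. G 0 (U s \<omega> - U 0 \<omega>) * G 1 (U (s + h) \<omega> - U s \<omega>) \<partial>M)
     = ?lhs"
    using U_0 by (intro nn_integral_cong_AE) (auto simp: G_def)
  moreover have "(\<integral>\<^sup>+\<omega>. G 0 (U s \<omega> - U 0 \<omega>) \<partial>M) = (\<integral>\<^sup>+\<omega>. ennreal (exp (- q * U s \<omega>)) \<partial>M)"
    using U_0 by (intro nn_integral_cong_AE) (auto simp: G_def)
  moreover have "(\<integral>\<^sup>+\<omega>. G 1 (U (s + h) \<omega> - U s \<omega>) \<partial>M) = ennreal (exp (- h * k powr \<beta>))"
    using increment_laplace[OF assms(2-4)] by (simp add: G_def)
  moreover have "(\<integral>\<^sup>+\<omega>. ennreal (exp (- q * U s \<omega>)) \<partial>M) = ennreal (exp (- s * q powr \<beta>))"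
    using U_laplace[OF assms(1,3)] .
  ultimately show ?thesis by (simp add: t_def)
qed

text \<open>By Markov's inequality for e^{-U}, the probability of staying below m at all integer
  times is at most e^{m-n} for every n.\<close>

lemma U_unbounded: "AE \<omega> in M. \<forall>a. \<exists>t\<ge>0. a < U t \<omega>"
proof -
  have "AE \<omega> in M. \<exists>n::nat. real m < U (real n) \<omega>" for m :: nat
  proof -
    let ?A = "{\<omega>\<in>space M. \<forall>n::nat. U (real n) \<omega> \<le> real m}"
    have [measurable]: "?A \<in> sets M" by measurable
    have bound: "emeasure M ?A \<le> ennreal (exp (real m - real n))" for n :: nat
    proof -
      have "emeasure M ?A = (\<integral>\<^sup>+\<omega>. indicator ?A \<omega> \<partial>M)" by simp
      also have "\<dots> \<le> (\<integral>\<^sup>+\<omega>. ennreal (exp (real m)) * ennreal (exp (- 1 * U (real n) \<omega>)) \<partial>M)"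
        by (intro nn_integral_mono) (auto simp: indicator_def ennreal_mult'[symmetric] exp_add[symmetric])
      also have "\<dots> = ennreal (exp (real m)) * ennreal (exp (- real n))"
        by (subst nn_integral_cmult, simp, subst U_laplace) auto
      finally show ?thesis by (simp add: ennreal_mult'[symmetric] exp_add[symmetric])
    qed
    have "(\<lambda>n. ennreal (exp (real m - real n))) \<longlonglongrightarrow> ennreal 0"
      by (intro tendsto_ennrealI) real_asymp
    then have "emeasure M ?A \<le> ennreal 0"
      by (rule LIMSEQ_le_const) (use bound in auto)
    then have "emeasure M ?A = 0" by simp
    then have "AE \<omega> in M. \<omega> \<notin> ?A" by (intro AE_not_in) (auto simp: null_sets_def)
    then show ?thesis by (auto simp: not_le)
  qed
  then have "AE \<omega> in M. \<forall>m. \<exists>n::nat. real m < U (real n) \<omega>"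
    by (subst AE_all_countable) auto
  then show ?thesis
  proof eventually_elim
    case (elim \<omega>)
    show ?case
    proof
      fix a :: real
      obtain m :: nat where "a < real m" using reals_Archimedean2 by blast
      with elim show "\<exists>t\<ge>0. a < U t \<omega>" by (metis of_nat_0_le_iff order.strict_trans)
    qed
  qed
qed

text \<open>Monotonicity holds outside one null set for all rational times together;
  right-continuity then extends it to all times, since a violation would be inherited by nearby
  rationals on the right.\<close>

lemma U_path: "AE \<omega> in M. subordinator_path (\<lambda>t. U t \<omega>)"
proof -
  have "AE \<omega> in M. cadlag (\<lambda>t. U t \<omega>)" using levy by (simp add: levy_process_def)
  moreover have "AE \<omega> in M. \<forall>s\<in>\<rat> \<inter> {0..}. \<forall>t\<in>\<rat> \<inter> {0..}. s \<le> t \<longrightarrow> U s \<omega> \<le> U t \<omega>"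
    by (intro AE_ball_countable' countable_nonneg_rats) (auto intro: U_increasing)
  ultimately show ?thesis
    using U_0 U_unbounded
  proof eventually_elim
    case (elim \<omega>)
    have cont: "((\<lambda>t. U t \<omega>) \<longlongrightarrow> U s \<omega>) (at_right s)" if "s \<ge> 0" for s
      using elim(1) that by (auto simp: cadlag_def continuous_within)
    have near: "\<exists>q\<in>\<rat>. s < q \<and> q < s' \<and> P (U q \<omega>)" if lt: "s < s'" and ev: "\<forall>\<^sub>F t in at_right s. P (U t \<omega>)"
        for s s' :: real and P
    proof -
      obtain b where "s < b" "\<And>t. s < t \<Longrightarrow> t < b \<Longrightarrow> P (U t \<omega>)"
        using ev by (auto simp: eventually_at_right_field)
      moreover obtain q where "q \<in> \<rat>" "s < q" "q < min b s'"
        using Rats_dense_in_real[of s "min b s'"] \<open>s < b\<close> lt by auto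
      ultimately show ?thesis by auto
    qed
    have "U s \<omega> \<le> U t \<omega>" if "0 \<le> s" and st: "s < t" for s t
    proof (rule ccontr)
      assume "\<not> U s \<omega> \<le> U t \<omega>"
      then have less: "U t \<omega> < U s \<omega>" by simp
      have "\<forall>\<^sub>F r in at_right t. U r \<omega> < U s \<omega>"
        using cont[of t] that less by (intro order_tendstoD) auto
      then obtain r where r: "r \<in> \<rat>" "t < r" "U r \<omega> < U s \<omega>"
        using near[of t "t + 1" "\<lambda>u. u < U s \<omega>"] by auto
      have "\<forall>\<^sub>F q in at_right s. U r \<omega> < U q \<omega>"
        using cont[of s] that r by (intro order_tendstoD) auto
      then obtain q where q: "q \<in> \<rat>" "s < q" "q < t" "U r \<omega> < U q \<omega>"
        using near[OF st, of "\<lambda>u. U r \<omega> < u"] by auto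
      then have "U q \<omega> \<le> U r \<omega>" using elim(2) r that by auto
      with q show False by simp
    qed
    then have "mono_on {0..} (\<lambda>t. U t \<omega>)"
      by (intro mono_onI) (metis atLeast_iff order.order_iff_strict)
    then show ?case
      using elim cont by (auto simp: subordinator_path_def continuous_within)
  qed
qed

definition X :: "'a \<Rightarrow> real \<Rightarrow> real" where
  "X \<omega> = (\<lambda>t\<in>{0..}. U t \<omega>)"

lemma measurable_X [measurable]: "X \<in> measurable M path_space"
  unfolding X_def by (rule measurable_restrict) auto

lemma X_path: "AE \<omega> in M. subordinator_path (X \<omega>)"
  using U_path by (rule AE_mp) (auto simp: X_def cong: subordinator_path_cong)

text \<open>\<open>U\<close> is only known to be measurable at each fixed time.
  \<open>path_val\<close> of the path is jointly measurable in time and \<omega>, as Fubini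
  requires, and outside one null set it agrees with \<open>U\<close> at all times.\<close>

lemma X_val: "AE \<omega> in M. \<forall>s\<ge>0. path_val (X \<omega>) s = U s \<omega>"
  using X_path by eventually_elim (simp add: path_val_eq X_def)

text \<open>The transform of the left side is the integral of the kernel of order a against e^{-s
  q^\<beta>}, that is (q^\<beta>)^{-a}, and q^{-a \<beta>} is the transform of the kernel of order a
  \<beta>.\<close>

lemma potential_measure:
  assumes "a > 0"
  shows "distr (density (lborel \<Otimes>\<^sub>M M) (\<lambda>z. ennreal (frac_kernel a (fst z)))) borel
      (\<lambda>z. path_val (X (snd z)) (fst z)) = density lborel (\<lambda>z. ennreal (frac_kernel (a * \<beta>) z))"
    (is "?L = ?R")
proof (rule laplace_unique)
  have lap: "(\<integral>\<^sup>+z. ennreal (exp (- q * z)) \<partial>?L) = ennreal (q powr (- (a * \<beta>)))" if "q > 0" for q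
  proof -
    have "(\<integral>\<^sup>+z. ennreal (exp (- q * z)) \<partial>?L)
      = (\<integral>\<^sup>+z. ennreal (frac_kernel a (fst z))
          * ennreal (exp (- q * path_val (X (snd z)) (fst z))) \<partial>(lborel \<Otimes>\<^sub>M M))"
      by (subst nn_integral_distr, simp, simp, subst nn_integral_density) auto
    also have "\<dots> = (\<integral>\<^sup>+s. \<integral>\<^sup>+\<omega>. ennreal (frac_kernel a s)
        * ennreal (exp (- q * path_val (X \<omega>) s)) \<partial>M \<partial>lborel)"
      by (subst nn_integral_fst[symmetric]) auto
    also have "\<dots> = (\<integral>\<^sup>+s. ennreal (exp (- (q powr \<beta>) * s) * frac_kernel a s) \<partial>lborel)"
    proof (intro nn_integral_cong, goal_cases)
      case (1 s)
      show ?case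
      proof (cases "s > 0")
        case True
        have "(\<integral>\<^sup>+\<omega>. ennreal (exp (- q * path_val (X \<omega>) s)) \<partial>M) = (\<integral>\<^sup>+\<omega>. ennreal (exp (- q * U s \<omega>)) \<partial>M)"
        proof (intro nn_integral_cong_AE)
          show "AE \<omega> in M. ennreal (exp (- q * path_val (X \<omega>) s)) = ennreal (exp (- q * U s \<omega>))"
            using X_val by eventually_elim (use True in simp)
        qed
        also have "\<dots> = ennreal (exp (- s * q powr \<beta>))"
          using True that by (intro U_laplace) auto
        finally show ?thesis using assms
          by (subst nn_integral_cmult) (auto simp: ennreal_mult'[symmetric] mult_ac)
      qed (simp add: frac_kernel_def)
    qed
    also have "\<dots> = ennreal (q powr (- (a * \<beta>)))"
      using assms that by (subst frac_kernel_laplace) (auto simp: powr_powr mult_ac)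
    finally show ?thesis .
  qed
  show "(\<integral>\<^sup>+z. ennreal (exp (- q * z)) \<partial>?L) = (\<integral>\<^sup>+z. ennreal (exp (- q * z)) \<partial>?R)"
    if "q > 0" for q
  proof -
    have "(\<integral>\<^sup>+z. ennreal (exp (- q * z)) \<partial>?R)
        = (\<integral>\<^sup>+z. ennreal (exp (- q * z) * frac_kernel (a * \<beta>) z) \<partial>lborel)"
      using assms beta
      by (subst nn_integral_density) (auto simp: ennreal_mult'[symmetric] mult.commute intro!:
          nn_integral_cong)
    also have "\<dots> = ennreal (q powr (- (a * \<beta>)))"
      using assms beta that by (intro frac_kernel_laplace) auto
    finally show ?thesis unfolding lap[OF that] ..
  qed
  show "(\<integral>\<^sup>+z. ennreal (exp (- z)) \<partial>?L) < \<infinity>"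
    using lap[of 1] by simp
  show "AE z in ?L. 0 \<le> z"
    by (subst AE_distr_iff) auto
  show "AE z in ?R. 0 \<le> z"
    by (subst AE_density) (auto simp: frac_kernel_def)
qed auto

text \<open>The reflection y = x - z turns the potential density into the kernel, and survival z < x
  becomes the cut-off y > 0.\<close>

lemma occupation_formula:
  assumes "a > 0" and [measurable]: "f \<in> borel_measurable borel"
  shows "(\<integral>\<^sup>+\<omega>. \<integral>\<^sup>+s. ennreal (frac_kernel a s) *
      (if path_val (X \<omega>) s < x then f (x - path_val (X \<omega>) s) else 0) \<partial>lborel \<partial>M) = frac_int (a * \<beta>) f x"
proof -
  define h where "h z = (if z < x then f (x - z) else 0)" for z
  have [measurable]: "h \<in> borel_measurable borel" unfolding h_def by measurable
  interpret pair_sigma_finite lborel M by standard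
  have "(\<integral>\<^sup>+\<omega>. \<integral>\<^sup>+s. ennreal (frac_kernel a s) * h (path_val (X \<omega>) s) \<partial>lborel \<partial>M)
    = (\<integral>\<^sup>+z. h z \<partial>distr (density (lborel \<Otimes>\<^sub>M M) (\<lambda>z. ennreal (frac_kernel a (fst z)))) borel
      (\<lambda>z. path_val (X (snd z)) (fst z)))"
    by (subst nn_integral_distr, simp, simp, subst nn_integral_density, simp, simp, subst
        nn_integral_snd[symmetric])
       auto
  also have "\<dots> = (\<integral>\<^sup>+z. ennreal (frac_kernel (a * \<beta>) z) * h z \<partial>lborel)"
    unfolding potential_measure[OF assms(1)] by (subst nn_integral_density) auto
  also have "\<dots> = frac_int (a * \<beta>) f x"
    unfolding frac_int_def
    by (subst nn_integral_real_affine[where c="-1" and t=x])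
       (auto intro!: nn_integral_cong simp: h_def indicator_def)
  finally show ?thesis by (simp add: h_def)
qed

end


section \<open>The joint law of first passage time and undershoot\<close>

text \<open>Because the dominating function is the limit itself, Fatou's lemma gives the lower bound
  and monotonicity the upper one; the limit may have infinite integral.\<close>

lemma nn_integral_LIMSEQ_dominated_by_limit:
  fixes f :: "nat \<Rightarrow> 'a \<Rightarrow> ennreal"
  assumes [measurable]: "\<And>n. f n \<in> borel_measurable M" "g \<in> borel_measurable M"
    and le: "\<And>n. AE x in M. f n x \<le> g x"
    and lim: "AE x in M. (\<lambda>n. f n x) \<longlonglongrightarrow> g x"
  shows "(\<lambda>n. \<integral>\<^sup>+x. f n x \<partial>M) \<longlonglongrightarrow> (\<integral>\<^sup>+x. g x \<partial>M)"
proof -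
  have int_le: "(\<integral>\<^sup>+x. f n x \<partial>M) \<le> (\<integral>\<^sup>+x. g x \<partial>M)" for n
    using le by (rule nn_integral_mono_AE)
  have "(\<integral>\<^sup>+x. g x \<partial>M) = (\<integral>\<^sup>+x. liminf (\<lambda>n. f n x) \<partial>M)"
    using lim by (intro nn_integral_cong_AE) (auto elim!: eventually_mono dest: lim_imp_Liminf[rotated])
  also have "\<dots> \<le> liminf (\<lambda>n. \<integral>\<^sup>+x. f n x \<partial>M)"
    by (rule nn_integral_liminf) auto
  finally have lower: "(\<integral>\<^sup>+x. g x \<partial>M) \<le> liminf (\<lambda>n. \<integral>\<^sup>+x. f n x \<partial>M)" .
  have "limsup (\<lambda>n. \<integral>\<^sup>+x. f n x \<partial>M) \<le> (\<integral>\<^sup>+x. g x \<partial>M)"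
    using int_le by (intro Limsup_bounded) auto
  moreover have "liminf (\<lambda>n. \<integral>\<^sup>+x. f n x \<partial>M) \<le> limsup (\<lambda>n. \<integral>\<^sup>+x. f n x \<partial>M)"
    by (intro Liminf_le_Limsup) auto
  ultimately show ?thesis
    using lower by (intro Liminf_eq_Limsup) auto
qed

text \<open>The source of the restriction 1 \<le> a in the passage results: the exponent a - 1 must
  be nonnegative for the window averages to be squeezed.\<close>

lemma frac_kernel_mono:
  "1 \<le> a \<Longrightarrow> s \<le> t \<Longrightarrow> frac_kernel a s \<le> frac_kernel a t"
  using Gamma_real_pos[of a]
  by (auto simp: frac_kernel_def intro!: divide_right_mono powr_mono2)

lemma nn_integral_exp_Ioc:
  fixes k u v :: real
  assumes "k > 0" "u \<le> v"
  shows "(\<integral>\<^sup>+x. ennreal (exp (- k * x)) * indicator {u<..v} x \<partial>lborel)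
      = ennreal ((exp (- k * u) - exp (- k * v)) / k)"
    (is "?lhs = _")
proof -
  have "?lhs
      = (\<integral>\<^sup>+x. ennreal (exp (- k * x)) * indicator {u..v} x \<partial>lborel)"
    by (intro nn_integral_cong_AE eventually_mono[OF AE_lborel_singleton[of u]]) (auto simp: indicator_def)
  also have "\<dots> = ennreal (- exp (- k * v) / k - (- exp (- k * u) / k))"
    using assms by (intro nn_integral_FTC_Icc) (auto intro!: derivative_eq_intros)
  finally show ?thesis by (simp add: diff_divide_distrib)
qed

text \<open>
  The times \<open>s\<close> with \<open>p s < x \<le> p (s + 1/(n+1))\<close> form the window of length \<open>1/(n+1)\<close> that ends at the
  first passage time.
\<close>

definition path_window :: "real \<Rightarrow> real \<Rightarrow> nat \<Rightarrow> (real \<Rightarrow> real) \<Rightarrow> real \<Rightarrow> ennreal" where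
  "path_window a c n p x = (\<integral>\<^sup>+s. ennreal (real (Suc n) * frac_kernel a s * exp (c * path_val p s)) *
      indicator {path_val p s<..path_val p (s + 1 / Suc n)} x \<partial>lborel)"

lemma measurable_path_window [measurable (raw)]:
  assumes [measurable]: "f \<in> measurable N path_space" "g \<in> borel_measurable N"
  shows "(\<lambda>w. path_window a c n (f w) (g w)) \<in> borel_measurable N"
  unfolding path_window_def indicator_def greaterThanAtMost_iff by measurable

text \<open>Before the passage time T both the kernel and e^{c p s} are nondecreasing. The average
  over [T - 1/(n+1), T) is therefore at most the limiting value and, once the window starts after 0,
  at least the value at its left end, which converges to that limit.\<close>

lemma path_window_tendsto:
  assumes path: "subordinator_path p" and x: "0 < x" and a: "1 \<le> a" and c: "0 \<le> c"
  defines "W \<equiv> \<lambda>n. path_window a c n p x"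
    and "g \<equiv> ennreal (frac_kernel a (path_time p x) * exp (c * path_left p x))"
  shows "W n \<le> g" and "W \<longlonglongrightarrow> g"
proof -
  define T where "T = path_time p x"
  define d where "d n = 1 / real (Suc n)" for n
  have d: "d n > 0" for n by (simp add: d_def)
  have T: "T > 0" unfolding T_def by (rule path_time_pos[OF path x])
  have in_window: "x \<in> {path_val p s<..path_val p (s + d n)} \<longleftrightarrow> T - d n \<le> s \<and> s < T" if "0 < s" for s n
    using less_path_time_iff[OF path, of s x] less_path_time_iff[OF path, of "s + d n" x] that d[of n]
    by (auto simp: path_val_eq[OF path] T_def not_less[symmetric])
  have W: "W n = (\<integral>\<^sup>+s. ennreal (real (Suc n) * frac_kernel a s * exp (c * path_val p s)) *
      indicator {T - d n..<T} s \<partial>lborel)" for n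
    unfolding W_def path_window_def
  proof (intro nn_integral_cong, goal_cases)
    case (1 s)
    show ?case
    proof (cases "0 < s")
      case True
      then show ?thesis using in_window[OF True, of n] by (simp add: indicator_def d_def)
    qed (simp add: frac_kernel_def)
  qed
  have window_measure: "(\<integral>\<^sup>+s. ennreal (real (Suc n) * K) * indicator {T - d n..<T} s \<partial>lborel)
      = ennreal K" if "K \<ge> 0" for n K
    using d[of n] that by (subst nn_integral_cmult) (auto simp: ennreal_mult'[symmetric] d_def)
  show upper: "W n \<le> g" for n
  proof -
    have "W n \<le> (\<integral>\<^sup>+s. ennreal (real (Suc n) * (frac_kernel a T * exp (c * path_left p x)))
        * indicator {T - d n..<T} s \<partial>lborel)"
      unfolding W
    proof (intro nn_integral_mono, goal_cases)
      case (1 s)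
      show ?case
      proof (cases "0 < s \<and> s < T")
        case True
        then have "p s \<le> path_left p x"
          using less_path_time_iff[OF path, of s x] by (intro path_le_left[OF path]) (auto simp: T_def)
        then have "frac_kernel a s * exp (c * path_val p s) \<le> frac_kernel a T * exp (c * path_left p x)"
          using True a c by (intro mult_mono frac_kernel_mono)
              (auto simp: path_val_eq[OF path] mult_left_mono)
        then show ?thesis
          by (intro mult_right_mono ennreal_leI) (simp_all add: mult.assoc mult_left_mono)
      qed (auto simp: frac_kernel_def indicator_def)
    qed
    also have "\<dots> = g" unfolding g_def T_def[symmetric] using a by (intro window_measure) auto
    finally show ?thesis .
  qed
  define w where "w n = frac_kernel a (T - d n) * exp (c * p (T - d n))" for n
  have d0: "d \<longlonglongrightarrow> 0" unfolding d_def by (rule LIMSEQ_Suc) (rule lim_1_over_n)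
  \<comment> \<open>For small n the window may begin before time 0, where the path is not
    controlled.\<close>
  then have evT: "\<forall>\<^sub>F n in sequentially. d n < T" using T by (intro order_tendstoD)
  have lower: "\<forall>\<^sub>F n in sequentially. ennreal (w n) \<le> W n"
    using evT
  proof eventually_elim
    case (elim n)
    have "ennreal (w n) = (\<integral>\<^sup>+s. ennreal (real (Suc n) * w n) * indicator {T - d n..<T} s \<partial>lborel)"
      using a by (intro window_measure[symmetric]) (simp add: w_def)
    also have "\<dots> \<le> W n" unfolding W
    proof (intro nn_integral_mono, goal_cases)
      case (1 s)
      have "w n \<le> frac_kernel a s * exp (c * path_val p s)" if "T - d n \<le> s"
        unfolding w_def using that elim a c
        by (intro mult_mono frac_kernel_mono)
          (auto simp: path_val_eq[OF path] intro!: mult_left_mono path_mono[OF path])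
      then show ?case by (auto simp: indicator_def mult.assoc intro!: ennreal_leI mult_left_mono)
    qed
    finally show ?case .
  qed
  have "filterlim (\<lambda>n. T - d n) (at_left T) sequentially"
    unfolding filterlim_at using d by (auto intro!: tendsto_eq_intros d0 always_eventually simp: less_imp_neq)
  then have "(\<lambda>n. p (T - d n)) \<longlonglongrightarrow> path_left p x"
    using path_tendsto_left[OF path x] unfolding T_def by (rule filterlim_compose[rotated])
  moreover have "(\<lambda>n. frac_kernel a (T - d n)) \<longlonglongrightarrow> frac_kernel a T"
  proof -
    have "(\<lambda>n. (T - d n) powr (a - 1) / Gamma a) \<longlonglongrightarrow> (T - 0) powr (a - 1) / Gamma a"
      using T a by (intro tendsto_intros d0) auto
    moreover have "\<forall>\<^sub>F n in sequentially. (T - d n) powr (a - 1) / Gamma a = frac_kernel a (T - d n)"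
      using evT by eventually_elim (simp add: frac_kernel_def)
    ultimately show ?thesis using T by (simp add: frac_kernel_def tendsto_cong)
  qed
  ultimately have "(\<lambda>n. ennreal (w n)) \<longlonglongrightarrow> g"
    unfolding w_def g_def T_def[symmetric] by (intro tendsto_intros)
  then show "W \<longlonglongrightarrow> g"
    using lower upper by (intro tendsto_sandwich[OF lower _ _ tendsto_const]) auto
qed


context subordinator
begin

text \<open>Up to the factor e^{c x} this is the weighted Laplace transform of the undershoot. The
  left limit is nondecreasing in x, the undershoot is not; hence the positive exponent.\<close>

definition passage_transform :: "real \<Rightarrow> real \<Rightarrow> real \<Rightarrow> ennreal" where
  "passage_transform a c x = (if 0 < x
     then \<integral>\<^sup>+\<omega>. ennreal (frac_kernel a (path_time (X \<omega>) x) * exp (c * path_left (X \<omega>) x)) \<partial>M else 0)"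

lemma borel_measurable_passage_transform [measurable]: "passage_transform a c \<in> borel_measurable borel"
  unfolding passage_transform_def by measurable

definition passage_window :: "real \<Rightarrow> real \<Rightarrow> nat \<Rightarrow> real \<Rightarrow> ennreal" where
  "passage_window a c n x = (\<integral>\<^sup>+\<omega>. path_window a c n (X \<omega>) x \<partial>M)"

lemma borel_measurable_passage_window [measurable]: "passage_window a c n \<in> borel_measurable borel"
  unfolding passage_window_def by measurable

lemma passage_window_tendsto:
  assumes "1 \<le> a" "0 \<le> c"
  shows "passage_window a c n x \<le> passage_transform a c x"
    and "(\<lambda>n. passage_window a c n x) \<longlonglongrightarrow> passage_transform a c x"
proof -
  have "passage_window a c n x \<le> passage_transform a c x \<and>
      (\<lambda>n. passage_window a c n x) \<longlonglongrightarrow> passage_transform a c x"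
  proof (cases "0 < x")
    case True
    have le: "AE \<omega> in M. path_window a c n (X \<omega>) x
       \<le> ennreal (frac_kernel a (path_time (X \<omega>) x) * exp (c * path_left (X \<omega>) x))" for n
      using X_path by eventually_elim (rule path_window_tendsto(1)[OF _ True assms])
    have "(\<lambda>n. passage_window a c n x) \<longlonglongrightarrow> passage_transform a c x"
      unfolding passage_window_def passage_transform_def if_P[OF True]
    proof (rule nn_integral_LIMSEQ_dominated_by_limit[OF _ _ le])
      show "AE \<omega> in M. (\<lambda>n. path_window a c n (X \<omega>) x)
        \<longlonglongrightarrow> ennreal (frac_kernel a (path_time (X \<omega>) x) * exp (c * path_left (X \<omega>) x))"
        using X_path by eventually_elim (rule path_window_tendsto(2)[OF _ True assms])
    qed measurable
    moreover have "passage_window a c n x \<le> passage_transform a c x"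
      unfolding passage_window_def passage_transform_def if_P[OF True] by (rule nn_integral_mono_AE[OF le])
    ultimately show ?thesis by simp
  next
    case False
    then have "x \<notin> {path_val (X \<omega>) s<..path_val (X \<omega>) (s + 1 / Suc n)}" for \<omega> s n
      by (metis greaterThanAtMost_iff le_less_trans path_val_nonneg)
    then have "indicator {path_val (X \<omega>) s<..path_val (X \<omega>) (s + 1 / Suc n)} x = (0::ennreal)" for \<omega> s n
      by (rule indicator_simps(2))
    then have "passage_window a c n x = 0" for n
      unfolding passage_window_def path_window_def
          by (simp only: mult_zero_right mult_zero_left nn_integral_const)
    then show ?thesis using False by (simp add: passage_transform_def)
  qed
  then show "passage_window a c n x \<le> passage_transform a c x"
    and "(\<lambda>n. passage_window a c n x) \<longlonglongrightarrow> passage_transform a c x" by blast+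
qed

lemma increment_transform:
  assumes "0 < q" "0 < k" "0 \<le> s" "0 \<le> h"
  shows "(\<integral>\<^sup>+\<omega>. ennreal (exp (- q * U s \<omega>) * (1 - exp (- k * (U (s + h) \<omega> - U s \<omega>)))) \<partial>M)
     = ennreal (exp (- s * q powr \<beta>) * (1 - exp (- h * k powr \<beta>)))"
    (is "?lhs = _")
proof -
  have [measurable]: "U s \<in> borel_measurable M" "U (s + h) \<in> borel_measurable M"
    using assms by auto
  have inc: "AE \<omega> in M. U s \<omega> \<le> U (s + h) \<omega>" using assms by (intro U_increasing) auto
  \<comment> \<open>Adding this finite term to both sides replaces a subtraction in
    \<open>ennreal\<close>.\<close>
  define P where "P = (\<integral>\<^sup>+\<omega>. ennreal (exp (- q * U s \<omega>)) * ennreal (exp (- k * (U (s + h) \<omega> - U s \<omega>))) \<partial>M)"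
  have P: "P = ennreal (exp (- s * q powr \<beta>) * exp (- h * k powr \<beta>))"
    unfolding P_def increment_laplace_product[OF assms] by (simp add: ennreal_mult'[symmetric])
  have "?lhs + P
     = (\<integral>\<^sup>+\<omega>. ennreal (exp (- q * U s \<omega>) * (1 - exp (- k * (U (s + h) \<omega> - U s \<omega>))))
          + ennreal (exp (- q * U s \<omega>)) * ennreal (exp (- k * (U (s + h) \<omega> - U s \<omega>))) \<partial>M)"
    unfolding P_def by (rule nn_integral_add[symmetric]) auto
  also have "\<dots> = (\<integral>\<^sup>+\<omega>. ennreal (exp (- q * U s \<omega>)) \<partial>M)"
    using inc
  proof (intro nn_integral_cong_AE, eventually_elim)
    case (elim \<omega>)
    then have "exp (- k * (U (s + h) \<omega> - U s \<omega>)) \<le> 1" using assms by simp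
    then show ?case
      by (simp add: ennreal_mult'[symmetric] ennreal_plus[symmetric] algebra_simps del: ennreal_plus)
  qed
  also have "\<dots> = ennreal (exp (- s * q powr \<beta>))"
    using assms by (intro U_laplace)
  also have "\<dots> = ennreal (exp (- s * q powr \<beta>) * (1 - exp (- h * k powr \<beta>))) + P"
    unfolding P using assms by (subst ennreal_plus[symmetric]) (auto simp: algebra_simps)
  finally show ?thesis
    by (simp add: P)
qed

text \<open>Integrating x first over (U s, U (s + h)] leaves (e^{-k U s} - e^{-k U (s+h)})/k with k
  = q + c. The weight e^{c U s} lowers the rate at time s to q, and what remains factors through the
  independent increment over [s, s + h].\<close>

lemma passage_window_laplace:
  assumes "1 \<le> a" "0 < c" "0 < q"
  shows "(\<integral>\<^sup>+x. ennreal (exp (- (q + c) * x)) * passage_window a c n x \<partial>lborel)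
    = ennreal (real (Suc n) * (1 - exp (- ((q + c) powr \<beta>) / real (Suc n))) / (q + c) * q powr (- (a * \<beta>)))"
proof -
  define k where "k = q + c"
  have k: "k > 0" using assms by (simp add: k_def)
  define h where "h = 1 / real (Suc n)"
  have h: "h > 0" by (simp add: h_def)
  interpret PM: pair_sigma_finite M lborel by standard
  define w where "w \<omega> s = ennreal (real (Suc n) * frac_kernel a s * exp (c * path_val (X \<omega>) s))" for \<omega> s
  define I where "I \<omega> s x = (indicator {path_val (X \<omega>) s<..path_val (X \<omega>) (s + h)} x :: ennreal)" for \<omega> s x
  have [measurable]: "(\<lambda>z. w (f z) (g z)) \<in> borel_measurable N"
    if [measurable]: "f \<in> measurable N M" "g \<in> borel_measurable N" for f g and N :: "'z measure"
    unfolding w_def by measurable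
  have [measurable]: "(\<lambda>z. I (f z) (g z) (e z)) \<in> borel_measurable N"
    if [measurable]: "f \<in> measurable N M" "g \<in> borel_measurable N" "e \<in> borel_measurable N" for f g e
        and N :: "'z measure"
    unfolding I_def indicator_def greaterThanAtMost_iff by measurable
  have "(\<integral>\<^sup>+x. ennreal (exp (- k * x)) * passage_window a c n x \<partial>lborel)
      = (\<integral>\<^sup>+x. \<integral>\<^sup>+\<omega>. \<integral>\<^sup>+s. ennreal (exp (- k * x)) * (w \<omega> s * I \<omega> s x) \<partial>lborel \<partial>M \<partial>lborel)"
    unfolding passage_window_def path_window_def w_def[symmetric] h_def[symmetric] I_def[symmetric]
    by (intro nn_integral_cong, subst nn_integral_cmult[symmetric], measurable)
      (intro nn_integral_cong, subst nn_integral_cmult[symmetric], auto)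
  \<comment> \<open>Adjacent integrals are exchanged one pair at a time; three exchanges bring x to
    the innermost place.\<close>
  also have "\<dots> = (\<integral>\<^sup>+x. \<integral>\<^sup>+s. \<integral>\<^sup>+\<omega>. ennreal (exp (- k * x)) * (w \<omega> s * I \<omega> s x) \<partial>M \<partial>lborel \<partial>lborel)"
    by (intro nn_integral_cong, subst PM.Fubini') auto
  also have "\<dots> = (\<integral>\<^sup>+s. \<integral>\<^sup>+x. \<integral>\<^sup>+\<omega>. ennreal (exp (- k * x)) * (w \<omega> s * I \<omega> s x) \<partial>M \<partial>lborel \<partial>lborel)"
    by (subst lborel_pair.Fubini') auto
  also have "\<dots> = (\<integral>\<^sup>+s. \<integral>\<^sup>+\<omega>. \<integral>\<^sup>+x. ennreal (exp (- k * x)) * (w \<omega> s * I \<omega> s x) \<partial>lborel \<partial>M \<partial>lborel)"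
    by (intro nn_integral_cong, subst PM.Fubini') auto
  also have "\<dots> = (\<integral>\<^sup>+s. ennreal (real (Suc n) * ((1 - exp (- h * k powr \<beta>)) / k))
      * ennreal (exp (- (q powr \<beta>) * s) * frac_kernel a s) \<partial>lborel)"
  proof (intro nn_integral_cong, goal_cases)
    case (1 s)
    show ?case
    proof (cases "s > 0")
      case True
      have inc: "AE \<omega> in M. U s \<omega> \<le> U (s + h) \<omega>"
        using True h by (intro U_increasing) auto
      have "(\<integral>\<^sup>+\<omega>. \<integral>\<^sup>+x. ennreal (exp (- k * x)) * (w \<omega> s * I \<omega> s x) \<partial>lborel \<partial>M)
        = (\<integral>\<^sup>+\<omega>. ennreal (real (Suc n) * frac_kernel a s / k) *
             ennreal (exp (- q * U s \<omega>) * (1 - exp (- k * (U (s + h) \<omega> - U s \<omega>)))) \<partial>M)"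
        using X_val inc
      proof (intro nn_integral_cong_AE, eventually_elim)
        case (elim \<omega>)
        then have le: "U s \<omega> \<le> U (s + h) \<omega>" and v: "path_val (X \<omega>) s = U s \<omega>" "path_val (X \<omega>) (s + h)
            = U (s + h) \<omega>"
          using True h by auto
        have "(\<integral>\<^sup>+x. ennreal (exp (- k * x)) * (w \<omega> s * I \<omega> s x) \<partial>lborel)
          = w \<omega> s * (\<integral>\<^sup>+x. ennreal (exp (- k * x)) * I \<omega> s x \<partial>lborel)"
        proof (subst nn_integral_cmult[symmetric])
          have [measurable]: "I \<omega> s \<in> borel_measurable borel" unfolding I_def by measurable
          show "(\<lambda>x. ennreal (exp (- k * x)) * I \<omega> s x) \<in> borel_measurable lborel" by measurable
        qed (auto simp: mult_ac)
        also have "\<dots> = w \<omega> s * ennreal ((exp (- k * U s \<omega>) - exp (- k * U (s + h) \<omega>)) / k)"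
          unfolding I_def v using nn_integral_exp_Ioc[OF k le] by simp
        also have "\<dots> = ennreal (real (Suc n) * frac_kernel a s * exp (c * U s \<omega>)
            * ((exp (- k * U s \<omega>) - exp (- k * U (s + h) \<omega>)) / k))"
          using assms unfolding w_def v by (subst ennreal_mult') auto
        also have "real (Suc n) * frac_kernel a s * exp (c * U s \<omega>)
            * ((exp (- k * U s \<omega>) - exp (- k * U (s + h) \<omega>)) / k)
          = real (Suc n) * frac_kernel a s / k
              * (exp (- q * U s \<omega>) * (1 - exp (- k * (U (s + h) \<omega> - U s \<omega>))))"
        proof -
          have "exp (c * U s \<omega>) * exp (- k * U s \<omega>) = exp (- q * U s \<omega>)"
            "exp (c * U s \<omega>) * exp (- k * U (s + h) \<omega>)
                = exp (- q * U s \<omega>) * exp (- k * (U (s + h) \<omega> - U s \<omega>))"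
            by (simp_all add: exp_add[symmetric] k_def algebra_simps)
          then show ?thesis by (simp only: right_diff_distrib diff_divide_distrib times_divide_eq_right
              times_divide_eq_left mult.assoc mult_1_right)
        qed
        also have "ennreal \<dots> = ennreal (real (Suc n) * frac_kernel a s / k) *
             ennreal (exp (- q * U s \<omega>) * (1 - exp (- k * (U (s + h) \<omega> - U s \<omega>))))"
          using assms k by (intro ennreal_mult') auto
        finally show ?case .
      qed
      also have "\<dots> = ennreal (real (Suc n) * frac_kernel a s / k)
          * ennreal (exp (- s * q powr \<beta>) * (1 - exp (- h * k powr \<beta>)))"
        using True h k assms by (subst nn_integral_cmult, simp, subst increment_transform) auto
      also have "\<dots> = ennreal (real (Suc n) * ((1 - exp (- h * k powr \<beta>)) / k))
          * ennreal (exp (- (q powr \<beta>) * s) * frac_kernel a s)"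
        using assms k h by (simp add: ennreal_mult'[symmetric] ennreal_mult''[symmetric] mult_ac)
      finally show ?thesis .
    qed (simp add: w_def frac_kernel_def)
  qed
  also have "\<dots> = ennreal (real (Suc n) * ((1 - exp (- h * k powr \<beta>)) / k)) * ennreal ((q powr \<beta>) powr (- a))"
    using assms by (subst nn_integral_cmult, simp, subst frac_kernel_laplace) auto
  also have "\<dots> = ennreal (real (Suc n) * (1 - exp (- (k powr \<beta>) / real (Suc n))) / k * q powr (- (a * \<beta>)))"
    using k h by (simp add: ennreal_mult''[symmetric] h_def powr_powr mult_ac)
  finally show ?thesis unfolding k_def .
qed

text \<open>With D = (q + c)^\<beta> one has n (1 - e^{-D/n}) \<rightarrow> D, and division by q + c
  leaves (q + c)^{\<beta>-1}.\<close>

lemma passage_transform_laplace: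
  assumes "1 \<le> a" "0 < c" "0 < q"
  shows "(\<integral>\<^sup>+x. ennreal (exp (- (q + c) * x)) * passage_transform a c x \<partial>lborel)
    = ennreal ((q + c) powr (\<beta> - 1) * q powr (- (a * \<beta>)))"
proof (rule LIMSEQ_unique)
  let ?k = "q + c"
  show "(\<lambda>n. \<integral>\<^sup>+x. ennreal (exp (- ?k * x)) * passage_window a c n x \<partial>lborel)
      \<longlonglongrightarrow> (\<integral>\<^sup>+x. ennreal (exp (- ?k * x)) * passage_transform a c x \<partial>lborel)"
    using assms
    by (intro nn_integral_LIMSEQ_dominated_by_limit AE_I2 mult_left_mono passage_window_tendsto
       tendsto_mult_ennreal tendsto_const) (auto simp: ennreal_zero_neq_top)
  define D where "D = ?k powr \<beta>"
  have "D > 0" using assms by (simp add: D_def)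
  then have "(\<lambda>n. real (Suc n) * (1 - exp (- D / real (Suc n)))) \<longlonglongrightarrow> D"
    by real_asymp
  then have "(\<lambda>n. real (Suc n) * (1 - exp (- D / real (Suc n))) / ?k * q powr (- (a * \<beta>)))
      \<longlonglongrightarrow> D / ?k * q powr (- (a * \<beta>))"
    using assms by (intro tendsto_intros) auto
  moreover have "D / ?k = ?k powr (\<beta> - 1)" using assms by (simp add: D_def powr_diff)
  ultimately show "(\<lambda>n. \<integral>\<^sup>+x. ennreal (exp (- ?k * x)) * passage_window a c n x \<partial>lborel)
      \<longlonglongrightarrow> ennreal (?k powr (\<beta> - 1) * q powr (- (a * \<beta>)))"
    unfolding passage_window_laplace[OF assms] D_def[symmetric] by (simp add: tendsto_ennrealI)
qed

end


text \<open>The form predicted by the compensation formula: \<open>frac_kernel (1 - b)\<close> is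
  the tail of the Levy measure, evaluated at the undershoot y, and the other factor is the weighted
  potential density at the left limit x - y, tilted by e^{c (x - y)}.\<close>

definition tilted_conv :: "real \<Rightarrow> real \<Rightarrow> real \<Rightarrow> real \<Rightarrow> ennreal" where
  "tilted_conv b a c x = (\<integral>\<^sup>+y. ennreal (frac_kernel (a * b) (x - y) * exp (c * (x - y)))
      * ennreal (frac_kernel (1 - b) y) \<partial>lborel)"

lemma borel_measurable_tilted_conv [measurable]: "tilted_conv b a c \<in> borel_measurable borel"
  unfolding tilted_conv_def by measurable

lemma tilted_conv_nonpos: "x \<le> 0 \<Longrightarrow> tilted_conv b a c x = 0"
proof -
  assume "x \<le> 0"
  then have "ennreal (frac_kernel (a * b) (x - y) * exp (c * (x - y))) * ennreal (frac_kernel (1 - b) y)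
      = 0" for y
    by (cases "y < x") (auto simp: frac_kernel_def)
  then show ?thesis unfolding tilted_conv_def by (simp only: nn_integral_const mult_zero_left)
qed

lemma tilted_conv_laplace:
  assumes "0 < b" "b < 1" "1 \<le> a" "0 < c" "0 < q"
  shows "(\<integral>\<^sup>+x. ennreal (exp (- (q + c) * x)) * tilted_conv b a c x \<partial>lborel)
    = ennreal ((q + c) powr (b - 1) * q powr (- (a * b)))"
proof -
  let ?k = "q + c"
  have "(\<integral>\<^sup>+x. ennreal (exp (- ?k * x)) * tilted_conv b a c x \<partial>lborel)
     = (\<integral>\<^sup>+x. \<integral>\<^sup>+y. ennreal (exp (- ?k * x))
         * (ennreal (frac_kernel (a * b) (x - y) * exp (c * (x - y))) * ennreal (frac_kernel (1 - b) y))
         \<partial>lborel \<partial>lborel)"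
    unfolding tilted_conv_def by (intro nn_integral_cong nn_integral_cmult[symmetric]) auto
  also have "\<dots> = (\<integral>\<^sup>+y. \<integral>\<^sup>+x. ennreal (exp (- ?k * x))
      * (ennreal (frac_kernel (a * b) (x - y) * exp (c * (x - y))) * ennreal (frac_kernel (1 - b) y))
      \<partial>lborel \<partial>lborel)"
    by (subst lborel_pair.Fubini') auto
  also have "\<dots> = (\<integral>\<^sup>+y. ennreal (exp (- ?k * y) * frac_kernel (1 - b) y)
      * ennreal (q powr (- (a * b))) \<partial>lborel)"
  proof (intro nn_integral_cong, goal_cases)
    case (1 y)
    have "(\<integral>\<^sup>+x. ennreal (exp (- ?k * x))
        * (ennreal (frac_kernel (a * b) (x - y) * exp (c * (x - y))) * ennreal (frac_kernel (1 - b) y))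
        \<partial>lborel)
      = (\<integral>\<^sup>+x. ennreal (exp (- ?k * y) * frac_kernel (1 - b) y)
          * ennreal (exp (- q * (x - y)) * frac_kernel (a * b) (x - y)) \<partial>lborel)"
    proof (intro nn_integral_cong, goal_cases)
      case (1 x)
      have "exp (- ?k * x) * exp (c * (x - y)) = exp (- ?k * y) * exp (- q * (x - y))"
        by (simp add: exp_add[symmetric] algebra_simps)
      moreover have "exp (- ?k * x) *
          (frac_kernel (a * b) (x - y) * exp (c * (x - y)) * frac_kernel (1 - b) y)
        = exp (- ?k * x) * exp (c * (x - y)) * (frac_kernel (a * b) (x - y) * frac_kernel (1 - b) y)"
        by (simp only: mult_ac)
      ultimately have "exp (- ?k * x)
          * (frac_kernel (a * b) (x - y) * exp (c * (x - y)) * frac_kernel (1 - b) y)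
        = exp (- ?k * y) * frac_kernel (1 - b) y * (exp (- q * (x - y)) * frac_kernel (a * b) (x - y))"
        by (simp only: mult_ac)
      then show ?case using assms by (simp add: ennreal_mult'[symmetric])
    qed
    also have "\<dots> = ennreal (exp (- ?k * y) * frac_kernel (1 - b) y) *
        (\<integral>\<^sup>+x. ennreal (exp (- q * (x - y)) * frac_kernel (a * b) (x - y)) \<partial>lborel)"
      by (rule nn_integral_cmult) auto
    also have "(\<integral>\<^sup>+x. ennreal (exp (- q * (x - y)) * frac_kernel (a * b) (x - y)) \<partial>lborel)
      = (\<integral>\<^sup>+x. ennreal (exp (- q * x) * frac_kernel (a * b) x) \<partial>lborel)"
      by (subst nn_integral_real_affine[where c=1 and t=y]) auto
    also have "\<dots> = ennreal (q powr (- (a * b)))"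
      using assms by (intro frac_kernel_laplace) auto
    finally show ?case .
  qed
  also have "\<dots> = ennreal (?k powr (- (1 - b))) * ennreal (q powr (- (a * b)))"
    using assms by (subst nn_integral_multc, simp, subst frac_kernel_laplace) auto
  finally show ?thesis by (simp add: ennreal_mult'[symmetric])
qed

text \<open>Substituting r y for y extracts r * r^{ab-1} * r^{-b} = r^{(a-1)b}, and the exponential
  grows by at most e^{c (r-1) x}. The bound tends to 1 as r decreases to 1 and serves as a one-sided
  form of continuity.\<close>

lemma tilted_conv_scale:
  assumes "0 < b" "b < 1" "1 \<le> a" "0 \<le> c" "1 \<le> r" "0 < x"
  shows "tilted_conv b a c (r * x)
      \<le> ennreal (r powr ((a - 1) * b) * exp (c * (r - 1) * x)) * tilted_conv b a c x"
proof -
  have pos: "0 < r" "0 < a * b" using assms by auto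
  have "tilted_conv b a c (r * x)
      = ennreal \<bar>r\<bar> * (\<integral>\<^sup>+y. ennreal
      (frac_kernel (a * b) (r * x - (0 + r * y)) * exp (c * (r * x - (0 + r * y))))
      * ennreal (frac_kernel (1 - b) (0 + r * y)) \<partial>lborel)"
    unfolding tilted_conv_def using assms by (intro nn_integral_real_affine) auto
  also have "\<dots> = (\<integral>\<^sup>+y. ennreal r
      * (ennreal (frac_kernel (a * b) (r * x - (0 + r * y)) * exp (c * (r * x - (0 + r * y))))
      * ennreal (frac_kernel (1 - b) (0 + r * y))) \<partial>lborel)"
    using assms by (subst nn_integral_cmult) auto
  also have "\<dots> \<le> (\<integral>\<^sup>+y. ennreal (r powr ((a - 1) * b) * exp (c * (r - 1) * x))
      * (ennreal (frac_kernel (a * b) (x - y) * exp (c * (x - y))) * ennreal (frac_kernel (1 - b) y))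
      \<partial>lborel)"
  proof (intro nn_integral_mono, goal_cases)
    case (1 y)
    show ?case
    proof (cases "0 < y \<and> y < x")
      case True
      have k1: "frac_kernel (a * b) (r * x - r * y) = r powr (a * b - 1) * frac_kernel (a * b) (x - y)"
        using True pos by (simp add: frac_kernel_def right_diff_distrib[symmetric] powr_mult)
      have k2: "frac_kernel (1 - b) (r * y) = r powr (- b) * frac_kernel (1 - b) y"
        using True pos by (simp add: frac_kernel_def powr_mult)
      have e: "exp (c * (r * x - r * y)) \<le> exp (c * (r - 1) * x) * exp (c * (x - y))"
      proof -
        have "c * (r - 1) * (x - y) \<le> c * (r - 1) * x"
          using True assms by (intro mult_left_mono) auto
        then have "c * (r * x - r * y) \<le> c * (r - 1) * x + c * (x - y)"
          by (simp add: algebra_simps)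
        then show ?thesis by (simp add: exp_add[symmetric])
      qed
      have r: "r * r powr (a * b - 1) * r powr (- b) = r powr ((a - 1) * b)"
      proof -
        have "r powr 1 * r powr (a * b - 1) * r powr (- b) = r powr ((a - 1) * b)"
          by (simp only: powr_add[symmetric]) (simp add: algebra_simps)
        then show ?thesis using pos by simp
      qed
      have "r * (frac_kernel (a * b) (r * x - r * y) * exp (c * (r * x - r * y))
          * frac_kernel (1 - b) (r * y))
        = r * r powr (a * b - 1) * r powr (- b) * (frac_kernel (a * b) (x - y) * frac_kernel (1 - b) y)
            * exp (c * (r * x - r * y))"
        unfolding k1 k2 by (simp only: mult_ac)
      also have "\<dots> \<le> r * r powr (a * b - 1) * r powr (- b)
          * (frac_kernel (a * b) (x - y) * frac_kernel (1 - b) y)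
          * (exp (c * (r - 1) * x) * exp (c * (x - y)))"
        using pos assms by (intro mult_left_mono[OF e]) auto
      also have "\<dots> = r powr ((a - 1) * b) * exp (c * (r - 1) * x)
          * (frac_kernel (a * b) (x - y) * exp (c * (x - y)) * frac_kernel (1 - b) y)"
        unfolding r by (simp only: mult_ac)
      finally show ?thesis
        using pos assms by (simp add: ennreal_mult'[symmetric] ennreal_leI)
    next
      case False
      then show ?thesis using pos
        by (auto simp: frac_kernel_def right_diff_distrib[symmetric] zero_less_mult_iff)
    qed
  qed
  also have "\<dots> = ennreal (r powr ((a - 1) * b) * exp (c * (r - 1) * x)) * tilted_conv b a c x"
    unfolding tilted_conv_def by (rule nn_integral_cmult) auto
  finally show ?thesis .
qed

text \<open>On either side of x there are points arbitrarily close to x where f and g agree.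
  Monotonicity of f and the scaling bound for g carry the equality to x with an error factor that
  tends to 1.\<close>

lemma eq_everywhere_from_AE:
  fixes f g :: "real \<Rightarrow> ennreal" and \<phi> :: "real \<Rightarrow> real \<Rightarrow> real"
  assumes AE: "AE x in lborel. 0 < x \<longrightarrow> f x = g x"
    and mono: "\<And>x y. 0 < x \<Longrightarrow> x \<le> y \<Longrightarrow> f x \<le> f y"
    and scale: "\<And>r x. 1 \<le> r \<Longrightarrow> 0 < x \<Longrightarrow> g (r * x) \<le> ennreal (\<phi> r x) * g x"
    and \<phi>_mono: "\<And>r s x y. 1 \<le> r \<Longrightarrow> r \<le> s \<Longrightarrow> 0 < x \<Longrightarrow> x \<le> y \<Longrightarrow> \<phi> r x \<le> \<phi> s y"
    and \<phi>_lim: "\<And>x. 0 < x \<Longrightarrow> ((\<lambda>r. \<phi> r x) \<longlongrightarrow> 1) (at_right 1)"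
    and x: "0 < x"
  shows "f x = g x"
proof -
  \<comment> \<open>An interval of positive length cannot lie in the exceptional null set.\<close>
  have pick: "\<exists>y\<in>{u<..<v}. f y = g y" if "0 < u" "u < v" for u v
  proof (rule ccontr)
    assume "\<not> ?thesis"
    then have "AE y in lborel. y \<notin> {u<..<v}"
      using AE that by (auto elim!: eventually_mono)
    then have "emeasure lborel {u<..<v} = 0"
      by (subst (asm) AE_iff_null_sets[symmetric]) (auto simp: null_sets_def)
    with that show False by simp
  qed
  have lim: "((\<lambda>r. ennreal (\<phi> r x) * h) \<longlongrightarrow> h) (at_right 1)" for h :: ennreal
  proof -
    have "((\<lambda>r. ennreal (\<phi> r x) * h) \<longlongrightarrow> ennreal 1 * h) (at_right 1)"
      by (intro tendsto_mult_ennreal tendsto_ennrealI \<phi>_lim x tendsto_const) auto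
    then show ?thesis by simp
  qed
  have ev: "\<forall>\<^sub>F r in at_right (1::real). 1 < r" by (simp add: eventually_at_right_less)
  have "f x \<le> ennreal (\<phi> r x) * g x" if "1 < r" for r
  proof -
    obtain y where y: "x < y" "y < r * x" "f y = g y"
      using pick[of x "r * x"] x \<open>1 < r\<close> by auto
    have "f x \<le> f y" by (intro mono) (use x y in auto)
    also have "\<dots> = g (y / x * x)" using x y by simp
    also have "\<dots> \<le> ennreal (\<phi> (y / x) x) * g x" using x y by (intro scale) auto
    also have "\<dots> \<le> ennreal (\<phi> r x) * g x"
      using x y by (intro mult_right_mono ennreal_leI \<phi>_mono) (auto simp: pos_le_divide_eq pos_divide_le_eq)
    finally show ?thesis .
  qed
  then have "f x \<le> g x"
    by (intro tendsto_lowerbound[OF lim[of "g x"]]) (auto intro: eventually_mono[OF ev])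
  moreover have "g x \<le> ennreal (\<phi> r x) * f x" if "1 < r" for r
  proof -
    obtain y where y: "x / r < y" "y < x" "f y = g y"
      using pick[of "x / r" x] x \<open>1 < r\<close> by (auto simp: field_simps)
    have "0 < x / r" using x \<open>1 < r\<close> by simp
    then have y0: "0 < y" using y by simp
    have "g x = g (x / y * y)" using y0 by simp
    also have "\<dots> \<le> ennreal (\<phi> (x / y) y) * g y" using y0 y by (intro scale) auto
    also have "\<dots> \<le> ennreal (\<phi> r x) * f y"
      unfolding y(3)[symmetric] using y0 y that
      by (intro mult_right_mono ennreal_leI \<phi>_mono)
          (auto simp: pos_le_divide_eq pos_divide_le_eq pos_divide_less_eq mult.commute)
    also have "\<dots> \<le> ennreal (\<phi> r x) * f x"
      by (intro mult_left_mono mono) (use y0 y in auto)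
    finally show ?thesis .
  qed
  then have "g x \<le> f x"
    by (intro tendsto_lowerbound[OF lim[of "f x"]]) (auto intro: eventually_mono[OF ev])
  ultimately show ?thesis by simp
qed

context subordinator
begin

text \<open>The two Laplace transforms in x are known only at arguments above c, so both functions
  are multiplied by e^{-c x} before uniqueness is applied. The resulting almost everywhere equality
  is then upgraded by monotonicity and scaling.\<close>

lemma passage_transform_eq:
  assumes "1 \<le> a" "0 < c" "0 < x"
  shows "passage_transform a c x = tilted_conv \<beta> a c x"
proof (rule eq_everywhere_from_AE[where \<phi>="\<lambda>r x. r powr ((a - 1) * \<beta>) * exp (c * (r - 1) * x)"])
  have "density lborel (\<lambda>x. ennreal (exp (- c * x)) * passage_transform a c x)
      = density lborel (\<lambda>x. ennreal (exp (- c * x)) * tilted_conv \<beta> a c x)"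
  proof (rule laplace_unique)
    have split: "(\<integral>\<^sup>+x. ennreal (exp (- q * x)) \<partial>density lborel (\<lambda>x. ennreal (exp (- c * x)) * f x))
      = (\<integral>\<^sup>+x. ennreal (exp (- (q + c) * x)) * f x \<partial>lborel)"
      if [measurable]: "f \<in> borel_measurable borel" for f q
    proof -
      have "(\<integral>\<^sup>+x. ennreal (exp (- q * x)) \<partial>density lborel (\<lambda>x. ennreal (exp (- c * x)) * f x))
        = (\<integral>\<^sup>+x. ennreal (exp (- c * x)) * f x * ennreal (exp (- q * x)) \<partial>lborel)"
        by (subst nn_integral_density) auto
      also have "\<dots> = (\<integral>\<^sup>+x. ennreal (exp (- (q + c) * x)) * f x \<partial>lborel)"
      proof (intro nn_integral_cong, goal_cases)
        case (1 x)
        have "ennreal (exp (- (q + c) * x)) = ennreal (exp (- c * x)) * ennreal (exp (- q * x))"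
          by (simp add: ennreal_mult'[symmetric] exp_add[symmetric] algebra_simps)
        then show ?case by (simp only: mult_ac)
      qed
      finally show ?thesis .
    qed
    show "(\<integral>\<^sup>+x. ennreal (exp (- q * x)) \<partial>density lborel
        (\<lambda>x. ennreal (exp (- c * x)) * passage_transform a c x))
      = (\<integral>\<^sup>+x. ennreal (exp (- q * x)) \<partial>density lborel (\<lambda>x. ennreal (exp (- c * x)) * tilted_conv \<beta> a c x))"
      if "0 < q" for q
      by (simp only: split borel_measurable_passage_transform borel_measurable_tilted_conv
          passage_transform_laplace[OF assms(1,2) that] tilted_conv_laplace[OF beta assms(1,2) that])
    show "(\<integral>\<^sup>+x. ennreal (exp (- x)) \<partial>density lborel
        (\<lambda>x. ennreal (exp (- c * x)) * passage_transform a c x)) < \<infinity>"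
      using split[of "passage_transform a c" 1] passage_transform_laplace[OF assms(1,2), of 1] by simp
    have "0 \<le> x" if "0 < ennreal (exp (- c * x)) * f x" "\<And>x. x \<le> 0 \<Longrightarrow> f x = 0" for x and f :: "real \<Rightarrow> ennreal"
      using that by (cases "x \<le> 0") auto
    then show "AE x in density lborel (\<lambda>x. ennreal (exp (- c * x)) * passage_transform a c x). 0 \<le> x"
      "AE x in density lborel (\<lambda>x. ennreal (exp (- c * x)) * tilted_conv \<beta> a c x). 0 \<le> x"
      by (subst AE_density; force simp: passage_transform_def tilted_conv_nonpos)+
  qed simp_all
  then have "AE x in lborel. ennreal (exp (- c * x)) * passage_transform a c x
      = ennreal (exp (- c * x)) * tilted_conv \<beta> a c x"
    by (subst (asm) sigma_finite_measure.density_unique_iff[OF sigma_finite_lborel]) auto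
  then show "AE x in lborel. 0 < x \<longrightarrow> passage_transform a c x = tilted_conv \<beta> a c x"
    by eventually_elim (auto simp: ennreal_mult_cancel_left)
  show "passage_transform a c u \<le> passage_transform a c v" if "0 < u" "u \<le> v" for u v
  proof -
    have "(\<integral>\<^sup>+\<omega>. ennreal (frac_kernel a (path_time (X \<omega>) u) * exp (c * path_left (X \<omega>) u)) \<partial>M)
       \<le> (\<integral>\<^sup>+\<omega>. ennreal (frac_kernel a (path_time (X \<omega>) v) * exp (c * path_left (X \<omega>) v)) \<partial>M)"
      using X_path
    proof (intro nn_integral_mono_AE, eventually_elim)
      case (elim \<omega>)
      then have P: "subordinator_path (X \<omega>)" by blast
      have "c * path_left (X \<omega>) u \<le> c * path_left (X \<omega>) v"
        using assms path_left_mono[OF P that(2)] by (intro mult_left_mono) auto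
      then show ?case
        using assms path_time_mono[OF P that(2)]
        by (intro ennreal_leI mult_mono frac_kernel_mono) auto
    qed
    then show ?thesis using that by (simp add: passage_transform_def)
  qed
  show "tilted_conv \<beta> a c (r * x)
      \<le> ennreal (r powr ((a - 1) * \<beta>) * exp (c * (r - 1) * x)) * tilted_conv \<beta> a c x"
    if "1 \<le> r" "0 < x" for r x
    using that assms beta by (intro tilted_conv_scale) auto
  show "r powr ((a - 1) * \<beta>) * exp (c * (r - 1) * x) \<le> s powr ((a - 1) * \<beta>) * exp (c * (s - 1) * y)"
    if "1 \<le> r" "r \<le> s" "0 < x" "x \<le> y" for r s x y
  proof -
    have "c * (r - 1) * x \<le> c * (s - 1) * y"
      using that assms by (intro mult_mono) auto
    moreover have "r powr ((a - 1) * \<beta>) \<le> s powr ((a - 1) * \<beta>)"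
      using that assms beta by (intro powr_mono2) auto
    ultimately show ?thesis by (intro mult_mono) auto
  qed
  show "((\<lambda>r. r powr ((a - 1) * \<beta>) * exp (c * (r - 1) * x)) \<longlongrightarrow> 1) (at_right 1)" for x
  proof -
    have "((\<lambda>r. r powr ((a - 1) * \<beta>) * exp (c * (r - 1) * x)) \<longlongrightarrow> 1 powr ((a - 1) * \<beta>)
        * exp (c * (1 - 1) * x)) (at_right 1)"
      by (intro tendsto_intros) auto
    then show ?thesis by simp
  qed
qed (use assms in auto)

text \<open>Now x is fixed and c varies: e^{-c (x - L)} = e^{-c x} e^{c L}, so the preceding
  identity is one of Laplace transforms in the undershoot. An exceptional null set of levels x would
  be fatal here.\<close>

lemma passage_law:
  assumes "1 \<le> a" "0 < x"
  shows "distr (density M (\<lambda>\<omega>. ennreal (frac_kernel a (path_time (X \<omega>) x)))) borel (\<lambda>\<omega>. x - path_left (X \<omega>) x)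
    = density lborel (\<lambda>y. ennreal (frac_kernel (a * \<beta>) (x - y)) * ennreal (frac_kernel (1 - \<beta>) y))"
    (is "?L = ?R")
proof (rule laplace_unique)
  have L: "(\<integral>\<^sup>+z. ennreal (exp (- c * z)) \<partial>?L)
      = ennreal (exp (- c * x)) * passage_transform a c x" if "0 < c" for c
  proof -
    have "(\<integral>\<^sup>+z. ennreal (exp (- c * z)) \<partial>?L)
      = (\<integral>\<^sup>+\<omega>. ennreal (frac_kernel a (path_time (X \<omega>) x))
          * ennreal (exp (- c * (x - path_left (X \<omega>) x))) \<partial>M)"
      by (subst nn_integral_distr, simp, simp, subst nn_integral_density) auto
    also have "\<dots> = (\<integral>\<^sup>+\<omega>. ennreal (exp (- c * x))
        * ennreal (frac_kernel a (path_time (X \<omega>) x) * exp (c * path_left (X \<omega>) x)) \<partial>M)"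
    proof (intro nn_integral_cong, goal_cases)
      case (1 \<omega>)
      have "exp (- c * (x - path_left (X \<omega>) x)) = exp (- c * x) * exp (c * path_left (X \<omega>) x)"
        by (simp add: exp_add[symmetric] algebra_simps)
      then show ?case using assms by (simp add: ennreal_mult'[symmetric] mult_ac)
    qed
    also have "\<dots> = ennreal (exp (- c * x)) * passage_transform a c x"
      unfolding passage_transform_def if_P[OF assms(2)] by (rule nn_integral_cmult) measurable
    finally show ?thesis .
  qed
  have R: "(\<integral>\<^sup>+z. ennreal (exp (- c * z)) \<partial>?R)
      = ennreal (exp (- c * x)) * tilted_conv \<beta> a c x" for c
  proof -
    have "(\<integral>\<^sup>+z. ennreal (exp (- c * z)) \<partial>?R)
      = (\<integral>\<^sup>+y. ennreal (frac_kernel (a * \<beta>) (x - y)) * ennreal (frac_kernel (1 - \<beta>) y)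
          * ennreal (exp (- c * y)) \<partial>lborel)"
      by (subst nn_integral_density) auto
    also have "\<dots> = (\<integral>\<^sup>+y. ennreal (exp (- c * x))
        * (ennreal (frac_kernel (a * \<beta>) (x - y) * exp (c * (x - y))) * ennreal (frac_kernel (1 - \<beta>) y))
        \<partial>lborel)"
    proof (intro nn_integral_cong, goal_cases)
      case (1 y)
      have "exp (- c * y) = exp (- c * x) * exp (c * (x - y))"
        by (simp add: exp_add[symmetric] algebra_simps)
      then show ?case using assms beta by (simp add: ennreal_mult'[symmetric] mult_ac)
    qed
    also have "\<dots> = ennreal (exp (- c * x)) * tilted_conv \<beta> a c x"
      unfolding tilted_conv_def by (rule nn_integral_cmult) measurable
    finally show ?thesis .
  qed
  show "(\<integral>\<^sup>+z. ennreal (exp (- c * z)) \<partial>?L)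
    = (\<integral>\<^sup>+z. ennreal (exp (- c * z)) \<partial>?R)"
    if "0 < c" for c
    unfolding L[OF that] R passage_transform_eq[OF assms(1) that assms(2)] ..
  have "(\<integral>\<^sup>+z. ennreal (exp (- 1 * z)) \<partial>?R)
      \<le> (\<integral>\<^sup>+y. ennreal (frac_kernel (a * \<beta>) (x - y)) * ennreal (frac_kernel (1 - \<beta>) y) \<partial>lborel)"
  proof (subst nn_integral_density, simp, simp, intro nn_integral_mono, goal_cases)
    case (1 y)
    show ?case
    proof (cases "0 < y")
      case True
      then have "ennreal (exp (- 1 * y)) \<le> 1" by simp
      from mult_left_mono[OF this, of "ennreal (frac_kernel (a * \<beta>) (x - y))
          * ennreal (frac_kernel (1 - \<beta>) y)"]
      show ?thesis by simp
    qed (simp add: frac_kernel_def)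
  qed
  also have "\<dots> < \<infinity>" using assms beta by (subst frac_kernel_conv) auto
  finally show "(\<integral>\<^sup>+z. ennreal (exp (- z)) \<partial>?L) < \<infinity>"
    using L[of 1] R[of 1] passage_transform_eq[OF assms(1) _ assms(2), of 1] by simp
  show "AE z in ?L. 0 \<le> z"
    using path_left_le[of x] assms by (subst AE_distr_iff) auto
  show "AE z in ?R. 0 \<le> z"
    by (subst AE_density) (auto simp: frac_kernel_def)
qed auto

text \<open>For a = 1 and a positive passage time the weight is 1 and the right side is
  \<open>censor_int \<beta> f x\<close>: the operator K is the transition operator of the successive
  starting positions.\<close>

lemma passage_formula:
  assumes "1 \<le> a" "0 < x" and [measurable]: "f \<in> borel_measurable borel"
  shows "(\<integral>\<^sup>+\<omega>. ennreal (frac_kernel a (path_time (X \<omega>) x)) * f (x - path_left (X \<omega>) x) \<partial>M)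
    = frac_int (a * \<beta>) (\<lambda>y. ennreal (frac_kernel (1 - \<beta>) y) * f y) x"
    (is "?lhs = _")
proof -
  have "?lhs
    = (\<integral>\<^sup>+y. f y \<partial>distr (density M (\<lambda>\<omega>. ennreal (frac_kernel a (path_time (X \<omega>) x)))) borel
        (\<lambda>\<omega>. x - path_left (X \<omega>) x))"
    by (subst nn_integral_distr, simp, simp, subst nn_integral_density) auto
  also have "\<dots> = frac_int (a * \<beta>) (\<lambda>y. ennreal (frac_kernel (1 - \<beta>) y) * f y) x"
    unfolding passage_law[OF assms(1,2)] frac_int_def
    by (subst nn_integral_density)
       (auto intro!: nn_integral_cong simp: frac_kernel_def indicator_def mult.assoc)
  finally show ?thesis .
qed

end


section \<open>The chain of stages\<close>

lemma borel_measurable_path_val [measurable]: "path_val p \<in> borel_measurable borel"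
  unfolding path_val_def
  by (rule borel_measurable_enn2real, rule borel_measurable_INF[OF countable_nonneg_rats]) measurable

primrec chain_pos :: "real \<Rightarrow> (nat \<Rightarrow> real \<Rightarrow> real) \<Rightarrow> nat \<Rightarrow> real" where
  "chain_pos x P 0 = x"
| "chain_pos x P (Suc j) = chain_pos x P j - path_left (P j) (chain_pos x P j)"

primrec chain_time :: "real \<Rightarrow> (nat \<Rightarrow> real \<Rightarrow> real) \<Rightarrow> nat \<Rightarrow> real" where
  "chain_time x P 0 = 0"
| "chain_time x P (Suc j) = chain_time x P j + path_time (P j) (chain_pos x P j)"

text \<open>The recursion splits off the last stage, whereas conditioning on the first path requires
  splitting off the first.\<close>

lemma chain_pos_Suc_shift:
  "chain_pos x P (Suc j) = chain_pos (x - path_left (P 0) x) (\<lambda>i. P (Suc i)) j"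
  by (induction j) auto

lemma chain_time_Suc_shift:
  "chain_time x P (Suc j) = path_time (P 0) x + chain_time (x - path_left (P 0) x) (\<lambda>i. P (Suc i)) j"
  by (induction j) (auto simp: chain_pos_Suc_shift[symmetric] simp del: chain_pos.simps(2))

lemma chain_time_nonneg [simp]: "0 \<le> chain_time x P j"
  by (induction j) auto

lemma chain_time_mono: "i \<le> j \<Longrightarrow> chain_time x P i \<le> chain_time x P j"
  by (rule lift_Suc_mono_le) auto

text \<open>The factorial makes this the fractional kernel of order n + 1 and removes the binomial
  coefficients from the addition formula.\<close>

definition divided_power :: "nat \<Rightarrow> real \<Rightarrow> real" where
  "divided_power n t = t ^ n / fact n"

lemma borel_measurable_divided_power [measurable]: "divided_power n \<in> borel_measurable borel"
  unfolding divided_power_def by measurable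

lemma divided_power_nonneg [simp]: "0 \<le> t \<Longrightarrow> 0 \<le> divided_power n t"
  by (simp add: divided_power_def)

lemma frac_kernel_divided_power: "0 < t \<Longrightarrow> frac_kernel (real n + 1) t = divided_power n t"
  using Gamma_fact[of n, where ?'a=real]
  by (simp add: frac_kernel_def divided_power_def powr_realpow add.commute)

lemma divided_power_add: "divided_power n (s + t) = (\<Sum>k\<le>n. divided_power (n - k) s * divided_power k t)"
proof -
  have "divided_power n (s + t) = (\<Sum>k\<le>n. real (n choose k) * t ^ k * s ^ (n - k) / fact n)"
    unfolding divided_power_def add.commute[of s] binomial_ring by (simp add: sum_divide_distrib)
  also have "\<dots> = (\<Sum>k\<le>n. divided_power (n - k) s * divided_power k t)"
    by (intro sum.cong) (auto simp: divided_power_def binomial_fact mult.commute)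
  finally show ?thesis .
qed

text \<open>The contribution of stage j to the integral of u^n/n! f(S^c_u) over u, in the local time
  s = u - \<open>chain_time x P j\<close>. Survival is expressed through the position instead of the
  passage time, which matches the occupation formula.\<close>

definition stage_integral :: "nat \<Rightarrow> (real \<Rightarrow> ennreal) \<Rightarrow> real \<Rightarrow> (nat \<Rightarrow> real \<Rightarrow> real) \<Rightarrow> nat \<Rightarrow> ennreal" where
  "stage_integral n f x P j = (\<integral>\<^sup>+s. indicator {0<..} s * ennreal (divided_power n (chain_time x P j + s)) *
     (if path_val (P j) s < chain_pos x P j then f (chain_pos x P j - path_val (P j) s) else 0) \<partial>lborel)"

text \<open>The interface to the probabilistic part: the chain argument needs only the two laws of a
  single stage and positivity of the passage time.\<close>

locale passage_chain =
  fixes \<beta> :: real and Q :: "(real \<Rightarrow> real) measure"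
  assumes beta: "0 < \<beta>" "\<beta> < 1"
    and prob_Q: "prob_space Q" and sets_Q [measurable_cong]: "sets Q = sets path_space"
    and time_pos: "\<And>x. 0 < x \<Longrightarrow> AE p in Q. 0 < path_time p x"
    and occupation: "\<And>a x f. 0 < a \<Longrightarrow> f \<in> borel_measurable borel \<Longrightarrow>
      (\<integral>\<^sup>+p. \<integral>\<^sup>+s. ennreal (frac_kernel a s)
          * (if path_val p s < x then f (x - path_val p s) else 0) \<partial>lborel \<partial>Q)
      = frac_int (a * \<beta>) f x"
    and passage: "\<And>a x f. 1 \<le> a \<Longrightarrow> 0 < x \<Longrightarrow> f \<in> borel_measurable borel \<Longrightarrow>
      (\<integral>\<^sup>+p. ennreal (frac_kernel a (path_time p x)) * f (x - path_left p x) \<partial>Q)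
      = frac_int (a * \<beta>) (\<lambda>y. ennreal (frac_kernel (1 - \<beta>) y) * f y) x"
begin

sublocale Q: prob_space Q by (rule prob_Q)
sublocale S: sequence_space Q ..

abbreviation "S \<equiv> Pi\<^sub>M UNIV (\<lambda>_::nat. Q)"

lemma measurable_coordinate:
  assumes "g \<in> measurable N S"
  shows "(\<lambda>w. g w j) \<in> measurable N path_space"
  using measurable_compose[OF assms measurable_component_singleton[of j UNIV "\<lambda>_. Q"]]
  by (simp add: measurable_cong_sets[OF refl sets_Q])

lemma measurable_chain_pos [measurable (raw)]:
  assumes [measurable]: "h \<in> borel_measurable N" "g \<in> measurable N S"
  shows "(\<lambda>w. chain_pos (h w) (g w) j) \<in> borel_measurable N"
proof (induction j)
  case (Suc j)
  note [measurable] = Suc measurable_coordinate[OF assms(2), of j]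
  show ?case by simp
qed simp

lemma measurable_chain_time [measurable (raw)]:
  assumes [measurable]: "h \<in> borel_measurable N" "g \<in> measurable N S"
  shows "(\<lambda>w. chain_time (h w) (g w) j) \<in> borel_measurable N"
proof (induction j)
  case (Suc j)
  note [measurable] = Suc measurable_coordinate[OF assms(2), of j]
  show ?case by simp
qed simp

lemma measurable_stage_integral [measurable (raw)]:
  assumes [measurable]: "f \<in> borel_measurable borel" "h \<in> borel_measurable N" "g \<in> measurable N S"
  shows "(\<lambda>w. stage_integral n f (h w) (g w) j) \<in> borel_measurable N"
proof -
  note [measurable] = measurable_compose[OF measurable_fst measurable_coordinate[OF assms(3)]]
  show ?thesis unfolding stage_integral_def by measurable
qed

text \<open>An i.i.d. sequence is its first term followed by an independent copy of the sequence;
  this replaces the Markov property at the first restart.\<close>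

lemma nn_integral_S_split:
  assumes [measurable]: "G \<in> borel_measurable S"
  shows "(\<integral>\<^sup>+P. G P \<partial>S) = (\<integral>\<^sup>+p. \<integral>\<^sup>+P. G (case_nat p P) \<partial>S \<partial>Q)"
proof -
  have [measurable]: "(\<lambda>(s, \<omega>). case_nat s \<omega>) \<in> measurable (Q \<Otimes>\<^sub>M S) S"
    by (auto simp: case_prod_beta intro!: measurable_case_nat')
  have "(\<integral>\<^sup>+P. G P \<partial>S) = (\<integral>\<^sup>+P. G P \<partial>distr (Q \<Otimes>\<^sub>M S) S (\<lambda>(s, \<omega>). case_nat s \<omega>))"
    by (simp add: S.PiM_iter)
  also have "\<dots> = (\<integral>\<^sup>+z. G (case_nat (fst z) (snd z)) \<partial>(Q \<Otimes>\<^sub>M S))"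
    by (subst nn_integral_distr) (auto simp: case_prod_beta)
  also have "\<dots> = (\<integral>\<^sup>+p. \<integral>\<^sup>+P. G (case_nat p P) \<partial>S \<partial>Q)"
    by (subst S.nn_integral_fst[symmetric]) (auto simp: case_prod_beta)
  finally show ?thesis .
qed

text \<open>Seen from the first restart, the clock reads T plus elapsed time, and the addition
  formula for divided powers separates the two.\<close>

lemma stage_integral_Suc:
  assumes [measurable]: "f \<in> borel_measurable borel"
  shows "stage_integral n f x P (Suc j) = (\<Sum>k\<le>n. ennreal (divided_power (n - k) (path_time (P 0) x)) *
    stage_integral k f (x - path_left (P 0) x) (\<lambda>i. P (Suc i)) j)"
proof -
  define x' where "x' = x - path_left (P 0) x"
  define P' where "P' = (\<lambda>i. P (Suc i))"
  define T where "T = path_time (P 0) x"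
  have T: "0 \<le> T" by (simp add: T_def)
  define h where "h s = (if path_val (P' j) s < chain_pos x' P' j then f
      (chain_pos x' P' j - path_val (P' j) s) else 0)" for s
  have [measurable]: "h \<in> borel_measurable borel" unfolding h_def by measurable
  have "stage_integral n f x P (Suc j)
      = (\<integral>\<^sup>+s. indicator {0<..} s * ennreal (divided_power n (T + (chain_time x' P' j + s))) * h s \<partial>lborel)"
    unfolding stage_integral_def chain_pos_Suc_shift chain_time_Suc_shift
    by (simp add: h_def x'_def P'_def T_def add.assoc cong: if_cong)
  also have "\<dots> = (\<integral>\<^sup>+s. (\<Sum>k\<le>n. ennreal (divided_power (n - k) T) *
      (indicator {0<..} s * ennreal (divided_power k (chain_time x' P' j + s)) * h s)) \<partial>lborel)"
  proof (intro nn_integral_cong, goal_cases)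
    case (1 s)
    show ?case
    proof (cases "0 < s")
      case True
      then have "0 \<le> chain_time x' P' j + s" by simp
      then have "ennreal (divided_power n (T + (chain_time x' P' j + s)))
          = (\<Sum>k\<le>n. ennreal (divided_power (n - k) T) * ennreal (divided_power k (chain_time x' P' j + s)))"
        using T by (subst divided_power_add) (simp add: sum_ennreal[symmetric] ennreal_mult)
      then show ?thesis using True by (simp add: sum_distrib_right mult.assoc)
    qed simp
  qed
  also have "\<dots> = (\<Sum>k\<le>n. ennreal (divided_power (n - k) T) * stage_integral k f x' P' j)"
    unfolding stage_integral_def h_def[symmetric]
    by (subst nn_integral_sum) (auto intro!: sum.cong nn_integral_cmult)
  finally show ?thesis by (simp add: x'_def P'_def T_def)
qed

definition stage_expectation :: "(real \<Rightarrow> ennreal) \<Rightarrow> nat \<Rightarrow> nat \<Rightarrow> real \<Rightarrow> ennreal" where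
  "stage_expectation f n N x = (if 0 < x then \<integral>\<^sup>+P. (\<Sum>j<N. stage_integral n f x P j) \<partial>S else 0)"

lemma borel_measurable_stage_expectation [measurable]:
  assumes [measurable]: "f \<in> borel_measurable borel"
  shows "stage_expectation f n N \<in> borel_measurable borel"
  unfolding stage_expectation_def by measurable

text \<open>With a = 1, the passage formula integrates only over y > 0, so the undershoot charges no
  nonpositive value: the level is almost surely crossed by a jump. The next stage thus starts from a
  positive position.\<close>

lemma passage_pos:
  assumes "0 < x"
  shows "AE p in Q. 0 < x - path_left p x"
proof -
  have meas: "(\<lambda>p. indicator {..0} (x - path_left p x) :: ennreal) \<in> borel_measurable Q"
    by measurable
  have "(\<integral>\<^sup>+p. indicator {..0} (x - path_left p x) \<partial>Q)
    = (\<integral>\<^sup>+p. ennreal (frac_kernel 1 (path_time p x)) * indicator {..0} (x - path_left p x) \<partial>Q)"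
    using time_pos[OF assms] by (intro nn_integral_cong_AE) (auto simp: frac_kernel_def)
  also have "\<dots> = frac_int (1 * \<beta>) (\<lambda>y. ennreal (frac_kernel (1 - \<beta>) y) * indicator {..0} y) x"
    using assms by (intro passage) auto
  also have "\<dots> = frac_int (1 * \<beta>) (\<lambda>y. 0) x"
    by (intro frac_int_cong) auto
  finally have "(\<integral>\<^sup>+p. indicator {..0} (x - path_left p x) \<partial>Q) = 0" by simp
  then have "AE p in Q. indicator {..0} (x - path_left p x) = (0::ennreal)"
    using nn_integral_0_iff_AE[OF meas] by simp
  then show ?thesis by eventually_elim (auto simp: indicator_def split: if_splits)
qed

text \<open>Conditioning on the first path, its own stage is an occupation integral of order n + 1.
  In the remaining stages the passage time carries weight n - k and the shifted chain weight k, so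
  the passage formula applies with a = n - k + 1.\<close>

lemma stage_expectation_Suc_moments:
  assumes [measurable]: "f \<in> borel_measurable borel"
  shows "stage_expectation f n (Suc N) x = frac_int ((real n + 1) * \<beta>) f x +
    (\<Sum>k\<le>n. frac_int ((real (n - k) + 1) * \<beta>)
        (\<lambda>y. ennreal (frac_kernel (1 - \<beta>) y) * stage_expectation f k N y) x)"
proof (cases "0 < x")
  case True
  have "stage_expectation f n (Suc N) x
      = (\<integral>\<^sup>+P. stage_integral n f x P 0 + (\<Sum>j<N. stage_integral n f x P (Suc j)) \<partial>S)"
    unfolding stage_expectation_def if_P[OF True] sum.lessThan_Suc_shift ..
  also have "\<dots> = (\<integral>\<^sup>+P. stage_integral n f x P 0 \<partial>S) + (\<integral>\<^sup>+P. (\<Sum>j<N. stage_integral n f x P (Suc j)) \<partial>S)"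
    by (rule nn_integral_add) measurable
  also have "(\<integral>\<^sup>+P. stage_integral n f x P 0 \<partial>S) = frac_int ((real n + 1) * \<beta>) f x"
  proof -
    have "(\<integral>\<^sup>+P. stage_integral n f x P 0 \<partial>S) = (\<integral>\<^sup>+p. \<integral>\<^sup>+P. stage_integral n f x (case_nat p P) 0 \<partial>S \<partial>Q)"
      by (rule nn_integral_S_split) measurable
    also have "\<dots> = (\<integral>\<^sup>+p. \<integral>\<^sup>+s. ennreal (frac_kernel (real n + 1) s) *
        (if path_val p s < x then f (x - path_val p s) else 0) \<partial>lborel \<partial>Q)"
    proof (intro nn_integral_cong, goal_cases)
      case (1 p)
      have "stage_integral n f x (case_nat p P) 0 = (\<integral>\<^sup>+s. ennreal (frac_kernel (real n + 1) s) *
        (if path_val p s < x then f (x - path_val p s) else 0) \<partial>lborel)" for P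
        unfolding stage_integral_def
      proof (intro nn_integral_cong, goal_cases)
        case (1 s)
        show ?case by (cases "0 < s") (simp_all add: frac_kernel_divided_power, simp add: frac_kernel_def)
      qed
      then show ?case by (simp add: S.emeasure_space_1)
    qed
    also have "\<dots> = frac_int ((real n + 1) * \<beta>) f x"
      by (rule occupation) auto
    finally show ?thesis .
  qed
  also have "(\<integral>\<^sup>+P. (\<Sum>j<N. stage_integral n f x P (Suc j)) \<partial>S)
     = (\<integral>\<^sup>+p. \<integral>\<^sup>+P. (\<Sum>j<N. stage_integral n f x (case_nat p P) (Suc j)) \<partial>S \<partial>Q)"
    by (rule nn_integral_S_split) measurable
  also have "\<dots> = (\<integral>\<^sup>+p. (\<Sum>k\<le>n. ennreal (frac_kernel (real (n - k) + 1) (path_time p x)) *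
      stage_expectation f k N (x - path_left p x)) \<partial>Q)"
    using time_pos[OF True] passage_pos[OF True]
  proof (intro nn_integral_cong_AE, eventually_elim)
    fix p
    assume T: "0 < path_time p x" and y: "0 < x - path_left p x"
    have "(\<integral>\<^sup>+P. (\<Sum>j<N. stage_integral n f x (case_nat p P) (Suc j)) \<partial>S)
      = (\<integral>\<^sup>+P. (\<Sum>k\<le>n. ennreal (frac_kernel (real (n - k) + 1) (path_time p x)) *
          (\<Sum>j<N. stage_integral k f (x - path_left p x) P j)) \<partial>S)"
      unfolding frac_kernel_divided_power[OF T]
    proof (intro nn_integral_cong, goal_cases)
      case (1 P)
      have "(\<Sum>j<N. stage_integral n f x (case_nat p P) (Suc j)) = (\<Sum>j<N. \<Sum>k\<le>n.
          ennreal (divided_power (n - k) (path_time p x)) * stage_integral k f (x - path_left p x) P j)"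
        by (simp add: stage_integral_Suc)
      also have "\<dots> = (\<Sum>k\<le>n. ennreal (divided_power (n - k) (path_time p x)) *
          (\<Sum>j<N. stage_integral k f (x - path_left p x) P j))"
        by (subst sum.swap) (simp add: sum_distrib_left)
      finally show ?case .
    qed
    also have "\<dots> = (\<Sum>k\<le>n. ennreal (frac_kernel (real (n - k) + 1) (path_time p x)) *
      stage_expectation f k N (x - path_left p x))"
      unfolding stage_expectation_def if_P[OF y]
      by (subst nn_integral_sum) (auto intro!: sum.cong nn_integral_cmult)
    finally show "(\<integral>\<^sup>+P. (\<Sum>j<N. stage_integral n f x (case_nat p P) (Suc j)) \<partial>S)
      = (\<Sum>k\<le>n. ennreal (frac_kernel (real (n - k) + 1) (path_time p x)) *
      stage_expectation f k N (x - path_left p x))" .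
  qed
  also have "\<dots> = (\<Sum>k\<le>n. \<integral>\<^sup>+p. ennreal (frac_kernel (real (n - k) + 1) (path_time p x)) *
      stage_expectation f k N (x - path_left p x) \<partial>Q)"
    by (rule nn_integral_sum) measurable
  also have "\<dots> = (\<Sum>k\<le>n. frac_int ((real (n - k) + 1) * \<beta>)
      (\<lambda>y. ennreal (frac_kernel (1 - \<beta>) y) * stage_expectation f k N y) x)"
    using True by (intro sum.cong refl passage) auto
  finally show ?thesis .
next
  case False
  then show ?thesis by (simp add: stage_expectation_def frac_int_nonpos)
qed

lemma stage_expectation_0_Suc:
  assumes [measurable]: "f \<in> borel_measurable borel"
  shows "stage_expectation f 0 (Suc N) x = frac_int \<beta> f x + censor_int \<beta> (stage_expectation f 0 N) x"
  by (simp add: stage_expectation_Suc_moments censor_int_def)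

text \<open>Applying \<open>frac_int \<beta>\<close> to the expansion of order n raises every
  fractional order by \<beta> and produces the expansion of order n + 1 except for its last summand
  k = n + 1, which is the \<open>censor_int\<close> term. The sum over k thus collapses to a
  two-term recursion.\<close>

lemma stage_expectation_Suc_Suc:
  assumes [measurable]: "f \<in> borel_measurable borel"
  shows "stage_expectation f (Suc n) (Suc N) x =
    frac_int \<beta> (stage_expectation f n (Suc N)) x + censor_int \<beta> (stage_expectation f (Suc n) N) x"
proof -
  define h where "h k y = ennreal (frac_kernel (1 - \<beta>) y) * stage_expectation f k N y" for k y
  have [measurable]: "h k \<in> borel_measurable borel" for k unfolding h_def by measurable
  have merge: "frac_int \<beta> (frac_int ((real m + 1) * \<beta>) g) x = frac_int ((real (Suc m) + 1) * \<beta>) g x"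
    if [measurable]: "g \<in> borel_measurable borel" for g m
    using beta by (subst frac_int_frac_int) (auto simp: algebra_simps intro!: add_pos_nonneg)
  have "stage_expectation f n (Suc N)
      = (\<lambda>y. frac_int ((real n + 1) * \<beta>) f y + (\<Sum>k\<le>n. frac_int ((real (n - k) + 1) * \<beta>) (h k) y))"
    by (simp add: fun_eq_iff stage_expectation_Suc_moments h_def[abs_def])
  then have "frac_int \<beta> (stage_expectation f n (Suc N)) x
      = frac_int \<beta> (frac_int ((real n + 1) * \<beta>) f) x
          + (\<Sum>k\<le>n. frac_int \<beta> (frac_int ((real (n - k) + 1) * \<beta>) (h k)) x)"
    by (simp add: frac_int_add frac_int_sum)
  also have "\<dots> = frac_int ((real (Suc n) + 1) * \<beta>) f x
      + (\<Sum>k\<le>n. frac_int ((real (Suc n - k) + 1) * \<beta>) (h k) x)"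
  proof -
    have "frac_int \<beta> (frac_int ((real (n - k) + 1) * \<beta>) (h k)) x
        = frac_int ((real (Suc n - k) + 1) * \<beta>) (h k) x" if "k \<le> n" for k
      using that by (subst merge) (auto simp: Suc_diff_le)
    then show ?thesis by (simp add: merge)
  qed
  finally have "frac_int \<beta> (stage_expectation f n (Suc N)) x
      = frac_int ((real (Suc n) + 1) * \<beta>) f x + (\<Sum>k\<le>n. frac_int ((real (Suc n - k) + 1) * \<beta>) (h k) x)" .
  moreover have "censor_int \<beta> (stage_expectation f (Suc n) N) x
      = frac_int ((real (Suc n - Suc n) + 1) * \<beta>) (h (Suc n)) x"
    by (simp add: censor_int_def h_def[abs_def])
  moreover have "stage_expectation f (Suc n) (Suc N) x
      = frac_int ((real (Suc n) + 1) * \<beta>) f x + (\<Sum>k\<le>Suc n. frac_int ((real (Suc n - k) + 1) * \<beta>) (h k) x)"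
    by (simp only: stage_expectation_Suc_moments[OF assms] h_def[abs_def])
  ultimately show ?thesis by (simp add: add.assoc)
qed

lemma incseq_stage_expectation: "incseq (stage_expectation f n)"
  unfolding stage_expectation_def
  by (auto simp: incseq_def le_fun_def intro!: nn_integral_mono sum_mono2)

text \<open>At order 0 the forcing is f in every step; at the next order it is the N-stage
  expectation of the preceding one, whose supremum is known by induction.\<close>

lemma SUP_stage_expectation:
  assumes [measurable]: "f \<in> borel_measurable borel"
  shows "(SUP N. stage_expectation f n N x) = (nn_censored_int \<beta> ^^ Suc n) f x"
proof (induction n arbitrary: x)
  case 0
  have "(SUP N. stage_expectation f 0 N x) = nn_censored_int \<beta> (\<lambda>y. SUP N::nat. f y) x"
    by (rule SUP_iteration_eq_nn_censored_int)
       (auto simp: stage_expectation_0_Suc incseq_stage_expectation stage_expectation_def[of f 0 0]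
           fun_eq_iff)
  then show ?case by simp
next
  case (Suc n)
  have "(SUP N. stage_expectation f (Suc n) N x) = nn_censored_int \<beta> (\<lambda>y. SUP N. stage_expectation f n N y) x"
    by (rule SUP_iteration_eq_nn_censored_int)
       (auto simp: stage_expectation_Suc_Suc incseq_stage_expectation
           stage_expectation_def[of f "Suc n" 0] fun_eq_iff)
  also have "(\<lambda>y. SUP N. stage_expectation f n N y) = (nn_censored_int \<beta> ^^ Suc n) f"
    using Suc by (rule ext)
  finally show ?case by simp
qed

theorem nn_integral_stage_sum:
  assumes [measurable]: "f \<in> borel_measurable borel" and "0 < x"
  shows "(\<integral>\<^sup>+P. (\<Sum>j. stage_integral n f x P j) \<partial>S) = (nn_censored_int \<beta> ^^ Suc n) f x"
    (is "?lhs = _")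
proof -
  have "?lhs = (SUP N. \<integral>\<^sup>+P. (\<Sum>j<N. stage_integral n f x P j) \<partial>S)"
    unfolding suminf_eq_SUP
    by (rule nn_integral_monotone_convergence_SUP) (auto simp: incseq_def le_fun_def intro!: sum_mono2)
  also have "\<dots> = (SUP N. stage_expectation f n N x)"
    using assms(2) by (simp add: stage_expectation_def)
  finally show ?thesis by (simp only: SUP_stage_expectation[OF assms(1)])
qed

lemma chain_pos_positive:
  assumes "0 < x"
  shows "AE P in S. \<forall>j. 0 < chain_pos x P j"
proof -
  have zero: "(\<integral>\<^sup>+P. indicator {..0} (chain_pos x P j) \<partial>S) = 0" if "0 < x" for j x
    using that
  proof (induction j arbitrary: x)
    case (Suc j)
    have "(\<integral>\<^sup>+P. indicator {..0} (chain_pos x P (Suc j)) \<partial>S)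
      = (\<integral>\<^sup>+p. \<integral>\<^sup>+P. indicator {..0} (chain_pos x (case_nat p P) (Suc j)) \<partial>S \<partial>Q)"
      by (rule nn_integral_S_split) measurable
    also have "\<dots> = (\<integral>\<^sup>+p. 0 \<partial>Q)"
      using passage_pos[OF Suc.prems]
      by (intro nn_integral_cong_AE, eventually_elim)
          (simp add: chain_pos_Suc_shift Suc.IH del: chain_pos.simps)
    finally show ?case by simp
  qed simp
  have "AE P in S. 0 < chain_pos x P j" for j
  proof -
    have "AE P in S. indicator {..0} (chain_pos x P j) = (0::ennreal)"
      using zero[OF assms, of j] by (subst (asm) nn_integral_0_iff_AE) auto
    then show ?thesis by eventually_elim (auto simp: indicator_def split: if_splits)
  qed
  then show ?thesis by (simp add: AE_all_countable)
qed

end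


section \<open>The pathwise construction\<close>

text \<open>
  \<open>P j\<close> is the path of subordinator \<open>j + 1\<close>, whereas \<open>p\<close> is indexed from \<open>1\<close> and holds the decreasing
  paths.
\<close>

locale regular_paths =
  fixes x :: real and P p :: "nat \<Rightarrow> real \<Rightarrow> real"
  assumes paths: "\<And>j. subordinator_path (P j)"
    and pos: "\<And>j. 0 < chain_pos x P j"
    and p_eq: "\<And>j t. 0 \<le> t \<Longrightarrow> p (Suc j) t = - P j t"
begin

abbreviation "\<tau> \<equiv> chain_time x P"
abbreviation "\<xi> \<equiv> chain_pos x P"
abbreviation "\<zeta> \<equiv> censored_lifetime x p"

declare chain_time.simps(2) [simp del] censored_time.simps(2) [simp del]

lemma stage_length_pos: "\<tau> j < \<tau> (Suc j)"
  using path_time_pos[OF paths pos] by (simp add: chain_time.simps)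

lemma below_level_iff:
  "0 \<le> s \<Longrightarrow> P j s < \<xi> j \<longleftrightarrow> \<tau> j + s < \<tau> (Suc j)"
  using less_path_time_iff[OF paths, of s j "\<xi> j"] by (simp add: chain_time.simps)

lemma Inf_ereal_atLeast: "Inf {ereal s |s. c \<le> s} = ereal c"
  by (intro antisym Inf_lower Inf_greatest) auto

text \<open>Times and stages are handled in one induction, since each time is an infimum over its
  stage and the next stage restarts from the left limit at that time.\<close>

lemma censored_time_stage:
  "censored_time x p j = ereal (\<tau> j) \<and>
   (\<forall>s\<ge>\<tau> j. censored_stage x p (Suc j) s = \<xi> j - P j (s - \<tau> j))"
proof (induction j)
  case 0
  then show ?case using p_eq[of _ 0] by (auto simp: zero_ereal_def)
next
  case (Suc j)
  define t where "t = \<tau> j"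
  define t' where "t' = \<tau> (Suc j)"
  define y where "y = \<xi> j"
  have t': "t' = t + path_time (P j) y" by (simp add: t'_def t_def y_def chain_time.simps)
  have T: "0 < path_time (P j) y" using path_time_pos[OF paths pos] by (simp add: y_def)
  have stage: "censored_stage x p (Suc j) s = y - P j (s - t)" if "t \<le> s" for s
    using Suc that by (simp add: t_def y_def)
  \<comment> \<open>The nonpositive times form a closed half line starting at \<open>t'\<close> by
    right-continuity; since the passage time is positive, the strict inequality at \<open>t\<close>
    removes nothing.\<close>
  have "{ereal s |s. censored_time x p j < ereal s \<and> censored_stage x p (Suc j) s \<le> 0} = {ereal s |s. t' \<le> s}"
  proof -
    have "censored_time x p j < ereal s \<and> censored_stage x p (Suc j) s \<le> 0 \<longleftrightarrow> t' \<le> s" for s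
    proof (cases "t \<le> s")
      case True
      have "s - t < path_time (P j) y \<longleftrightarrow> P j (s - t) < y"
        using True by (intro less_path_time_iff paths) auto
      then show ?thesis using True Suc T stage[OF True] t' by (auto simp: t_def[symmetric])
    next
      case False
      then show ?thesis using Suc T t' by (auto simp: t_def[symmetric])
    qed
    then show ?thesis by auto
  qed
  then have time: "censored_time x p (Suc j) = ereal t'"
    by (simp add: Inf_ereal_atLeast censored_time.simps)
  have "(censored_stage x p (Suc j) \<longlongrightarrow> y - path_left (P j) y) (at_left t')"
  proof -
    have lim: "filterlim (\<lambda>s. s - t) (at_left (path_time (P j) y)) (at_left t')"
      unfolding filterlim_at t'
      by (auto intro!: tendsto_eq_intros simp: eventually_at_filter)
    have "((\<lambda>s. y - P j (s - t)) \<longlongrightarrow> y - path_left (P j) y) (at_left t')"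
      using filterlim_compose[OF path_tendsto_left[OF paths[of j], of y] lim] pos[of j]
      by (intro tendsto_intros) (simp add: y_def)
    moreover have "\<forall>\<^sub>F s in at_left t'. s \<in> {t<..<t'}"
      using T t' by (intro eventually_at_left_real) auto
    then have "\<forall>\<^sub>F s in at_left t'. y - P j (s - t) = censored_stage x p (Suc j) s"
      by eventually_elim (simp add: stage)
    ultimately show ?thesis by (rule Lim_transform_eventually)
  qed
  then have "Lim (at_left t') (censored_stage x p (Suc j)) = \<xi> (Suc j)"
    by (intro tendsto_Lim) (auto simp: y_def)
  then have "censored_stage x p (Suc (Suc j)) s = \<xi> (Suc j) - P (Suc j) (s - t')" if "t' \<le> s" for s
    using that p_eq[of "s - t'" "Suc j"] by (simp add: time)
  with time show ?case by (simp add: t'_def)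
qed

lemma censored_time_eq: "censored_time x p j = ereal (\<tau> j)"
  using censored_time_stage by blast

lemma censored_lifetime_eq: "\<zeta> = (SUP j. ereal (\<tau> j))"
proof -
  have "incseq (\<lambda>j. ereal (\<tau> j))"
    by (auto simp: incseq_def chain_time_mono)
  then have "(\<lambda>j. ereal (\<tau> j)) \<longlonglongrightarrow> (SUP j. ereal (\<tau> j))"
    by (rule LIMSEQ_SUP)
  then show ?thesis
    unfolding censored_lifetime_def censored_time_eq[abs_def] by (rule limI)
qed

lemma chain_time_less_lifetime: "ereal (\<tau> j) < \<zeta>"
proof -
  have "ereal (\<tau> j) < ereal (\<tau> (Suc j))"
    using stage_length_pos by simp
  also have "\<dots> \<le> \<zeta>"
    unfolding censored_lifetime_eq by (rule SUP_upper) simp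
  finally show ?thesis .
qed

lemma stage_exists:
  assumes "0 \<le> s" "ereal s < \<zeta>"
  obtains j where "\<tau> j \<le> s" "s < \<tau> (Suc j)"
proof -
  obtain i where "s < \<tau> i"
    using assms(2) by (auto simp: censored_lifetime_eq less_SUP_iff)
  then have ex: "\<exists>i. s < \<tau> i" by blast
  define i where "i = (LEAST i. s < \<tau> i)"
  have i: "s < \<tau> i" unfolding i_def using ex by (rule LeastI_ex)
  with assms(1) obtain j where j: "i = Suc j" by (cases i) auto
  have "\<not> s < \<tau> j"
    using not_less_Least[of j "\<lambda>i. s < \<tau> i"] by (simp add: i_def[symmetric] j)
  then show thesis using that[of j] i j by simp
qed

lemma censored_process_eq:
  assumes "\<tau> j \<le> s" "s < \<tau> (Suc j)"
  shows "censored_process x p s = Some (\<xi> j - P j (s - \<tau> j))"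
proof -
  have "ereal s < \<zeta>"
    using less_trans[OF _ chain_time_less_lifetime[of "Suc j"], of "ereal s"] assms by simp
  moreover have "(THE i. 1 \<le> i \<and> censored_time x p (i - 1) \<le> ereal s \<and> ereal s < censored_time x p i) = Suc j"
  proof (rule the_equality)
    fix i assume i: "1 \<le> i \<and> censored_time x p (i - 1) \<le> ereal s \<and> ereal s < censored_time x p i"
    then have i': "\<tau> (i - 1) \<le> s" "s < \<tau> i" by (auto simp: censored_time_eq)
    have "\<not> i \<le> j" using chain_time_mono[of i j x P] assms i' by auto
    moreover have "\<not> Suc j \<le> i - 1" using chain_time_mono[of "Suc j" "i - 1" x P] assms i' by auto
    ultimately show "i = Suc j" by simp
  qed (use assms in \<open>simp add: censored_time_eq\<close>)
  ultimately show ?thesis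
    using assms censored_time_stage[of j] by (simp add: censored_process_def)
qed

text \<open>The intervals are open, leaving out the countably many stage ends. As a series of
  disjoint pieces written with \<open>path_val\<close>, the function is visibly Borel in u.\<close>

definition running :: "(real \<Rightarrow> ennreal) \<Rightarrow> real \<Rightarrow> ennreal" where
  "running f u = (\<Sum>j. indicator {\<tau> j<..<\<tau> (Suc j)} u *
     f (\<xi> j - path_val (P j) (u - \<tau> j)))"

lemma borel_measurable_running [measurable]:
  assumes [measurable]: "f \<in> borel_measurable borel"
  shows "running f \<in> borel_measurable borel"
  unfolding running_def by measurable

lemma running_stage:
  assumes "\<tau> j < u" "u < \<tau> (Suc j)"
  shows "running f u = f (\<xi> j - P j (u - \<tau> j))"
proof -
  have "running f u = (\<Sum>i\<in>{j}. indicator {\<tau> i<..<\<tau> (Suc i)} u *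
     f (\<xi> i - path_val (P i) (u - \<tau> i)))"
    unfolding running_def
  proof (rule suminf_finite)
    fix i assume "i \<notin> {j}"
    then consider "Suc i \<le> j" | "Suc j \<le> i" by fastforce
    then have "u \<notin> {\<tau> i<..<\<tau> (Suc i)}"
      by cases (use chain_time_mono[of "Suc i" j x P] chain_time_mono[of "Suc j" i x P] assms in auto)
    then show "indicator {\<tau> i<..<\<tau> (Suc i)} u *
     f (\<xi> i - path_val (P i) (u - \<tau> i)) = 0" by simp
  qed simp
  then show ?thesis using assms by (simp add: path_val_eq[OF paths])
qed

lemma running_outside:
  assumes "u \<le> 0 \<or> \<zeta> \<le> ereal u"
  shows "running f u = 0"
proof -
  have "u \<notin> {\<tau> i<..<\<tau> (Suc i)}" for i
    using assms chain_time_nonneg[of x P i] chain_time_less_lifetime[of "Suc i"]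
    by (auto simp del: chain_time_nonneg) (metis ereal_less_eq(3) leD less_le_trans less_imp_le)
  then show ?thesis by (simp add: running_def)
qed

text \<open>With u = \<tau> j + s, survival in stage j means exactly u < \<tau> (Suc j), so the
  stages tile the time axis up to the lifetime.\<close>

lemma sum_stage_integral:
  assumes [measurable]: "f \<in> borel_measurable borel"
  shows "(\<Sum>j. stage_integral n f x P j) = (\<integral>\<^sup>+u. ennreal (divided_power n u) * running f u \<partial>lborel)"
proof -
  have "stage_integral n f x P j = (\<integral>\<^sup>+u. ennreal (divided_power n u) *
      (indicator {\<tau> j<..<\<tau> (Suc j)} u * f (\<xi> j - path_val (P j) (u - \<tau> j))) \<partial>lborel)" for j
  proof -
    have "(\<integral>\<^sup>+u. ennreal (divided_power n u) *
      (indicator {\<tau> j<..<\<tau> (Suc j)} u * f (\<xi> j - path_val (P j) (u - \<tau> j))) \<partial>lborel)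
     = (\<integral>\<^sup>+s. ennreal (divided_power n (\<tau> j + s)) *
      (indicator {\<tau> j<..<\<tau> (Suc j)} (\<tau> j + s) * f (\<xi> j - path_val (P j) s)) \<partial>lborel)"
      by (subst nn_integral_real_affine[where c=1 and t="\<tau> j"]) auto
    also have "\<dots> = stage_integral n f x P j"
      unfolding stage_integral_def
    proof (intro nn_integral_cong, goal_cases)
      case (1 s)
      show ?case
        using below_level_iff[of s j]
        by (cases "0 < s") (auto simp: indicator_def path_val_eq[OF paths] mult.commute)
    qed
    finally show ?thesis ..
  qed
  then show ?thesis
    unfolding running_def by (simp add: nn_integral_suminf[symmetric])
qed

end


section \<open>Passage to signed functions\<close>

text \<open>Finite integrals make both functions finite almost everywhere, so
  \<open>enn2real\<close> alters them only on a null set.\<close>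

lemma enn2real_diff_integral:
  assumes [measurable]: "h1 \<in> borel_measurable N" "h2 \<in> borel_measurable N"
    and fin: "(\<integral>\<^sup>+x. h1 x \<partial>N) < \<top>" "(\<integral>\<^sup>+x. h2 x \<partial>N) < \<top>"
  shows "integrable N (\<lambda>x. enn2real (h1 x) - enn2real (h2 x))"
    and "(\<integral>x. enn2real (h1 x) - enn2real (h2 x) \<partial>N) = enn2real (\<integral>\<^sup>+x. h1 x \<partial>N) - enn2real (\<integral>\<^sup>+x. h2 x \<partial>N)"
    and "(\<integral>x. norm (enn2real (h1 x) - enn2real (h2 x)) \<partial>N)
        \<le> enn2real (\<integral>\<^sup>+x. h1 x \<partial>N) + enn2real (\<integral>\<^sup>+x. h2 x \<partial>N)"
proof -
  have one: "integrable N (\<lambda>x. enn2real (h x)) \<and> (\<integral>x. enn2real (h x) \<partial>N) = enn2real (\<integral>\<^sup>+x. h x \<partial>N)"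
    if [measurable]: "h \<in> borel_measurable N" and h: "(\<integral>\<^sup>+x. h x \<partial>N) < \<top>" for h
  proof -
    have "AE x in N. h x \<noteq> \<infinity>" using h by (intro nn_integral_PInf_AE) auto
    then have "(\<integral>\<^sup>+x. ennreal (enn2real (h x)) \<partial>N) = (\<integral>\<^sup>+x. h x \<partial>N)"
      by (intro nn_integral_cong_AE) (auto elim!: eventually_mono simp: less_top)
    then show ?thesis using h
      by (auto intro!: integrableI_nonneg simp: integral_eq_nn_integral)
  qed
  show "integrable N (\<lambda>x. enn2real (h1 x) - enn2real (h2 x))"
    using one fin by auto
  show "(\<integral>x. enn2real (h1 x) - enn2real (h2 x) \<partial>N) = enn2real (\<integral>\<^sup>+x. h1 x \<partial>N) - enn2real (\<integral>\<^sup>+x. h2 x \<partial>N)"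
    using one fin by (subst Bochner_Integration.integral_diff) auto
  have "(\<integral>x. norm (enn2real (h1 x) - enn2real (h2 x)) \<partial>N) \<le> (\<integral>x. enn2real (h1 x) + enn2real (h2 x) \<partial>N)"
    using one fin by (intro integral_mono) (auto simp: abs_le_iff)
  then show "(\<integral>x. norm (enn2real (h1 x) - enn2real (h2 x)) \<partial>N)
      \<le> enn2real (\<integral>\<^sup>+x. h1 x \<partial>N) + enn2real (\<integral>\<^sup>+x. h2 x \<partial>N)"
    using one fin by simp
qed

lemma sums_enn2real:
  assumes "(\<Sum>i. t i) < \<top>"
  shows "(\<lambda>i. enn2real (t i)) sums enn2real (\<Sum>i. t i)"
proof -
  have "t i \<le> (\<Sum>i. t i)" for i
    using sum_le_suminf[OF summableI, of "{i}" t] by simp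
  then have "t i < \<top>" for i using assms le_less_trans by blast
  then have t: "ennreal (enn2real (t i)) = t i" for i by simp
  have "summable (\<lambda>i. enn2real (t i))"
    by (rule summable_suminf_not_top) (use assms in \<open>simp_all add: t\<close>)
  moreover have "(\<Sum>i. t i) = ennreal (\<Sum>i. enn2real (t i))"
    using calculation by (subst suminf_ennreal2[symmetric]) (simp_all add: t)
  ultimately show ?thesis by (simp add: sums_iff suminf_nonneg)
qed

text \<open>Absolute summability of the integrals of \<open>h1\<close> and \<open>h2\<close>
  justifies exchanging sum and integral. It serves twice: in time along a single path, and in
  expectation.\<close>

lemma series_integral:
  fixes c :: "nat \<Rightarrow> real"
  assumes [measurable]: "\<And>n. h1 n \<in> borel_measurable N" "\<And>n. h2 n \<in> borel_measurable N"
    and fin: "\<And>n. (\<integral>\<^sup>+x. h1 n x \<partial>N) < \<top>" "\<And>n. (\<integral>\<^sup>+x. h2 n x \<partial>N) < \<top>"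
    and sum: "(\<Sum>n. ennreal \<bar>c n\<bar> * ((\<integral>\<^sup>+x. h1 n x \<partial>N) + (\<integral>\<^sup>+x. h2 n x \<partial>N))) < \<top>"
  shows "integrable N (\<lambda>x. \<Sum>n. c n * (enn2real (h1 n x) - enn2real (h2 n x)))"
    and "(\<lambda>n. c n * (enn2real (\<integral>\<^sup>+x. h1 n x \<partial>N) - enn2real (\<integral>\<^sup>+x. h2 n x \<partial>N))) sums
      (\<integral>x. (\<Sum>n. c n * (enn2real (h1 n x) - enn2real (h2 n x))) \<partial>N)"
    and "AE x in N. (\<Sum>n. ennreal \<bar>c n\<bar> * (h1 n x + h2 n x)) < \<top>"
proof -
  define f where "f n x = c n * (enn2real (h1 n x) - enn2real (h2 n x))" for n x
  have int: "integrable N (f n)" for n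
    unfolding f_def by (intro integrable_mult_right enn2real_diff_integral fin) auto
  have "(\<integral>\<^sup>+x. (\<Sum>n. ennreal \<bar>c n\<bar> * (h1 n x + h2 n x)) \<partial>N)
      = (\<Sum>n. ennreal \<bar>c n\<bar> * ((\<integral>\<^sup>+x. h1 n x \<partial>N) + (\<integral>\<^sup>+x. h2 n x \<partial>N)))"
    by (subst nn_integral_suminf) (auto simp: nn_integral_cmult nn_integral_add)
  then have "AE x in N. (\<Sum>n. ennreal \<bar>c n\<bar> * (h1 n x + h2 n x)) \<noteq> \<infinity>"
    using sum by (intro nn_integral_PInf_AE) auto
  then show AE: "AE x in N. (\<Sum>n. ennreal \<bar>c n\<bar> * (h1 n x + h2 n x)) < \<top>"
    by (simp add: less_top)
  have fin_AE: "AE x in N. \<forall>n. h1 n x < \<top> \<and> h2 n x < \<top>"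
  proof (subst AE_all_countable, intro allI)
    fix n
    have "AE x in N. h1 n x \<noteq> \<infinity>" "AE x in N. h2 n x \<noteq> \<infinity>"
      using nn_integral_PInf_AE[of "h1 n" N] nn_integral_PInf_AE[of "h2 n" N] fin[of n] by auto
    then show "AE x in N. h1 n x < \<top> \<and> h2 n x < \<top>" by eventually_elim (simp add: less_top)
  qed
  have abs_sum: "AE x in N. summable (\<lambda>n. norm (f n x))"
    using AE fin_AE
  proof eventually_elim
    case (elim x)
    have "summable (\<lambda>n. enn2real (ennreal \<bar>c n\<bar> * (h1 n x + h2 n x)))"
      using sums_enn2real[OF elim(1)] by (rule sums_summable)
    then show ?case
    proof (rule summable_comparison_test')
      fix n
      have "norm (f n x) \<le> \<bar>c n\<bar> * (enn2real (h1 n x) + enn2real (h2 n x))"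
        unfolding f_def by (auto simp: abs_mult abs_le_iff intro!: mult_left_mono)
      then show "norm (norm (f n x)) \<le> enn2real (ennreal \<bar>c n\<bar> * (h1 n x + h2 n x))"
        using elim(2) by (simp add: enn2real_mult enn2real_plus)
    qed
  qed
  have "summable (\<lambda>n. enn2real (ennreal \<bar>c n\<bar> * ((\<integral>\<^sup>+x. h1 n x \<partial>N) + (\<integral>\<^sup>+x. h2 n x \<partial>N))))"
    using sums_enn2real[OF sum] by (rule sums_summable)
  then have norm_sum: "summable (\<lambda>n. \<integral>x. norm (f n x) \<partial>N)"
  proof (rule summable_comparison_test')
    fix n
    have "(\<integral>x. norm (f n x) \<partial>N) = \<bar>c n\<bar> * (\<integral>x. norm (enn2real (h1 n x) - enn2real (h2 n x)) \<partial>N)"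
      unfolding f_def norm_mult by simp
    also have "\<dots> \<le> \<bar>c n\<bar> * (enn2real (\<integral>\<^sup>+x. h1 n x \<partial>N) + enn2real (\<integral>\<^sup>+x. h2 n x \<partial>N))"
      by (intro mult_left_mono enn2real_diff_integral fin) auto
    finally show "norm (\<integral>x. norm (f n x) \<partial>N)
        \<le> enn2real (ennreal \<bar>c n\<bar> * ((\<integral>\<^sup>+x. h1 n x \<partial>N) + (\<integral>\<^sup>+x. h2 n x \<partial>N)))"
      using fin by (simp add: enn2real_mult enn2real_plus)
  qed
  show "integrable N (\<lambda>x. \<Sum>n. c n * (enn2real (h1 n x) - enn2real (h2 n x)))"
    using integrable_suminf[OF int abs_sum norm_sum] by (simp add: f_def)
  show "(\<lambda>n. c n * (enn2real (\<integral>\<^sup>+x. h1 n x \<partial>N) - enn2real (\<integral>\<^sup>+x. h2 n x \<partial>N))) sums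
      (\<integral>x. (\<Sum>n. c n * (enn2real (h1 n x) - enn2real (h2 n x))) \<partial>N)"
    using sums_integral[OF int abs_sum norm_sum] enn2real_diff_integral(2)[OF _ _ fin]
    by (simp add: f_def)
qed

text \<open>A preimage under f differs from the one under g only within a null set, and the
  completion contains every subset of it.\<close>

lemma measurable_completion_AE:
  fixes f g :: "'a \<Rightarrow> 'b::topological_space"
  assumes g: "g \<in> borel_measurable M" and eq: "AE x in M. f x = g x"
  shows "f \<in> borel_measurable (completion M)"
proof (rule measurableI)
  fix A :: "'b set" assume A: "A \<in> sets borel"
  have pred [measurable]: "Measurable.pred (completion M) (\<lambda>x. f x \<noteq> g x)"
    "Measurable.pred (completion M) (\<lambda>x. f x \<noteq> g x \<and> f x \<in> A)"
    using eq by (auto intro!: sets_completion_AE elim!: eventually_mono)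
  note [measurable] = measurable_completion[OF g] A
  have "Measurable.pred (completion M) (\<lambda>x. (\<not> f x \<noteq> g x) \<and> g x \<in> A \<or> f x \<noteq> g x \<and> f x \<in> A)"
    by measurable
  also have "(\<lambda>x. (\<not> f x \<noteq> g x) \<and> g x \<in> A \<or> f x \<noteq> g x \<and> f x \<in> A) = (\<lambda>x. f x \<in> A)"
    by auto
  finally show "f -` A \<inter> space (completion M) \<in> sets (completion M)"
    by (simp add: pred_def vimage_def Int_def conj_commute)
qed simp

lemma interval_integral_enn2real_diff:
  fixes k :: "real \<Rightarrow> real"
  assumes x: "0 < x" and [measurable]: "k \<in> borel_measurable borel" "F \<in> borel_measurable borel" "G \<in>
      borel_measurable borel"
    and k: "\<And>r. 0 < r \<Longrightarrow> r < x \<Longrightarrow> 0 \<le> k r"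
    and rep: "\<And>r. 0 < r \<Longrightarrow> r < x \<Longrightarrow> \<psi> r = enn2real (F r) - enn2real (G r)"
    and fin: "(\<integral>\<^sup>+r. ennreal (k r) * (F r * indicator {0<..<x} r) \<partial>lborel) < \<top>"
      "(\<integral>\<^sup>+r. ennreal (k r) * (G r * indicator {0<..<x} r) \<partial>lborel) < \<top>"
  shows "(LBINT r=0..x. k r * \<psi> r) = enn2real (\<integral>\<^sup>+r. ennreal (k r) * (F r * indicator {0<..<x} r) \<partial>lborel)
    - enn2real (\<integral>\<^sup>+r. ennreal (k r) * (G r * indicator {0<..<x} r) \<partial>lborel)"
proof -
  have "(LBINT r=0..x. k r * \<psi> r) = (LINT r|lborel. indicator {0<..<x} r *\<^sub>R (k r * \<psi> r))"
    using x by (simp add: zero_ereal_def interval_integral_Ioo set_lebesgue_integral_def)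
  also have "\<dots> = (LINT r|lborel. enn2real (ennreal (k r) * (F r * indicator {0<..<x} r))
       - enn2real (ennreal (k r) * (G r * indicator {0<..<x} r)))"
    using k rep by (intro Bochner_Integration.integral_cong)
      (auto simp: indicator_def enn2real_mult right_diff_distrib)
  also have "\<dots> = enn2real (\<integral>\<^sup>+r. ennreal (k r) * (F r * indicator {0<..<x} r) \<partial>lborel)
    - enn2real (\<integral>\<^sup>+r. ennreal (k r) * (G r * indicator {0<..<x} r) \<partial>lborel)"
    by (intro enn2real_diff_integral fin) auto
  finally show ?thesis .
qed

section \<open>Real-valued operators as differences of \<open>ennreal\<close> operators\<close>

context
  fixes b :: real
  assumes b: "0 < b" "b < 1"
begin

lemma frac_int_indicator:
  "frac_int b F x = (\<integral>\<^sup>+r. ennreal ((x - r) powr (b - 1) / Gamma b) * (F r * indicator {0<..<x} r) \<partial>lborel)"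
  unfolding frac_int_def by (intro nn_integral_cong) (auto simp: frac_kernel_def indicator_def)

lemma censor_int_indicator:
  "censor_int b F x = (\<integral>\<^sup>+r. ennreal ((x - r) powr (b - 1) * r powr (- b) / (Gamma b * Gamma (1 - b))) *
     (F r * indicator {0<..<x} r) \<partial>lborel)"
  unfolding censor_int_def frac_int_def using b Gamma_real_pos[of b]
  by (intro nn_integral_cong)
    (auto simp: frac_kernel_def indicator_def mult.assoc[symmetric] ennreal_mult'[symmetric])

lemma riemann_liouville_rep:
  assumes [measurable]: "F \<in> borel_measurable borel" "G \<in> borel_measurable borel"
    and "0 < x" and "\<And>r. 0 < r \<Longrightarrow> r < x \<Longrightarrow> \<psi> r = enn2real (F r) - enn2real (G r)"
    and "frac_int b F x < \<top>" "frac_int b G x < \<top>"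
  shows "riemann_liouville b \<psi> x = enn2real (frac_int b F x) - enn2real (frac_int b G x)"
  unfolding riemann_liouville_def if_P[OF \<open>0 < x\<close>] using assms b Gamma_real_pos[of b]
  unfolding frac_int_indicator
  by (intro interval_integral_enn2real_diff) auto

lemma censor_kernel_rep:
  assumes [measurable]: "F \<in> borel_measurable borel" "G \<in> borel_measurable borel"
    and "0 < x" and "\<And>r. 0 < r \<Longrightarrow> r < x \<Longrightarrow> \<psi> r = enn2real (F r) - enn2real (G r)"
    and "censor_int b F x < \<top>" "censor_int b G x < \<top>"
  shows "censor_kernel b \<psi> x = enn2real (censor_int b F x) - enn2real (censor_int b G x)"
  unfolding censor_kernel_def if_P[OF \<open>0 < x\<close>] using assms b Gamma_real_pos[of b] Gamma_real_pos[of "1 - b"]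
  unfolding censor_int_indicator
  by (intro interval_integral_enn2real_diff) auto

lemma censored_integral_rep:
  assumes [measurable]: "F \<in> borel_measurable borel" "G \<in> borel_measurable borel"
    and rep: "\<And>r. 0 < r \<Longrightarrow> r \<le> T \<Longrightarrow> \<psi> r = enn2real (F r) - enn2real (G r)"
    and fin: "\<And>r. 0 < r \<Longrightarrow> r \<le> T \<Longrightarrow> nn_censored_int b F r < \<top>" "\<And>r. 0 < r \<Longrightarrow> r \<le> T \<Longrightarrow> nn_censored_int b G r < \<top>"
    and x: "0 < x" "x \<le> T"
  shows "censored_integral b \<psi> x = enn2real (nn_censored_int b F x) - enn2real (nn_censored_int b G x)"
proof -
  \<comment> \<open>Finiteness of the whole Neumann series bounds each of its terms, so the
    difference representation survives every iteration.\<close>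
  have term_fin: "(censor_int b ^^ i) (frac_int b H) r < \<top>" if "nn_censored_int b H r < \<top>" for H r i
  proof -
    have "(censor_int b ^^ i) (frac_int b H) r \<le> nn_censored_int b H r"
      unfolding nn_censored_int_def using sum_le_suminf[OF summableI, of "{i}"] by simp
    then show ?thesis using that by (rule le_less_trans)
  qed
  have iter: "(censor_kernel b ^^ i) (riemann_liouville b \<psi>) r
      = enn2real ((censor_int b ^^ i) (frac_int b F) r) - enn2real ((censor_int b ^^ i) (frac_int b G) r)"
    if "0 < r" "r \<le> T" for i r
    using that
  proof (induction i arbitrary: r)
    case 0
    then show ?case
      using term_fin[OF fin(1), of r 0] term_fin[OF fin(2), of r 0] rep by (simp add: riemann_liouville_rep)
  next
    case (Suc i)
    then show ?case
      using term_fin[OF fin(1), of r "Suc i"] term_fin[OF fin(2), of r "Suc i"]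
          by (simp add: censor_kernel_rep)
  qed
  have "(\<lambda>i. enn2real ((censor_int b ^^ i) (frac_int b F) x)
      - enn2real ((censor_int b ^^ i) (frac_int b G) x)) sums
     (enn2real (nn_censored_int b F x) - enn2real (nn_censored_int b G x))"
    using fin x unfolding nn_censored_int_def by (intro sums_diff sums_enn2real) auto
  then show ?thesis
    unfolding censored_integral_def by (simp add: iter[OF x] sums_iff)
qed

lemma censored_integral_pow_rep:
  assumes [measurable]: "F \<in> borel_measurable borel" "G \<in> borel_measurable borel"
    and rep: "\<And>r. 0 < r \<Longrightarrow> r \<le> T \<Longrightarrow> \<psi> r = enn2real (F r) - enn2real (G r)"
    and fin: "\<And>r n. 0 < r \<Longrightarrow> r \<le> T \<Longrightarrow> (nn_censored_int b ^^ Suc n) F r < \<top>"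
      "\<And>r n. 0 < r \<Longrightarrow> r \<le> T \<Longrightarrow> (nn_censored_int b ^^ Suc n) G r < \<top>"
    and "0 < x" "x \<le> T"
  shows "(censored_integral b ^^ n) \<psi> x
      = enn2real ((nn_censored_int b ^^ n) F x) - enn2real ((nn_censored_int b ^^ n) G x)"
  using assms(6,7)
proof (induction n arbitrary: x)
  case (Suc n)
  then show ?case
    using fin[of _ n] by (simp add: censored_integral_rep[where T=T])
qed (use rep in simp)

lemma nn_censored_int_pow_le:
  assumes "\<And>y. 0 < y \<Longrightarrow> y \<le> T \<Longrightarrow> F y \<le> C" "0 < x" "x \<le> T"
  shows "(nn_censored_int b ^^ n) F x \<le> C * (nn_censored_int b ^^ n) (pos_power 0) x"
  using assms(2,3)
proof (induction n arbitrary: x)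
  case 0
  then show ?case using assms(1) by (simp add: pos_power_def)
next
  case (Suc n)
  have "nn_censored_int b ((nn_censored_int b ^^ n) F) x
      \<le> nn_censored_int b (\<lambda>y. C * (nn_censored_int b ^^ n) (pos_power 0) y) x"
    using Suc by (intro nn_censored_int_mono) auto
  then show ?case by (simp add: nn_censored_int_cmult)
qed

text \<open>The n-th factor is at least (n b)^b - 1 / Gamma (1 - b), which tends to infinity, so the
  ratio test applies for every r.\<close>

lemma summable_censor_factor_series:
  assumes "0 \<le> r"
  shows "summable (\<lambda>n. r ^ n * (\<Prod>k=1..n. inverse (censor_factor b (real k * b))))"
proof -
  have "filterlim (\<lambda>n. (real (Suc n) * b) powr b - 1 / Gamma (1 - b)) at_top sequentially"
    using b by real_asymp
  \<comment> \<open>The bound 2 r makes the ratio at most 1/2; the additional 1 keeps the factor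
    positive when r = 0.\<close>
  then have "\<forall>\<^sub>F n in sequentially. 2 * r + 1 \<le> (real (Suc n) * b) powr b - 1 / Gamma (1 - b)"
    by (simp add: filterlim_at_top)
  then obtain N where N: "\<And>n. N \<le> n \<Longrightarrow> 2 * r + 1 \<le> (real (Suc n) * b) powr b - 1 / Gamma (1 - b)"
    unfolding eventually_sequentially by blast
  have "norm (r ^ Suc n * (\<Prod>k=1..Suc n. inverse (censor_factor b (real k * b))))
      \<le> 1/2 * norm (r ^ n * (\<Prod>k=1..n. inverse (censor_factor b (real k * b))))" if "N \<le> n" for n
  proof -
    have "2 * r + 1 \<le> censor_factor b (real (Suc n) * b)"
      using N[OF that] Gamma_ratio_ge_powr[OF b, of "real (Suc n) * b"] b
      by (simp add: censor_factor_def add.commute)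
    then have "r * inverse (censor_factor b (real (Suc n) * b))
        \<le> 1 / 2" "0 < censor_factor b (real (Suc n) * b)"
      using assms by (auto simp: field_simps)
    then have "norm (r * inverse (censor_factor b (real (Suc n) * b))) \<le> 1 / 2"
      using assms by simp
    from mult_right_mono[OF this norm_ge_zero, of "r ^ n * (\<Prod>k=1..n. inverse (censor_factor b (real k * b)))"]
    moreover have "r ^ Suc n * (\<Prod>k=1..Suc n. inverse (censor_factor b (real k * b)))
      = r * inverse (censor_factor b (real (Suc n) * b))
          * (r ^ n * (\<Prod>k=1..n. inverse (censor_factor b (real k * b))))"
      by simp
    ultimately show ?thesis by (simp only: norm_mult)
  qed
  then show ?thesis by (intro summable_ratio_test[of "1/2" N]) auto
qed

end


text \<open>Stated for arbitrary functions because the integrand of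
  \<open>discounted_integral\<close> is never itself shown to be measurable.\<close>

lemma integral_lborel_eq_off_countable:
  fixes f g :: "real \<Rightarrow> real"
  assumes "countable X" "\<And>u. u \<notin> X \<Longrightarrow> f u = g u"
  shows "integral\<^sup>L lborel f = integral\<^sup>L lborel g"
proof (rule integral_discrete_difference[OF assms(1)])
  show "{u} \<in> sets lborel" for u :: real by simp
qed (simp_all add: assms(2))

section \<open>The discounted integral and the lifetime along one path\<close>

context regular_paths
begin

lemma chain_pos_le: "\<xi> j \<le> x"
proof (induction j)
  case (Suc j)
  have "\<xi> (Suc j) \<le> \<xi> j" by simp
  with Suc show ?case by linarith
qed simp

lemma off_grid_cases:
  assumes "u \<notin> range \<tau>"
  obtains "u \<le> 0 \<or> \<zeta> \<le> ereal u"
  | j where "0 < u" "ereal u < \<zeta>" "\<tau> j < u" "u < \<tau> (Suc j)"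
proof (cases "u \<le> 0 \<or> \<zeta> \<le> ereal u")
  case False
  then obtain j where j: "\<tau> j \<le> u" "u < \<tau> (Suc j)"
    using stage_exists[of u] by force
  moreover have "\<tau> j \<noteq> u" using assms by auto
  ultimately show ?thesis using False that(2)[of j] by auto
qed (use that in blast)

text \<open>Off the countable set of stage ends the integrand is e^{lam u} times a difference of
  \<open>running\<close> functionals; expanding the exponential turns the integral into a series of
  stage sums.\<close>

lemma discounted_integral_eq:
  assumes g: "\<And>y. 0 < y \<Longrightarrow> y \<le> x \<Longrightarrow> g y = enn2real (f1 y) - enn2real (f2 y)"
    and [measurable]: "f1 \<in> borel_measurable borel" "f2 \<in> borel_measurable borel"
    and fin: "\<And>n. (\<Sum>j. stage_integral n f1 x P j) < \<top>" "\<And>n. (\<Sum>j. stage_integral n f2 x P j) < \<top>"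
    and sum: "(\<Sum>n. ennreal \<bar>lam ^ n\<bar>
        * ((\<Sum>j. stage_integral n f1 x P j) + (\<Sum>j. stage_integral n f2 x P j))) < \<top>"
  shows "discounted_integral lam g x p =
    (\<Sum>n. lam ^ n * (enn2real (\<Sum>j. stage_integral n f1 x P j) - enn2real (\<Sum>j. stage_integral n f2 x P j)))"
proof -
  define h where "h f n u = ennreal (divided_power n u) * running f u" for f n u
  have [measurable]: "h f n \<in> borel_measurable borel" if [measurable]: "f \<in> borel_measurable borel" for f n
    unfolding h_def by measurable
  have exp_h: "exp (lam * u) * (enn2real (running f1 u) - enn2real (running f2 u))
      = (\<Sum>n. lam ^ n * (enn2real (h f1 n u) - enn2real (h f2 n u)))" for u
  \<comment> \<open>For u \<le> 0 \<open>ennreal\<close> may truncate a negative power of u, but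
    \<open>running\<close> vanishes there.\<close>
  proof (cases "u \<le> 0")
    case True
    then show ?thesis by (simp add: h_def running_outside)
  next
    case False
    have "(\<lambda>n. (lam * u) ^ n /\<^sub>R fact n * (enn2real (running f1 u) - enn2real (running f2 u))) sums
        (exp (lam * u) * (enn2real (running f1 u) - enn2real (running f2 u)))"
      by (intro sums_mult2 exp_converges)
    moreover have "(lam * u) ^ n /\<^sub>R fact n * (enn2real (running f1 u) - enn2real (running f2 u))
        = lam ^ n * (enn2real (h f1 n u) - enn2real (h f2 n u))" for n
      using False
      by (simp add: h_def enn2real_mult divided_power_def power_mult_distrib right_diff_distrib
          divide_inverse mult_ac)
    ultimately show ?thesis by (simp add: sums_iff)
  qed
  have life: "0 \<le> \<zeta>"
    using chain_time_less_lifetime[of 0] by (simp add: zero_ereal_def)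
  have "discounted_integral lam g x p = (\<integral>s. indicator (einterval 0 (\<zeta>)) s *\<^sub>R
      (exp (lam * s) * (case censored_process x p s of Some y \<Rightarrow> g y | None \<Rightarrow> 0)) \<partial>lborel)"
    using life by (simp add: discounted_integral_def interval_lebesgue_integral_def set_lebesgue_integral_def)
  also have "\<dots> = (\<integral>u. exp (lam * u) * (enn2real (running f1 u) - enn2real (running f2 u)) \<partial>lborel)"
  proof (rule integral_lborel_eq_off_countable[OF countable_image[OF countableI_type]])
    fix u assume "u \<notin> range \<tau>"
    then show "indicator (einterval 0 (\<zeta>)) u *\<^sub>R
      (exp (lam * u) * (case censored_process x p u of Some y \<Rightarrow> g y | None \<Rightarrow> 0))
      = exp (lam * u) * (enn2real (running f1 u) - enn2real (running f2 u))"
    proof (cases rule: off_grid_cases)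
      case 1
      then have "u \<notin> einterval 0 (\<zeta>)" by (auto simp: einterval_iff)
      then show ?thesis using running_outside[OF 1] by simp
    next
      case (2 j)
      define y where "y = \<xi> j - P j (u - \<tau> j)"
      have "P j (u - \<tau> j) < \<xi> j"
        by (subst below_level_iff) (use 2 in auto)
      moreover have "0 \<le> P j (u - \<tau> j)"
        using 2 by (auto intro: path_nonneg[OF paths])
      ultimately have y: "0 < y" "y \<le> x"
        using chain_pos_le[of j] unfolding y_def by linarith+
      have u: "u \<in> einterval 0 (\<zeta>)"
        unfolding einterval_iff using 2(1,2) by simp
      have process: "censored_process x p u = Some y"
        unfolding y_def by (rule censored_process_eq) (use 2(3,4) in auto)
      show ?thesis
        unfolding process running_stage[OF 2(3,4)] y_def[symmetric] indicator_simps(1)[OF u]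
        by (simp add: g[OF y])
    qed
  qed
  also have "\<dots> = (\<integral>u. (\<Sum>n. lam ^ n * (enn2real (h f1 n u) - enn2real (h f2 n u))) \<partial>lborel)"
    unfolding exp_h ..
  also have "\<dots> = (\<Sum>n. lam ^ n * (enn2real (\<integral>\<^sup>+u. h f1 n u \<partial>lborel) - enn2real (\<integral>\<^sup>+u. h f2 n u \<partial>lborel)))"
  proof (rule sums_unique, rule series_integral(2)[where c="\<lambda>n. lam ^ n" and ?h1.0="h f1" and ?h2.0="h f2"
      and N=lborel])
    show "(\<integral>\<^sup>+u. h f1 n u \<partial>lborel) < \<top>" "(\<integral>\<^sup>+u. h f2 n u \<partial>lborel) < \<top>" for n
      using fin[of n] by (simp_all add: h_def sum_stage_integral)
    show "(\<Sum>n. ennreal \<bar>lam ^ n\<bar> * ((\<integral>\<^sup>+u. h f1 n u \<partial>lborel) + (\<integral>\<^sup>+u. h f2 n u \<partial>lborel))) < \<top>"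
      using sum by (simp add: h_def sum_stage_integral)
  qed simp_all
  finally show ?thesis unfolding h_def sum_stage_integral[OF assms(2)] sum_stage_integral[OF assms(3)] .
qed

text \<open>For f = 1 the running functional is almost everywhere the indicator of (0, \<zeta>), so
  the stage sum of order 0 is \<zeta> itself. Its finiteness therefore bounds the lifetime, and
  higher orders integrate u^n/n! up to it.\<close>

lemma lifetime_moments:
  assumes fin: "(\<Sum>j. stage_integral 0 (\<lambda>_. 1) x P j) < \<top>"
  obtains t where "0 \<le> t" "\<zeta> = ereal t"
    "\<And>n. (\<Sum>j. stage_integral n (\<lambda>_. 1) x P j) = ennreal (divided_power (Suc n) t)"
proof -
  have null: "AE u in lborel. u \<notin> range \<tau>"
    by (intro AE_not_in countable_imp_null_set_lborel) auto
  have running: "AE u in lborel. running (\<lambda>_. 1) u = indicator {u. 0 < u \<and> ereal u < \<zeta>} u"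
    using null
  proof eventually_elim
    case (elim u)
    then show ?case
      by (cases rule: off_grid_cases) (auto simp: running_outside running_stage indicator_def)
  qed
  have moment: "(\<Sum>j. stage_integral n (\<lambda>_. 1) x P j)
      = (\<integral>\<^sup>+u. ennreal (divided_power n u) * indicator {u. 0 < u \<and> ereal u < \<zeta>} u \<partial>lborel)" for n
  proof -
    have "(\<Sum>j. stage_integral n (\<lambda>_. 1) x P j)
        = (\<integral>\<^sup>+u. ennreal (divided_power n u) * running (\<lambda>_. 1) u \<partial>lborel)"
      by (rule sum_stage_integral) simp
    also have "\<dots> = (\<integral>\<^sup>+u. ennreal (divided_power n u) * indicator {u. 0 < u \<and> ereal u < \<zeta>} u \<partial>lborel)"
      using running by (intro nn_integral_cong_AE) (auto elim!: eventually_mono)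
    finally show ?thesis .
  qed
  have "\<zeta> \<noteq> \<infinity>"
  proof
    assume inf: "\<zeta> = \<infinity>"
    have "ennreal (real m) \<le> (\<Sum>j. stage_integral 0 (\<lambda>_. 1) x P j)" for m :: nat
    proof -
      have "ennreal (real m) = (\<integral>\<^sup>+u. indicator {0<..real m} u \<partial>lborel)" by simp
      also have "\<dots> \<le> (\<Sum>j. stage_integral 0 (\<lambda>_. 1) x P j)"
        unfolding moment inf by (intro nn_integral_mono) (auto simp: indicator_def divided_power_def)
      finally show ?thesis .
    qed
    moreover obtain r where "0 \<le> r" "(\<Sum>j. stage_integral 0 (\<lambda>_. 1) x P j) = ennreal r"
      using fin by (cases "\<Sum>j. stage_integral 0 (\<lambda>_. 1) x P j") auto
    ultimately have "real m \<le> r" for m :: nat by simp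
    then show False using reals_Archimedean2[of r] by (meson not_less)
  qed
  moreover have "0 < \<zeta>"
    using chain_time_less_lifetime[of 0] by (simp add: zero_ereal_def)
  ultimately obtain t where t: "\<zeta> = ereal t" "0 < t"
    by (cases "\<zeta>") auto
  have "(\<Sum>j. stage_integral n (\<lambda>_. 1) x P j) = ennreal (divided_power (Suc n) t)" for n
  proof -
    have "(\<Sum>j. stage_integral n (\<lambda>_. 1) x P j)
        = (\<integral>\<^sup>+u. ennreal (divided_power n u) * indicator {0..t} u \<partial>lborel)"
      unfolding moment t
      by (intro nn_integral_cong_AE, rule AE_mp[OF AE_lborel_singleton[of 0]], rule
          AE_mp[OF AE_lborel_singleton[of t]])
        (auto simp: indicator_def)
    also have "\<dots> = ennreal (divided_power (Suc n) t - divided_power (Suc n) 0)"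
    proof (rule nn_integral_FTC_Icc)
      fix u :: real
      show "(divided_power (Suc n) has_real_derivative divided_power n u) (at u)"
        unfolding divided_power_def
        by (rule derivative_eq_intros refl | simp)+
    qed (use t in auto)
    finally show ?thesis by (simp add: divided_power_def)
  qed
  then show thesis using t that[of t] by auto
qed

end

context subordinator
begin

lemma passage_chain_distr: "passage_chain \<beta> (distr M path_space X)"
proof (rule passage_chain.intro)
  show "0 < \<beta>" "\<beta> < 1" by (fact beta)+
  show "prob_space (distr M path_space X)" by (rule prob_space_distr) measurable
  show "sets (distr M path_space X) = sets path_space" by simp
next
  fix x :: real assume "0 < x"
  then have "AE \<omega> in M. 0 < path_time (X \<omega>) x"
    using X_path by (auto elim!: eventually_mono intro: path_time_pos)
  then show "AE p in distr M path_space X. 0 < path_time p x"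
    by (subst AE_distr_iff) auto
next
  fix a x :: real and f :: "real \<Rightarrow> ennreal"
  assume a: "0 < a" and f [measurable]: "f \<in> borel_measurable borel"
  show "(\<integral>\<^sup>+p. \<integral>\<^sup>+s. ennreal (frac_kernel a s)
      * (if path_val p s < x then f (x - path_val p s) else 0) \<partial>lborel \<partial>distr M path_space X)
      = frac_int (a * \<beta>) f x"
    by (subst nn_integral_distr) (simp_all add: occupation_formula[OF a f])
next
  fix a x :: real and f :: "real \<Rightarrow> ennreal"
  assume a: "1 \<le> a" "0 < x" and f [measurable]: "f \<in> borel_measurable borel"
  show "(\<integral>\<^sup>+p. ennreal (frac_kernel a (path_time p x)) * f (x - path_left p x) \<partial>distr M path_space X)
      = frac_int (a * \<beta>) (\<lambda>y. ennreal (frac_kernel (1 - \<beta>) y) * f y) x"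
    by (subst nn_integral_distr) (simp_all add: passage_formula[OF a f])
qed

end


section \<open>Expectations for the censored process\<close>

lemma nn_censored_int_pow_mono:
  assumes "\<And>y. 0 < y \<Longrightarrow> y \<le> T \<Longrightarrow> F y \<le> G y" "0 < x" "x \<le> T"
  shows "(nn_censored_int b ^^ n) F x \<le> (nn_censored_int b ^^ n) G x"
  using assms(2,3)
proof (induction n arbitrary: x)
  case (Suc n)
  then show ?case by (auto intro!: nn_censored_int_mono)
qed (use assms(1) in simp)

text \<open>The value at x of the n-th iterate of the censored integral on 1, which is also the n-th
  moment of the lifetime divided by n!.\<close>

definition lifetime_coeff :: "real \<Rightarrow> real \<Rightarrow> nat \<Rightarrow> real" where
  "lifetime_coeff b x n = x powr (b * real n) * (\<Prod>k=1..n. inverse (censor_factor b (real k * b)))"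

lemma lifetime_coeff_nonneg:
  "0 < b \<Longrightarrow> b < 1 \<Longrightarrow> 0 \<le> lifetime_coeff b x n"
  unfolding lifetime_coeff_def
  by (intro mult_nonneg_nonneg prod_nonneg) (auto intro!: less_imp_le[OF censor_factor_pos])

lemma nn_censored_int_pow_const:
  assumes "0 < b" "b < 1" "0 < x"
  shows "(nn_censored_int b ^^ n) (\<lambda>_. 1) x = ennreal (lifetime_coeff b x n)"
proof -
  have "(nn_censored_int b ^^ n) (\<lambda>_. 1) x = (nn_censored_int b ^^ n) (pos_power 0) x"
    by (intro antisym nn_censored_int_pow_mono[where T=x]) (auto simp: pos_power_def assms)
  also have "\<dots> = ennreal (lifetime_coeff b x n)"
    using assms
    by (simp add: nn_censored_int_pow_one pos_power_def lifetime_coeff_def ennreal_mult' mult.commute)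
  finally show ?thesis .
qed

lemma summable_lifetime_coeff:
  assumes "0 < b" "b < 1" "0 < x"
  shows "summable (\<lambda>n. r ^ n * lifetime_coeff b x n)"
proof (rule summable_norm_cancel)
  have "norm (r ^ n * lifetime_coeff b x n)
      = (\<bar>r\<bar> * x powr b) ^ n * (\<Prod>k=1..n. inverse (censor_factor b (real k * b)))" for n
  proof -
    have "(x powr b) ^ n = x powr (b * real n)"
      using assms by (simp add: powr_powr[symmetric] powr_realpow)
    then show ?thesis
      using lifetime_coeff_nonneg[OF assms(1,2), of x n]
      by (simp add: abs_mult power_abs power_mult_distrib) (simp add: lifetime_coeff_def)
  qed
  then show "summable (\<lambda>n. norm (r ^ n * lifetime_coeff b x n))"
    using summable_censor_factor_series[OF assms(1,2), of "\<bar>r\<bar> * x powr b"] by simp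
qed

lemma summable_lifetime_coeff_Suc:
  assumes "0 < b" "b < 1" "0 < x"
  shows "summable (\<lambda>n. \<bar>r\<bar> ^ n * lifetime_coeff b x (Suc n))"
proof (rule summable_comparison_test')
  \<comment> \<open>Shifting the index costs a factor |r|, which cannot be divided out at r = 0; |r|
    + 1 avoids this.\<close>
  show "summable (\<lambda>n. (\<bar>r\<bar> + 1) ^ Suc n * lifetime_coeff b x (Suc n))"
    using summable_lifetime_coeff[OF assms, of "\<bar>r\<bar> + 1"] by (subst summable_Suc_iff)
  fix n
  have "\<bar>r\<bar> ^ n \<le> (\<bar>r\<bar> + 1) ^ n" by (intro power_mono) auto
  also have "\<dots> \<le> (\<bar>r\<bar> + 1) ^ Suc n" by (intro power_increasing) auto
  finally show "norm (\<bar>r\<bar> ^ n * lifetime_coeff b x (Suc n)) \<le> (\<bar>r\<bar> + 1) ^ Suc n * lifetime_coeff b x (Suc n)"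
    using lifetime_coeff_nonneg[OF assms(1,2), of x "Suc n"]
    by (simp add: abs_mult mult_right_mono del: power_Suc)
qed

lemma suminf_ennreal_less_top:
  "summable f \<Longrightarrow> (\<And>n. 0 \<le> f n) \<Longrightarrow> (\<Sum>n. ennreal (f n)) < \<top>"
  by (simp add: ennreal_suminf_neq_top less_top)

section \<open>The i.i.d. sequence of subordinator paths\<close>

locale iid_subordinators =
  fixes \<beta> :: real and M :: "'a measure" and S :: "nat \<Rightarrow> real \<Rightarrow> 'a \<Rightarrow> real"
  assumes beta: "0 < \<beta>" "\<beta> < 1"
    and prob: "prob_space M"
    and stable: "\<And>j. j \<ge> 1 \<Longrightarrow> stable_subordinator \<beta> M (\<lambda>t \<omega>. - S j t \<omega>)"
    and iid: "iid_processes M (\<lambda>j t \<omega>. - S j t \<omega>)"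
begin

sublocale prob_space M by (rule prob)

definition paths :: "'a \<Rightarrow> nat \<Rightarrow> real \<Rightarrow> real" where
  "paths \<omega> j = (\<lambda>t\<in>{0..}. - S (Suc j) t \<omega>)"

lemma subordinator_Suc: "subordinator \<beta> M (\<lambda>t \<omega>. - S (Suc j) t \<omega>)"
  using beta stable by (simp add: subordinator_def)

lemma X_eq: "subordinator.X (\<lambda>t \<omega>. - S (Suc j) t \<omega>) = (\<lambda>\<omega>. paths \<omega> j)"
  by (simp add: fun_eq_iff subordinator.X_def[OF subordinator_Suc] paths_def)

lemma measurable_path_j [measurable]: "(\<lambda>\<omega>. paths \<omega> j) \<in> measurable M path_space"
  using subordinator.measurable_X[OF subordinator_Suc, of j] by (simp add: X_eq)

definition Q :: "(real \<Rightarrow> real) measure" where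
  "Q = distr M path_space (\<lambda>\<omega>. paths \<omega> 0)"

sublocale C: passage_chain \<beta> Q
  using subordinator.passage_chain_distr[OF subordinator_Suc, of 0] by (simp add: Q_def X_eq)

lemma distr_path: "distr M path_space (\<lambda>\<omega>. paths \<omega> j) = Q"
proof -
  have "\<forall>i\<ge>1. \<forall>j\<ge>1. distr M path_space (\<lambda>\<omega>. \<lambda>t\<in>{0..}. - S i t \<omega>)
      = distr M path_space (\<lambda>\<omega>. \<lambda>t\<in>{0..}. - S j t \<omega>)"
    using iid unfolding iid_processes_def by blast
  then show ?thesis unfolding Q_def paths_def by simp
qed

lemma measurable_paths [measurable]: "paths \<in> measurable M C.S"
proof -
  have "paths \<in> measurable M (Pi\<^sub>M UNIV (\<lambda>_. path_space))"
    by (rule measurable_PiM_single') (auto simp: measurable_space[OF measurable_path_j])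
  then show ?thesis
    by (simp add: measurable_cong_sets[OF refl sets_PiM_cong[OF refl C.sets_Q]])
qed

text \<open>Independence gives a product law over the indices from 1 on, and reindexing by
  \<open>Suc\<close> moves it to all naturals.\<close>

lemma distr_paths: "distr M C.S paths = C.S"
proof -
  define Y where "Y j \<omega> = (\<lambda>t\<in>{0..}. - S j t \<omega>)" for j \<omega>
  have Y: "Y (Suc j) \<omega> = paths \<omega> j" for j \<omega> by (simp add: Y_def paths_def)
  have rv: "random_variable path_space (Y j)" if "j \<in> {1..}" for j
    using that Y[of "j - 1"] measurable_path_j[of "j - 1"] by (simp add: Y_def[abs_def] paths_def)
  have dist: "distr M path_space (Y j) = Q" if "j \<in> {1..}" for j
    using that distr_path[of "j - 1"] by (simp add: Y_def[abs_def] paths_def)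
  have "indep_vars (\<lambda>_. path_space) Y {1..}"
    using iid unfolding iid_processes_def Y_def by blast
  then have "distr M (Pi\<^sub>M {1..} (\<lambda>_. path_space)) (\<lambda>\<omega>. \<lambda>i\<in>{1..}. Y i \<omega>)
      = Pi\<^sub>M {1..} (\<lambda>i. distr M path_space (Y i))"
    by (subst (asm) indep_vars_iff_distr_eq_PiM') (auto simp: rv)
  also have "\<dots> = Pi\<^sub>M {1..} (\<lambda>_. Q)"
    by (intro PiM_cong) (auto simp: dist)
  finally have joint: "distr M (Pi\<^sub>M {1..} (\<lambda>_. path_space)) (\<lambda>\<omega>. \<lambda>i\<in>{1..}. Y i \<omega>) = Pi\<^sub>M {1..} (\<lambda>_. Q)" .
  have sets_eq: "sets (Pi\<^sub>M {1..} (\<lambda>_. Q)) = sets (Pi\<^sub>M {1::nat..} (\<lambda>_. path_space))"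
    by (intro sets_PiM_cong) (auto simp: C.sets_Q)
  have mY: "(\<lambda>\<omega>. \<lambda>i\<in>{1..}. Y i \<omega>) \<in> measurable M (Pi\<^sub>M {1..} (\<lambda>_. path_space))"
    by (rule measurable_restrict) (auto simp: rv)
  have shift: "(\<lambda>w. \<lambda>n\<in>UNIV. w (Suc n)) \<in> measurable (Pi\<^sub>M {1..} (\<lambda>_. path_space)) C.S"
    unfolding measurable_cong_sets[OF sets_eq[symmetric] refl]
    by (rule measurable_restrict) (rule measurable_component_singleton, simp)
  have "C.S = distr (Pi\<^sub>M {1..} (\<lambda>_. Q)) C.S (\<lambda>w. \<lambda>n\<in>UNIV. w (Suc n))"
    by (rule distr_PiM_reindex[symmetric]) (auto intro: C.prob_Q)
  also have "\<dots> = distr M C.S ((\<lambda>w. \<lambda>n\<in>UNIV. w (Suc n)) \<circ> (\<lambda>\<omega>. \<lambda>i\<in>{1..}. Y i \<omega>))"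
    unfolding joint[symmetric] by (rule distr_distr[OF shift mY])
  also have "((\<lambda>w. \<lambda>n\<in>UNIV. w (Suc n)) \<circ> (\<lambda>\<omega>. \<lambda>i\<in>{1..}. Y i \<omega>)) = paths"
    by (simp add: fun_eq_iff Y)
  finally show ?thesis ..
qed

definition stage_total :: "nat \<Rightarrow> (real \<Rightarrow> ennreal) \<Rightarrow> real \<Rightarrow> 'a \<Rightarrow> ennreal" where
  "stage_total n f x \<omega> = (\<Sum>j. stage_integral n f x (paths \<omega>) j)"

lemma measurable_stage_total [measurable]:
  assumes [measurable]: "f \<in> borel_measurable borel"
  shows "stage_total n f x \<in> borel_measurable M"
  unfolding stage_total_def by measurable

lemma stage_total_expectation:
  assumes f [measurable]: "f \<in> borel_measurable borel" and "0 < x"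
  shows "(\<integral>\<^sup>+\<omega>. stage_total n f x \<omega> \<partial>M) = (nn_censored_int \<beta> ^^ Suc n) f x"
    (is "?lhs = _")
proof -
  have "?lhs = (\<integral>\<^sup>+P. (\<Sum>j. stage_integral n f x P j) \<partial>distr M C.S paths)"
    unfolding stage_total_def by (subst nn_integral_distr) auto
  also have "\<dots> = (nn_censored_int \<beta> ^^ Suc n) f x"
    unfolding distr_paths by (rule C.nn_integral_stage_sum[OF f assms(2)])
  finally show ?thesis .
qed

lemma AE_regular_paths:
  assumes "0 < x"
  shows "AE \<omega> in M. regular_paths x (paths \<omega>) (\<lambda>j t. S j t \<omega>)"
proof -
  have "AE \<omega> in M. \<forall>j. subordinator_path (paths \<omega> j)"
    using subordinator.X_path[OF subordinator_Suc] by (simp add: AE_all_countable X_eq)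
  moreover have "AE \<omega> in M. \<forall>j. 0 < chain_pos x (paths \<omega>) j"
    by (rule AE_distrD[OF measurable_paths]) (unfold distr_paths, rule C.chain_pos_positive[OF assms])
  ultimately show ?thesis
    by eventually_elim (auto simp: regular_paths_def paths_def)
qed

theorem discounted_expectation:
  assumes g: "continuous_on {0..T} g" and x: "0 < x" "x \<le> T"
  shows "integrable (completion M) (\<lambda>\<omega>. discounted_integral lam g x (\<lambda>j t. S j t \<omega>)) \<and>
    (\<lambda>j. lam ^ j * (censored_integral \<beta> ^^ (j + 1)) g x) sums
      (\<integral>\<omega>. discounted_integral lam g x (\<lambda>j t. S j t \<omega>) \<partial>completion M)"
proof -
  let ?D = "\<lambda>\<omega>. discounted_integral lam g x (\<lambda>j t. S j t \<omega>)"
  \<comment> \<open>Clamping extends g from [0,T] to a bounded continuous function on the line; the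
    process takes values in (0,x], where nothing changes.\<close>
  define gt where "gt y = g (max 0 (min T y))" for y
  have gt_eq: "gt y = g y" if "0 < y" "y \<le> T" for y using that by (simp add: gt_def)
  have "continuous_on UNIV gt"
    unfolding gt_def using x
    by (intro continuous_on_compose2[OF g] continuous_intros) auto
  then have [measurable]: "gt \<in> borel_measurable borel" by (rule borel_measurable_continuous_onI)
  have "bounded (g ` {0..T})"
    using compact_continuous_image[OF g] by (simp add: compact_imp_bounded)
  then obtain K where "\<forall>y\<in>{0..T}. \<bar>g y\<bar> \<le> K" by (auto simp: bounded_iff)
  then have K: "\<bar>gt y\<bar> \<le> K" for y using x by (simp add: gt_def)
  then have "0 \<le> K" using abs_ge_zero order_trans by blast
  \<comment> \<open>\<open>ennreal\<close> truncates negative reals at 0, so \<open>f1\<close> and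
    \<open>f2\<close> are the positive and negative parts.\<close>
  define f1 where "f1 y = ennreal (gt y)" for y
  define f2 where "f2 y = ennreal (- gt y)" for y
  have [measurable]: "f1 \<in> borel_measurable borel" "f2 \<in> borel_measurable borel"
    unfolding f1_def f2_def by measurable
  have rep: "g y = enn2real (f1 y) - enn2real (f2 y)" if "0 < y" "y \<le> T" for y
    unfolding gt_eq[OF that, symmetric] f1_def f2_def by (cases "0 \<le> gt y") (auto simp: ennreal_neg)
  have bound: "(nn_censored_int \<beta> ^^ n) f r \<le> ennreal (K * lifetime_coeff \<beta> r n)"
    if f: "\<And>y. f y \<le> ennreal K" and r: "0 < r" for f n r
  proof -
    have "(nn_censored_int \<beta> ^^ n) f r \<le> ennreal K * (nn_censored_int \<beta> ^^ n) (pos_power 0) r"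
      by (rule nn_censored_int_pow_le[OF beta _ r order_refl]) (rule f)
    also have "(nn_censored_int \<beta> ^^ n) (pos_power 0) r = (nn_censored_int \<beta> ^^ n) (\<lambda>_. 1) r"
      by (intro antisym nn_censored_int_pow_mono[where T=r]) (auto simp: pos_power_def r)
    finally show ?thesis
      using \<open>0 \<le> K\<close> r by (simp add: nn_censored_int_pow_const[OF beta] ennreal_mult')
  qed
  have fK: "f1 y \<le> ennreal K" "f2 y \<le> ennreal K" for y
    using K[of y] unfolding f1_def f2_def by (intro ennreal_leI; simp)+
  have fin1: "(nn_censored_int \<beta> ^^ n) f1 r < \<top>" and fin2: "(nn_censored_int \<beta> ^^ n) f2 r < \<top>" if "0 < r"
      for r n
    using le_less_trans[OF bound[of f1, OF fK(1) that] ennreal_less_top]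
      le_less_trans[OF bound[of f2, OF fK(2) that] ennreal_less_top] by blast+
  define a1 where "a1 n = (\<integral>\<^sup>+\<omega>. stage_total n f1 x \<omega> \<partial>M)" for n
  define a2 where "a2 n = (\<integral>\<^sup>+\<omega>. stage_total n f2 x \<omega> \<partial>M)" for n
  have a: "a1 n = (nn_censored_int \<beta> ^^ Suc n) f1 x" "a2 n = (nn_censored_int \<beta> ^^ Suc n) f2 x" for n
    unfolding a1_def a2_def by (rule stage_total_expectation[OF _ x(1)]; simp)+
  have coeff: "(censored_integral \<beta> ^^ (j + 1)) g x = enn2real (a1 j) - enn2real (a2 j)" for j
    unfolding a Suc_eq_plus1[symmetric]
    by (rule censored_integral_pow_rep[OF beta _ _ rep]) (assumption | rule fin1 fin2 x | simp)+
  have a_fin: "a1 n < \<top>" "a2 n < \<top>" for n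
    unfolding a by (rule fin1[OF x(1)] fin2[OF x(1)])+
  \<comment> \<open>Both parts are at most K, so their iterates are at most K times those of 1; the
    lifetime series then supplies absolute convergence.\<close>
  have sum: "(\<Sum>n. ennreal \<bar>lam ^ n\<bar> * (a1 n + a2 n)) < \<top>"
  proof -
    have "ennreal \<bar>lam ^ n\<bar> * (a1 n + a2 n) \<le> ennreal (\<bar>lam\<bar> ^ n * lifetime_coeff \<beta> x (Suc n) * (2 * K))"
        for n
    proof -
      have "a1 n + a2 n \<le> ennreal (K * lifetime_coeff \<beta> x (Suc n)) + ennreal (K * lifetime_coeff \<beta> x (Suc n))"
        unfolding a by (intro add_mono bound fK x)
      also have "\<dots> = ennreal (2 * K * lifetime_coeff \<beta> x (Suc n))"
        using \<open>0 \<le> K\<close> lifetime_coeff_nonneg[OF beta] by (simp add: ennreal_plus[symmetric] del: ennreal_plus)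
      finally have "ennreal \<bar>lam ^ n\<bar> * (a1 n + a2 n)
          \<le> ennreal \<bar>lam ^ n\<bar> * ennreal (2 * K * lifetime_coeff \<beta> x (Suc n))"
        by (intro mult_left_mono) auto
      then show ?thesis by (simp add: ennreal_mult'[symmetric] power_abs mult_ac)
    qed
    then have "(\<Sum>n. ennreal \<bar>lam ^ n\<bar> * (a1 n + a2 n))
        \<le> (\<Sum>n. ennreal (\<bar>lam\<bar> ^ n * lifetime_coeff \<beta> x (Suc n) * (2 * K)))"
      by (intro suminf_le) auto
    also have "\<dots> < \<top>"
      using \<open>0 \<le> K\<close> lifetime_coeff_nonneg[OF beta]
      by (intro suminf_ennreal_less_top summable_mult2 summable_lifetime_coeff_Suc beta x) auto
    finally show ?thesis .
  qed
  define D where "D \<omega> = (\<Sum>n. lam ^ n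
      * (enn2real (stage_total n f1 x \<omega>) - enn2real (stage_total n f2 x \<omega>)))" for \<omega>
  have D_int: "integrable M D"
    and D_sums: "(\<lambda>n. lam ^ n * (enn2real (a1 n) - enn2real (a2 n))) sums (\<integral>\<omega>. D \<omega> \<partial>M)"
    and D_fin: "AE \<omega> in M. (\<Sum>n. ennreal \<bar>lam ^ n\<bar> * (stage_total n f1 x \<omega> + stage_total n f2 x \<omega>)) < \<top>"
    unfolding D_def a1_def a2_def using a_fin sum
    by (intro series_integral; simp add: a1_def a2_def)+
  have "AE \<omega> in M. \<forall>n. stage_total n f1 x \<omega> < \<top> \<and> stage_total n f2 x \<omega> < \<top>"
  proof (subst AE_all_countable, intro allI)
    fix n
    have "AE \<omega> in M. stage_total n f1 x \<omega> \<noteq> \<infinity>" "AE \<omega> in M. stage_total n f2 x \<omega> \<noteq> \<infinity>"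
      using a_fin[of n] unfolding a1_def a2_def by (intro nn_integral_PInf_AE; simp)+
    then show "AE \<omega> in M. stage_total n f1 x \<omega> < \<top> \<and> stage_total n f2 x \<omega> < \<top>"
      by eventually_elim (simp add: less_top)
  qed
  with AE_regular_paths[OF x(1)] D_fin
  have eq: "AE \<omega> in M. ?D \<omega> = D \<omega>"
  proof eventually_elim
    case (elim \<omega>)
    then interpret R: regular_paths x "paths \<omega>" "\<lambda>j t. S j t \<omega>" by simp
    show ?case
      unfolding D_def stage_total_def
      by (rule R.discounted_integral_eq) (use elim x rep in \<open>auto simp: stage_total_def\<close>)
  qed
  have D_meas: "D \<in> borel_measurable M" using D_int by (rule borel_measurable_integrable)
  \<comment> \<open>\<open>?D\<close> agrees with \<open>D\<close> only off a null set of irregular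
    paths, so measurability is obtained for the completion.\<close>
  have meas: "?D \<in> borel_measurable (completion M)"
    by (rule measurable_completion_AE[OF D_meas eq])
  have eq': "AE \<omega> in completion M. ?D \<omega> = D \<omega>"
    using eq by (rule AE_completion)
  have "integrable (completion M) ?D"
    using D_int integrable_cong_AE[OF meas measurable_completion[OF D_meas] eq']
        integrable_completion[OF D_meas] by simp
  moreover have "(\<integral>\<omega>. ?D \<omega> \<partial>completion M) = (\<integral>\<omega>. D \<omega> \<partial>M)"
    using integral_cong_AE[OF meas measurable_completion[OF D_meas] eq'] integral_completion[OF D_meas]
        by simp
  ultimately show ?thesis
    using D_sums unfolding coeff by simp
qed

theorem exponential_lifetime_moment:
  assumes x: "0 < x"
  shows "(\<lambda>\<omega>. exp_ereal (ereal lam * censored_lifetime x (\<lambda>j t. S j t \<omega>))) \<in> borel_measurable (completion M) \<and>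
    summable (\<lambda>n. lam ^ n * lifetime_coeff \<beta> x n) \<and>
    enn2ereal (\<integral>\<^sup>+\<omega>. exp_ereal (ereal lam * censored_lifetime x (\<lambda>j t. S j t \<omega>)) \<partial>completion M) =
      ereal (\<Sum>n. lam ^ n * lifetime_coeff \<beta> x n)"
proof -
  let ?E = "\<lambda>\<omega>. exp_ereal (ereal lam * censored_lifetime x (\<lambda>j t. S j t \<omega>))"
  \<comment> \<open>The stage total of order m is the lifetime to the power m + 1 over (m + 1)!, so
    the constant term of the exponential series is put in separately.\<close>
  define h where "h n \<omega> = (case n of 0 \<Rightarrow> 1 | Suc m \<Rightarrow> stage_total m (\<lambda>_. 1) x \<omega>)" for n \<omega>
  have [measurable]: "h n \<in> borel_measurable M" for n
    unfolding h_def by (cases n) auto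
  have h_int: "(\<integral>\<^sup>+\<omega>. h n \<omega> \<partial>M) = ennreal (lifetime_coeff \<beta> x n)" for n
  proof (cases n)
    case 0
    then show ?thesis using x by (simp add: h_def emeasure_space_1 lifetime_coeff_def)
  next
    case (Suc m)
    then show ?thesis
      using nn_censored_int_pow_const[OF beta x, of n] stage_total_expectation[of "\<lambda>_. 1" x m] x
          by (simp add: h_def)
  qed
  note nonneg = lifetime_coeff_nonneg[OF beta, of x]
  have sum: "(\<Sum>n. ennreal \<bar>lam ^ n\<bar> * ((\<integral>\<^sup>+\<omega>. h n \<omega> \<partial>M) + (\<integral>\<^sup>+\<omega>. 0 \<partial>M))) < \<top>"
  proof -
    have "(\<Sum>n. ennreal (\<bar>lam\<bar> ^ n * lifetime_coeff \<beta> x n)) < \<top>"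
      using nonneg by (intro suminf_ennreal_less_top summable_lifetime_coeff beta x) auto
    then show ?thesis
      using nonneg by (simp add: h_int ennreal_mult'[symmetric] power_abs)
  qed
  define D where "D \<omega> = (\<Sum>n. lam ^ n * (enn2real (h n \<omega>) - enn2real 0))" for \<omega>
  have D_int: "integrable M D"
    and D_sums: "(\<lambda>n. lam ^ n * (enn2real (\<integral>\<^sup>+\<omega>. h n \<omega> \<partial>M) - enn2real (\<integral>\<^sup>+\<omega>. 0 \<partial>M))) sums (\<integral>\<omega>. D \<omega> \<partial>M)"
    unfolding D_def using sum
    by (intro series_integral; simp add: h_int)+
  \<comment> \<open>\<open>h 1\<close> is the lifetime itself; once it is finite along a path, all
    its higher powers are known there as well.\<close>
  have "AE \<omega> in M. h 1 \<omega> \<noteq> \<infinity>"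
    by (intro nn_integral_PInf_AE) (auto simp: h_int)
  with AE_regular_paths[OF x]
  have eq: "AE \<omega> in M. ?E \<omega> = ennreal (D \<omega>) \<and> 0 \<le> D \<omega>"
  proof eventually_elim
    case (elim \<omega>)
    then interpret R: regular_paths x "paths \<omega>" "\<lambda>j t. S j t \<omega>" by simp
    have "(\<Sum>j. stage_integral 0 (\<lambda>_. 1) x (paths \<omega>) j) < \<top>"
      using elim(2) by (simp add: h_def stage_total_def less_top)
    then obtain t where t: "0 \<le> t" "censored_lifetime x (\<lambda>j t. S j t \<omega>) = ereal t"
      "\<And>n. (\<Sum>j. stage_integral n (\<lambda>_. 1) x (paths \<omega>) j) = ennreal (divided_power (Suc n) t)"
      by (rule R.lifetime_moments) (rule that)
    have h: "enn2real (h n \<omega>) = t ^ n / fact n" for n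
      using t(1) by (cases n) (simp_all add: h_def stage_total_def t(3), simp add: divided_power_def)
    have "D \<omega> = (\<Sum>n. (lam * t) ^ n /\<^sub>R fact n)"
      unfolding D_def h by (simp add: power_mult_distrib divide_inverse mult_ac)
    then have "D \<omega> = exp (lam * t)" by (simp add: exp_def)
    then show ?case by (simp add: t(2) exp_ereal_def)
  qed
  have [measurable]: "D \<in> borel_measurable M" using D_int by (rule borel_measurable_integrable)
  have "?E \<in> borel_measurable (completion M)"
    by (rule measurable_completion_AE[where g="\<lambda>\<omega>. ennreal (D \<omega>)"]) (use eq in auto)
  moreover have sums: "(\<lambda>n. lam ^ n * lifetime_coeff \<beta> x n) sums (\<integral>\<omega>. D \<omega> \<partial>M)"
    using D_sums nonneg by (simp add: h_int)
  moreover have "(\<integral>\<^sup>+\<omega>. ?E \<omega> \<partial>completion M)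
      = ennreal (\<integral>\<omega>. D \<omega> \<partial>M)"
  proof -
    have "(\<integral>\<^sup>+\<omega>. ?E \<omega> \<partial>completion M) = (\<integral>\<^sup>+\<omega>. ennreal (D \<omega>) \<partial>M)"
      unfolding nn_integral_completion using eq by (intro nn_integral_cong_AE) auto
    also have "\<dots> = ennreal (\<integral>\<omega>. D \<omega> \<partial>M)"
      using D_int eq by (intro nn_integral_eq_integral) auto
    finally show ?thesis .
  qed
  moreover have "0 \<le> (\<integral>\<omega>. D \<omega> \<partial>M)"
    using eq by (intro integral_nonneg_AE) auto
  ultimately show ?thesis
    by (simp add: sums_iff enn2ereal_ennreal)
qed

end

theorem theorem4p12:
  fixes \<beta> :: real
    and M :: "'a measure"
    and S :: "nat \<Rightarrow> real \<Rightarrow> 'a \<Rightarrow> real"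
  assumes "0 < \<beta>" and "\<beta> < 1"
    and "prob_space M"
    and "\<And>j. j \<ge> 1 \<Longrightarrow> stable_subordinator \<beta> M (\<lambda>t \<omega>. - S j t \<omega>)"
    and "iid_processes M (\<lambda>j t \<omega>. - S j t \<omega>)"
  shows "(\<forall>(lam::real) (T::real) (g :: real \<Rightarrow> real) (x::real).
           lam < 0 \<and> T > 0 \<and> continuous_on {0..T} g \<and> x \<in> {0<..T} \<longrightarrow>
             integrable (completion M) (\<lambda>\<omega>. discounted_integral lam g x (\<lambda>j t. S j t \<omega>)) \<and>
             (\<lambda>j. lam ^ j * (censored_integral \<beta> ^^ (j + 1)) g x) sums
               (\<integral>\<omega>. discounted_integral lam g x (\<lambda>j t. S j t \<omega>) \<partial>completion M)) \<and>
         (\<forall>(lam::real) (x::real). x > 0 \<longrightarrow>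
           (\<lambda>\<omega>. exp_ereal (ereal lam * censored_lifetime x (\<lambda>j t. S j t \<omega>)))
             \<in> borel_measurable (completion M) \<and>
           summable (\<lambda>N. lam ^ N * x powr (\<beta> * real N) *
             (\<Prod>n=1..N. inverse (Gamma (1 + real n * \<beta>) / Gamma (real n * \<beta> + 1 - \<beta>)
                                 - 1 / Gamma (1 - \<beta>)))) \<and>
           enn2ereal (\<integral>\<^sup>+\<omega>. exp_ereal (ereal lam * censored_lifetime x (\<lambda>j t. S j t \<omega>)) \<partial>completion M) =
           ereal (\<Sum>N. lam ^ N * x powr (\<beta> * real N) *
             (\<Prod>n=1..N. inverse (Gamma (1 + real n * \<beta>) / Gamma (real n * \<beta> + 1 - \<beta>)
                                 - 1 / Gamma (1 - \<beta>)))))"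
proof -
  interpret iid_subordinators \<beta> M S
    using assms by (simp add: iid_subordinators_def)
  have coeff: "lam ^ N * x powr (\<beta> * real N) *
      (\<Prod>n=1..N. inverse (Gamma (1 + real n * \<beta>) / Gamma (real n * \<beta> + 1 - \<beta>) - 1 / Gamma (1 - \<beta>)))
    = lam ^ N * lifetime_coeff \<beta> x N" for lam x :: real and N
    by (simp add: lifetime_coeff_def censor_factor_def mult.assoc)
  show ?thesis
    unfolding coeff using discounted_expectation exponential_lifetime_moment
    by (auto simp del: funpow.simps)
qed

end
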